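(* For every $\lambda<-2/\sqrt[4]{27}$ and every rational number $q=m/n\in \mathrm{J}_\lambda\cap\mathbb{Q}$, there exists $\mathfrak{p}=(\lambda,e_2)\in\mathcal{T}$ such that the standard BT-curve $\gamma_{\mathfrak p}$ is a BT-string (i.e. $\gamma_{\mathfrak p}$ is closed) and $\mathcal{P}(\mathfrak{p})=q$.
   Context: **Hyperbolic plane and curves.** $\mathbb{R}^{1,2}$ is $\mathbb{R}^3$ with the inner product $\vec x\cdot\vec y=-x^1y^1+x^2y^2+x^3y^3$ and the cross product defined by $(\vec x\times\vec y)\cdot\vec w=\det(\vec x,\vec y,\vec w)$. The hyperbolic plane is $\mathcal{H}^2=\{\vec x\in\mathbb{R}^{1,2}: \vec x\cdot\vec x=-1,\ x^1>0\}$ with the induced metric. For a curve $\gamma$ in $\mathcal{H}^2$ with arc length $s$, a dot denotes $d/ds$ and the geodesic curvature $\kappa$ is defined by $\ddot\gamma=\gamma+\kappa\,\gamma\times\dot\gamma$. A curve is convex if $\kappa$ never vanishes, and it is then oriented so that $\kappa>0$; its Blaschke invariant is $\mu=\sqrt\kappa$. A curve defined on $\mathbb{R}$ is closed if it is periodic. **B-curves.** A B-curve is a convex curve whose Blaschke invariant is a non-constant periodic solution of $\dot\mu^2=-\mu^2Q_{\lambda,c}(\mu)$ for some $\lambda,c\in\mathbb{R}$, where $Q_{\lambda,c}(x)=x^4+4\lambda x^3+4(\lambda^2-c)x^2-1$. It is a BT-curve if its momentum $\vec\xi=\frac1{2\mu}\gamma+\frac{\dot\mu}{2\mu^2}\dot\gamma-(\lambda+\frac\mu2)\gamma\times\dot\gamma$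 (a constant vector with $\vec\xi\cdot\vec\xi=c$) is time-like. A closed BT-curve is called a BT-string. **Moduli.** Let $\mathfrak{P}=\{(\lambda,e_2)\in\mathbb{R}^2: e_2>0,\ e_2^4+2\lambda e_2^3+1<0\}$. For $\mathfrak p=(\lambda,e_2)\in\mathfrak P$ there is a unique $c=c(\lambda,e_2)$ with $Q_{\lambda,c}(e_2)=0$, namely $c=\lambda^2+\lambda e_2+\frac{e_2^2}{4}-\frac{1}{4e_2^2}$; then $Q_{\lambda,c}$ has four distinct real roots $e_1>e_2>e_3>0>e_4$. Let $\mu_{\mathfrak p}$ be the solution of $\ddot\mu=\frac{2\dot\mu^2}{\mu}-\mu-2\lambda\mu^4-\mu^5$ with $\mu(0)=e_2$, $\dot\mu(0)=0$; it is positive, non-constant, periodic and satisfies $\dot\mu_{\mathfrak p}^2=-\mu_{\mathfrak p}^2Q_{\lambda,c}(\mu_{\mathfrak p})$. Let $\omega_{\mathfrak p}$ be its least period. Set $\mathcal{T}=\{(\lambda,e_2)\in\mathfrak P: c(\lambda,e_2)<0\}$. **Decomposition of $\mathcal T$.** For $\lambda<-2/\sqrt[4]{27}$ let $0<\eta_-(\lambda)<\eta_+(\lambda)$ be the two real roots of $x^4+2\lambda x^3+1$. Let $a(\lambda)=\sqrt{\lambda^2-1}-\lambda$ if $\lambda\le-1$ and $a(\lambda)=\eta_-(\lambda)$ if $-1<\lambda<-2/\sqrt[4]{27}$. Then $(\lambda,e_2)\in\mathcal T$ iff $\lambda<-2/\sqrt[4]{27}$ and $a(\lambda)<e_2<\eta_+(\lambda)$.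 Let $\varphi=(1+\sqrt5)/2$. The exceptional locus $\mathcal E=\{(\lambda,e_2)\in\mathfrak P: 1+4ce_1^2=0\}$ (contained in $\mathcal T$) is the graph of a function $\mathfrak c:(-\infty,-\sqrt[4]{\varphi^5}/2)\to(\sqrt[4]{\varphi},+\infty)$ with $a(\lambda)<\mathfrak c(\lambda)<\eta_+(\lambda)$. Set $\mathcal T_-=\{(\lambda,e_2): \lambda<-\sqrt[4]{\varphi^5}/2,\ a(\lambda)<e_2<\mathfrak c(\lambda)\}$ and $\mathcal T_+=\{(\lambda,e_2):\lambda<-\sqrt[4]{\varphi^5}/2,\ \mathfrak c(\lambda)<e_2<\eta_+(\lambda)\}\cup\{(\lambda,e_2): -\sqrt[4]{\varphi^5}/2\le\lambda<-2/\sqrt[4]{27},\ a(\lambda)<e_2<\eta_+(\lambda)\}$, so that $\mathcal T=\mathcal T_-\cup\mathcal E\cup\mathcal T_+$ is a disjoint union. **Radial and angular functions; standard BT-curve.** For $\mathfrak p\in\mathcal T\setminus\mathcal E$: $\varrho_{\mathfrak p}=\frac{\sqrt{1+4c\mu_{\mathfrak p}^2}}{2\sqrt{|c|}\mu_{\mathfrak p}}$ and $\Theta_{\mathfrak p}(s)=2\sqrt{|c|}\int_0^s\frac{\mu_{\mathfrak p}^2(\mu_{\mathfrak p}+2\lambda)}{1+4c\mu_{\mathfrak p}^2}ds$. For $\mathfrak p\in\mathcal E$: $\varrho_{\mathfrak p}$ is the $2\omega_{\mathfrak p}$-periodic function equal to $\frac{\sqrt{1+4c\mu_{\mathfrak p}^2}}{2\sqrt{|c|}\mu_{\mathfrak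 p}}$ on $[-\frac{\omega_{\mathfrak p}}2,\frac{\omega_{\mathfrak p}}2]$ and to $-\frac{\sqrt{1+4c\mu_{\mathfrak p}^2}}{2\sqrt{|c|}\mu_{\mathfrak p}}$ on $[\frac{\omega_{\mathfrak p}}2,\frac{3\omega_{\mathfrak p}}2]$, and $\Theta_{\mathfrak p}(s)=-8\sqrt{|c|}\lambda^2\int_0^s\frac{\mu_{\mathfrak p}^2}{\mu_{\mathfrak p}-2\lambda}ds$. The standard BT-curve with modulus $\mathfrak p$ is $\gamma_{\mathfrak p}=\left(\frac{1}{2\sqrt{|c|}\mu_{\mathfrak p}},-\varrho_{\mathfrak p}\cos\Theta_{\mathfrak p},\varrho_{\mathfrak p}\sin\Theta_{\mathfrak p}\right):\mathbb R\to\mathcal H^2$. **Period map.** $\mathcal P:\mathcal T\to\mathbb R$ is $\mathcal P(\mathfrak p)=-\frac1{2\pi}\Theta_{\mathfrak p}(\omega_{\mathfrak p})+1$ if $\mathfrak p\in\mathcal T_-$; $-\frac1{2\pi}\Theta_{\mathfrak p}(\omega_{\mathfrak p})+\frac12$ if $\mathfrak p\in\mathcal E$; $-\frac1{2\pi}\Theta_{\mathfrak p}(\omega_{\mathfrak p})$ if $\mathfrak p\in\mathcal T_+$. **The interval $\mathrm J_\lambda$.** Let $\chi(\lambda)=\frac{\eta_+(\lambda)^4-1}{\sqrt{\eta_+(\lambda)^8-4\eta_+(\lambda)^4+3}}$ for $\lambda<-2/\sqrt[4]{27}$. Then $\mathrm J_\lambda=(1,\chi(\lambda))$ if $\lambda\le-1$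 and $\mathrm J_\lambda=(\chi(\lambda),+\infty)$ if $-1<\lambda<-2/\sqrt[4]{27}$. *)

theory Defs
  imports "HOL-Analysis.Analysis"
begin

section \<open>Minkowski space and the hyperbolic plane\<close>

definition lorentz :: "real^3 \<Rightarrow> real^3 \<Rightarrow> real" where
  "lorentz x y = - (x$1 * y$1) + x$2 * y$2 + x$3 * y$3"

definition lcross :: "real^3 \<Rightarrow> real^3 \<Rightarrow> real^3" where
  "lcross x y = vector [- (cross3 x y $ 1), cross3 x y $ 2, cross3 x y $ 3]"

text \<open>The Lorentzian cross product is the unique vector representing the determinant.\<close>

lemma lorentz_lcross: "lorentz (lcross x y) w = det (vector [x, y, w] :: real^3^3)"
  by (simp add: lorentz_def lcross_def cross3_def det_3 vector_3 algebra_simps)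

lemma lcross_unique:
  assumes "\<And>w. lorentz z w = det (vector [x, y, w] :: real^3^3)"
  shows "z = lcross x y"
proof -
  have eq: "lorentz z w = lorentz (lcross x y) w" for w
    by (simp add: assms lorentz_lcross)
  show ?thesis
    using eq[of "axis 1 1"] eq[of "axis 2 1"] eq[of "axis 3 1"]
    by (simp add: lorentz_def axis_def vec_eq_iff forall_3)
qed

definition timelike :: "real^3 \<Rightarrow> bool" where
  "timelike x \<longleftrightarrow> lorentz x x < 0"

definition hyperbolic_plane :: "(real^3) set" where
  "hyperbolic_plane = {x. lorentz x x = -1 \<and> x$1 > 0}"

section \<open>Curves in the hyperbolic plane\<close>

definition periodic_with :: "(real \<Rightarrow> 'a) \<Rightarrow> real \<Rightarrow> bool" where
  "periodic_with f T \<longleftrightarrow> T > 0 \<and> (\<forall>s. f (s + T) = f s)"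

definition periodic :: "(real \<Rightarrow> 'a) \<Rightarrow> bool" where
  "periodic f \<longleftrightarrow> (\<exists>T. periodic_with f T)"

definition least_period :: "(real \<Rightarrow> 'a) \<Rightarrow> real" where
  "least_period f = (LEAST T. periodic_with f T)"

definition nonconstant :: "(real \<Rightarrow> 'a) \<Rightarrow> bool" where
  "nonconstant f \<longleftrightarrow> \<not> (\<exists>m. \<forall>s. f s = m)"

text \<open>\<open>D n\<close> is the \<open>n\<close>-th derivative, so this is differentiability of class $C^\infty$.\<close>

definition smooth_curve :: "(real \<Rightarrow> real^3) \<Rightarrow> bool" where
  "smooth_curve \<gamma> \<longleftrightarrow>
     (\<exists>D. D 0 = \<gamma> \<and> (\<forall>n s. (D n has_vector_derivative D (Suc n) s) (at s)))"

abbreviation velocity :: "(real \<Rightarrow> real^3) \<Rightarrow> real \<Rightarrow> real^3" where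
  "velocity \<gamma> s \<equiv> vector_derivative \<gamma> (at s)"

text \<open>Curves are smooth, defined on the whole line and parametrized by arc length.\<close>

definition hyperbolic_curve :: "(real \<Rightarrow> real^3) \<Rightarrow> bool" where
  "hyperbolic_curve \<gamma> \<longleftrightarrow>
     smooth_curve \<gamma> \<and> range \<gamma> \<subseteq> hyperbolic_plane \<and>
     (\<forall>s. lorentz (velocity \<gamma> s) (velocity \<gamma> s) = 1)"

definition geodesic_curvature :: "(real \<Rightarrow> real^3) \<Rightarrow> real \<Rightarrow> real" where
  "geodesic_curvature \<gamma> s =
     (THE k. velocity (velocity \<gamma>) s = \<gamma> s + k *\<^sub>R lcross (\<gamma> s) (velocity \<gamma> s))"

text \<open>Reversing a curve changes the sign of its curvature; a convex curve always carries the
  orientation for which the curvature is positive.\<close>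

definition convex_curve :: "(real \<Rightarrow> real^3) \<Rightarrow> bool" where
  "convex_curve \<gamma> \<longleftrightarrow> hyperbolic_curve \<gamma> \<and> (\<forall>s. geodesic_curvature \<gamma> s > 0)"

definition blaschke :: "(real \<Rightarrow> real^3) \<Rightarrow> real \<Rightarrow> real" where
  "blaschke \<gamma> s = sqrt (geodesic_curvature \<gamma> s)"

definition closed_curve :: "(real \<Rightarrow> real^3) \<Rightarrow> bool" where
  "closed_curve \<gamma> \<longleftrightarrow> periodic \<gamma>"

section \<open>B-curves and BT-strings\<close>

definition Q_poly :: "real \<Rightarrow> real \<Rightarrow> real \<Rightarrow> real" where
  "Q_poly l c x = x^4 + 4 * l * x^3 + 4 * (l^2 - c) * x^2 - 1"

definition B_curve_with :: "real \<Rightarrow> real \<Rightarrow> (real \<Rightarrow> real^3) \<Rightarrow> bool" where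
  "B_curve_with l c \<gamma> \<longleftrightarrow>
     convex_curve \<gamma> \<and> nonconstant (blaschke \<gamma>) \<and> periodic (blaschke \<gamma>) \<and>
     (\<forall>s. blaschke \<gamma> differentiable (at s) \<and>
          (deriv (blaschke \<gamma>) s)^2 = - ((blaschke \<gamma> s)^2) * Q_poly l c (blaschke \<gamma> s))"

definition B_curve :: "(real \<Rightarrow> real^3) \<Rightarrow> bool" where
  "B_curve \<gamma> \<longleftrightarrow> (\<exists>l c. B_curve_with l c \<gamma>)"

definition momentum :: "real \<Rightarrow> (real \<Rightarrow> real^3) \<Rightarrow> real \<Rightarrow> real^3" where
  "momentum l \<gamma> s =
     (1 / (2 * blaschke \<gamma> s)) *\<^sub>R \<gamma> s
     + (deriv (blaschke \<gamma>) s / (2 * (blaschke \<gamma> s)^2)) *\<^sub>R velocity \<gamma> s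
     - (l + blaschke \<gamma> s / 2) *\<^sub>R lcross (\<gamma> s) (velocity \<gamma> s)"

definition BT_curve :: "(real \<Rightarrow> real^3) \<Rightarrow> bool" where
  "BT_curve \<gamma> \<longleftrightarrow>
     (\<exists>l c. B_curve_with l c \<gamma> \<and> (\<forall>s. timelike (momentum l \<gamma> s)))"

definition BT_string :: "(real \<Rightarrow> real^3) \<Rightarrow> bool" where
  "BT_string \<gamma> \<longleftrightarrow> BT_curve \<gamma> \<and> closed_curve \<gamma>"

section \<open>Moduli\<close>

definition moduli_P :: "(real \<times> real) set" where
  "moduli_P = {(l, e2). e2 > 0 \<and> e2^4 + 2 * l * e2^3 + 1 < 0}"

definition c_of :: "real \<Rightarrow> real \<Rightarrow> real" where
  "c_of l e2 = l^2 + l * e2 + e2^2 / 4 - 1 / (4 * e2^2)"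

lemma Q_poly_eq_0_iff_c_of: "e2 \<noteq> 0 \<Longrightarrow> Q_poly l c e2 = 0 \<longleftrightarrow> c = c_of l e2"
  by (auto simp: Q_poly_def c_of_def field_simps power2_eq_square power3_eq_cube power4_eq_xxxx)

definition e1_of :: "real \<Rightarrow> real \<Rightarrow> real" where
  "e1_of l e2 = Max {x. Q_poly l (c_of l e2) x = 0}"

text \<open>Positivity is the domain on which the right-hand side of the second-order equation is
  defined, given the positive initial value.\<close>

definition is_mu :: "real \<Rightarrow> real \<Rightarrow> (real \<Rightarrow> real) \<Rightarrow> bool" where
  "is_mu l e2 m \<longleftrightarrow>
     (\<forall>s. m s > 0) \<and> m 0 = e2 \<and>
     (\<exists>m'. m' 0 = 0 \<and>
        (\<forall>s. (m has_real_derivative m' s) (at s) \<and>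
             (m' has_real_derivative
                (2 * (m' s)^2 / m s - m s - 2 * l * (m s)^4 - (m s)^5)) (at s)))"

definition mu_of :: "real \<Rightarrow> real \<Rightarrow> real \<Rightarrow> real" where
  "mu_of l e2 = (THE m. is_mu l e2 m)"

definition omega_of :: "real \<Rightarrow> real \<Rightarrow> real" where
  "omega_of l e2 = least_period (mu_of l e2)"

definition moduli_T :: "(real \<times> real) set" where
  "moduli_T = {(l, e2). (l, e2) \<in> moduli_P \<and> c_of l e2 < 0}"

definition eta_minus :: "real \<Rightarrow> real" where
  "eta_minus l = Min {x. x^4 + 2 * l * x^3 + 1 = 0}"

definition eta_plus :: "real \<Rightarrow> real" where
  "eta_plus l = Max {x. x^4 + 2 * l * x^3 + 1 = 0}"

definition a_of :: "real \<Rightarrow> real" where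
  "a_of l = (if l \<le> -1 then sqrt (l^2 - 1) - l else eta_minus l)"

definition golden :: real where
  "golden = (1 + sqrt 5) / 2"

definition moduli_E :: "(real \<times> real) set" where
  "moduli_E = {(l, e2). (l, e2) \<in> moduli_P \<and> 1 + 4 * c_of l e2 * (e1_of l e2)^2 = 0}"

text \<open>The function whose graph is the exceptional locus, meaningful for
  \<open>l < - root 4 (golden ^ 5) / 2\<close>.\<close>

definition exc_of :: "real \<Rightarrow> real" where
  "exc_of l = (THE e2. (l, e2) \<in> moduli_E)"

definition moduli_T_minus :: "(real \<times> real) set" where
  "moduli_T_minus =
     {(l, e2). l < - root 4 (golden^5) / 2 \<and> a_of l < e2 \<and> e2 < exc_of l}"

definition moduli_T_plus :: "(real \<times> real) set" where
  "moduli_T_plus =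
     {(l, e2). l < - root 4 (golden^5) / 2 \<and> exc_of l < e2 \<and> e2 < eta_plus l} \<union>
     {(l, e2). - root 4 (golden^5) / 2 \<le> l \<and> l < -2 / root 4 27 \<and>
               a_of l < e2 \<and> e2 < eta_plus l}"

section \<open>The standard BT-curve and the period map\<close>

definition rho_abs :: "real \<Rightarrow> real \<Rightarrow> real \<Rightarrow> real" where
  "rho_abs l e2 s =
     sqrt (1 + 4 * c_of l e2 * (mu_of l e2 s)^2)
       / (2 * sqrt \<bar>c_of l e2\<bar> * mu_of l e2 s)"

text \<open>On the exceptional locus, \<open>t\<close> is the representative of \<open>s\<close> modulo \<open>2 * \<omega>\<close> in the
  fundamental domain \<open>[-\<omega>/2, 3*\<omega>/2)\<close>.\<close>

definition rho_of :: "real \<Rightarrow> real \<Rightarrow> real \<Rightarrow> real" where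
  "rho_of l e2 s =
     (if (l, e2) \<in> moduli_E then
        (let \<omega> = omega_of l e2;
             t = s - 2 * \<omega> * of_int \<lfloor>(s + \<omega> / 2) / (2 * \<omega>)\<rfloor>
         in if t \<le> \<omega> / 2 then rho_abs l e2 t else - rho_abs l e2 t)
      else rho_abs l e2 s)"

text \<open>The oriented integral is used since \<open>s\<close> may be negative.\<close>

definition Theta_of :: "real \<Rightarrow> real \<Rightarrow> real \<Rightarrow> real" where
  "Theta_of l e2 s =
     (if (l, e2) \<in> moduli_E then
        - 8 * sqrt \<bar>c_of l e2\<bar> * l^2 *
          (LBINT t=ereal 0..ereal s. (mu_of l e2 t)^2 / (mu_of l e2 t - 2 * l))
      else
        2 * sqrt \<bar>c_of l e2\<bar> *
          (LBINT t=ereal 0..ereal s.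
             (mu_of l e2 t)^2 * (mu_of l e2 t + 2 * l)
               / (1 + 4 * c_of l e2 * (mu_of l e2 t)^2)))"

definition standard_BT_curve :: "real \<times> real \<Rightarrow> real \<Rightarrow> real^3" where
  "standard_BT_curve p s =
     (case p of (l, e2) \<Rightarrow>
        vector [1 / (2 * sqrt \<bar>c_of l e2\<bar> * mu_of l e2 s),
                - (rho_of l e2 s * cos (Theta_of l e2 s)),
                rho_of l e2 s * sin (Theta_of l e2 s)])"

definition period_map :: "real \<times> real \<Rightarrow> real" where
  "period_map p =
     (case p of (l, e2) \<Rightarrow>
        let th = - Theta_of l e2 (omega_of l e2) / (2 * pi)
        in if p \<in> moduli_T_minus then th + 1
           else if p \<in> moduli_E then th + 1/2
           else if p \<in> moduli_T_plus then th
           else undefined)"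

definition chi :: "real \<Rightarrow> real" where
  "chi l = ((eta_plus l)^4 - 1) / sqrt ((eta_plus l)^8 - 4 * (eta_plus l)^4 + 3)"

definition J_interval :: "real \<Rightarrow> real set" where
  "J_interval l = (if l \<le> -1 then {1 <..< chi l} else {chi l <..})"

end

theory Submission
  imports Defs
begin

text \<open>Write \<open>k = sqrt (- c)\<close>. The trihedron of a BT-curve rotates about its constant time-like momentum, and
  the rotation over one period is governed by \<open>\<Theta>\<close>, whose integrand degenerates where
  \<open>1 + 4 c \<mu>\<^sup>2\<close> vanishes. Put \<open>\<alpha> = \<mu> + 2 l\<close> and \<open>\<beta> = \<mu>' / \<mu>\<^sup>2\<close>; then
  \<open>\<alpha>\<^sup>2 + \<beta>\<^sup>2 = (1 + 4 c \<mu>\<^sup>2) / \<mu>\<^sup>2\<close>, and the sum of \<open>\<Theta>\<close> and the nondegenerate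
  integral \<open>\<Psi> = \<integral> \<mu>\<^sup>2 + \<mu> \<alpha> / (1 + 2 k \<mu>)\<close> is, up to sign and a constant, the argument of \<open>\<alpha> + i \<beta>\<close>. Its
  increment over a period is \<open>2 \<pi>\<close>, \<open>\<pi>\<close> or \<open>0\<close> according to the sign of \<open>e\<^sub>1 + 2 l\<close>, which is
  exactly the correction in the period map: on all of \<open>\<T>\<close> the period map is \<open>\<Psi>(\<omega>) / 2\<pi>\<close>. This is an
  integral over a fixed interval with continuous integrand, so the period map is continuous on each slice
  \<open>l\<close> constant. It tends to \<open>\<chi>(l)\<close> as \<open>e\<^sub>1\<close> and \<open>e\<^sub>2\<close> merge; at the other end it tends to
  \<open>1\<close> if \<open>l \<le> -1\<close> and to infinity otherwise. The intermediate value theorem gives every \<open>q\<close>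
  in the interval, and for rational \<open>q\<close> the curve closes up.\<close>

section \<open>The quartic and the roots of Q\<close>

text \<open>With \<open>y = 1 / mu\<close> the pair \<open>(alpha, beta)\<close> turns at the rate
  \<open>mu^2 + y * alpha / (y^2 - 4 * k^2)\<close>, while \<open>Theta\<close> has the derivative
  \<open>2 * k * alpha / (y^2 - 4 * k^2)\<close>. In the difference the factor
  \<open>y - 2 * k\<close>, the source of every degeneracy, cancels and leaves
  \<open>mu^2 + alpha / (y + 2 * k)\<close>: this is the origin of the integrand of
  \<open>Psi\<close>. All geometry can therefore be done on one regular curve built from
  \<open>Psi\<close>, and the definitions by cases are only compared with it. Since
  \<open>mu_of\<close> is a definite description and the period varies with \<open>e2\<close>, the
  solution is constructed in a parameter whose period is always \<open>2 * pi\<close>; this settles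
  existence and at the same time fixes the interval of integration. At the lower end with
  \<open>l <= -1\<close>, \<open>c\<close> tends to 0, so \<open>Theta\<close> over a period should
  vanish and leave one full turn. The delicate value is \<open>l = -1\<close>: there
  \<open>e2\<close> meets the third root at the same moment and the bound for the period blows up,
  so the rates at which \<open>c\<close> and the cofactor vanish must be compared.\<close>

definition quartic :: "real \<Rightarrow> real \<Rightarrow> real" where
  "quartic l x = x^4 + 2 * l * x^3 + 1"

lemma c_of_alt: "x \<noteq> 0 \<Longrightarrow> c_of l x = ((x + 2 * l)^2 - 1 / x^2) / 4"
  by (simp add: c_of_def power2_eq_square field_simps)

text \<open>This is why the quartic governs the moduli: for positive \<open>e2\<close>,
  \<open>moduli_P\<close> is the region where \<open>c\<close> decreases in \<open>e2\<close>, and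
  the positive zeros of the quartic are the critical points of \<open>c_of l\<close>.\<close>

lemma c_of_has_derivative:
  assumes "x > 0"
  shows "(c_of l has_real_derivative quartic l x / (2 * x^3)) (at x)"
proof -
  have "((\<lambda>x. l^2 + l * x + x^2 / 4 - 1 / (4 * x^2)) has_real_derivative quartic l x / (2 * x^3)) (at x)"
    using assms
    by (auto intro!: derivative_eq_intros simp: quartic_def)
       (simp add: field_simps power_def numeral_eq_Suc)
  then show ?thesis by (simp add: c_of_def[abs_def])
qed

lemma cube_product_less:
  fixes x y :: real
  assumes "0 < x" "x < y" "y^4 \<le> 3"
  shows "x^3 * y^3 < x^2 + x * y + y^2"
proof -
  have "(x * y)^2 < (y * y)^2"
    using assms by (intro power_strict_mono) auto
  also have "\<dots> = y^4" by (simp add: power4_eq_xxxx power2_eq_square)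
  finally have "(x * y)^2 < 3" using assms by simp
  then have "(x * y)^2 * (x * y) < 3 * (x * y)" using assms by (intro mult_strict_right_mono) auto
  moreover have "3 * (x * y) \<le> x^2 + x * y + y^2"
    using zero_le_power2[of "x - y"] by (simp add: power2_eq_square algebra_simps)
  moreover have "(x * y)^2 * (x * y) = x^3 * y^3" by (simp add: power2_eq_square power3_eq_cube)
  ultimately show ?thesis by simp
qed

lemma cube_product_greater:
  fixes x y :: real
  assumes "0 < x" "x < y" "x^4 \<ge> 3"
  shows "x^3 * y^3 > x^2 + x * y + y^2"
proof -
  have "x^2 < y^2" "x * y < y^2"
    using assms by (auto simp: power2_eq_square intro!: mult_strict_mono)
  then have "x^2 + x * y + y^2 < 3 * y^2" by simp
  also have "\<dots> \<le> x^4 * y^2" using assms by (intro mult_right_mono) auto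
  also have "\<dots> = (x^3 * y^2) * x" by (simp add: power4_eq_xxxx power3_eq_cube)
  also have "\<dots> \<le> (x^3 * y^2) * y" using assms by (intro mult_left_mono) auto
  finally show ?thesis by (simp add: power3_eq_cube power2_eq_square mult_ac)
qed

text \<open>A division-free form of the monotonicity of
  \<open>quartic l x / x^3 = x + 2 * l + 1 / x^3\<close>, which falls up to \<open>x^4 = 3\<close>
  and rises afterwards. The sign of the last factor decides, and \<open>l\<close> enters only as a
  shift.\<close>

lemma quartic_diff:
  "quartic l y * x^3 - quartic l x * y^3 = (y - x) * (x^3 * y^3 - (x^2 + x * y + y^2))"
  by (simp add: quartic_def power4_eq_xxxx power3_eq_cube power2_eq_square algebra_simps)

lemma quartic_decreasing_ratio:
  assumes "0 < x" "x < y" "y^4 \<le> 3"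
  shows "quartic l y * x^3 < quartic l x * y^3"
proof -
  have "(y - x) * (x^3 * y^3 - (x^2 + x * y + y^2)) < 0"
    using cube_product_less[OF assms] assms by (intro mult_pos_neg) auto
  then show ?thesis using quartic_diff[of l y x] by linarith
qed

lemma quartic_increasing_ratio:
  assumes "0 < x" "x < y" "x^4 \<ge> 3"
  shows "quartic l y * x^3 > quartic l x * y^3"
proof -
  have "(y - x) * (x^3 * y^3 - (x^2 + x * y + y^2)) > 0"
    using cube_product_greater[OF assms] assms by (intro mult_pos_pos) auto
  then show ?thesis using quartic_diff[of l y x] by linarith
qed

lemma continuous_on_quartic: "continuous_on S (quartic l)"
  unfolding quartic_def[abs_def] by (intro continuous_intros)

lemma quartic_neg_imp_pos:
  assumes "quartic l x \<le> 0" "l < 0" shows "x > 0"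
proof (rule ccontr)
  assume "\<not> x > 0"
  then have "l * x^3 \<ge> 0"
    using assms by (intro mult_nonpos_nonpos) (auto simp: power_le_zero_eq)
  moreover have "x^4 \<ge> 0" by simp
  ultimately show False using assms(1) unfolding quartic_def by linarith
qed

section \<open>A slice of constant \<open>l\<close>: zeros of the quartic and the two branches of
  \<open>c_of l\<close>\<close>

locale slice =
  fixes l :: real
  assumes l_less: "l < -2 / root 4 27"
begin

abbreviation "hm \<equiv> eta_minus l"
abbreviation "hp \<equiv> eta_plus l"

text \<open>The minimizer of \<open>quartic l x / x^3\<close> on the positive axis, the same for all
  \<open>l\<close>.\<close>

definition "r3 = root 4 (3::real)"

lemma r3: "r3 > 0" "r3^4 = 3" by (auto simp: r3_def)

lemma root_27: "root 4 27 = r3^3"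
proof -
  have "(r3^3)^4 = (r3^4)^3" by (simp add: power_mult[symmetric])
  then have "(r3^3)^4 = 27" by (simp add: r3)
  then show ?thesis using r3(1) real_root_power_cancel[of 4 "r3^3"] by simp
qed

text \<open>The quartic equals \<open>4 + 2 * l * r3^3\<close> at this minimizer, so the hypothesis
  on \<open>l\<close> says exactly that it takes a negative value on the positive axis.\<close>

lemma quartic_r3: "quartic l r3 < 0"
proof -
  have "l * r3^3 < -2" using l_less r3 unfolding root_27 by (simp add: pos_less_divide_eq[symmetric])
  then show ?thesis by (simp add: quartic_def r3)
qed

lemma l_neg: "l < 0"
proof -
  have "-2 / root 4 27 < (0::real)" by simp
  then show ?thesis using l_less by linarith
qed

lemma quartic_roots_exist:
  "\<exists>x y. 0 < x \<and> x < r3 \<and> r3 < y \<and> y < - 2 * l \<and> quartic l x = 0 \<and> quartic l y = 0"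
proof -
  have "\<exists>x\<ge>0. x \<le> r3 \<and> quartic l x = 0"
    using r3 quartic_r3
    by (intro IVT2' continuous_on_quartic) (auto simp: quartic_def)
  then obtain x where x: "x \<ge> 0" "x \<le> r3" "quartic l x = 0" by auto
  have *: "r3 < - 2 * l"
  proof (rule ccontr)
    assume "\<not> ?thesis"
    then have "r3^3 * (r3 + 2 * l) \<ge> 0" using r3 by simp
    then show False using quartic_r3 by (simp add: quartic_def power4_eq_xxxx power3_eq_cube algebra_simps)
  qed
  \<comment> \<open>In the form \<open>x^3 * (x + 2 * l) + 1\<close> the quartic is visibly 1 here.
    This bounds the larger root by \<open>- 2 * l\<close>, a bound that later makes
    \<open>alpha\<close> negative at \<open>mu = e2\<close>.\<close>
  have q1: "quartic l (- 2 * l) = 1"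
    by (simp add: quartic_def power4_eq_xxxx power3_eq_cube)
  have "\<exists>y\<ge>r3. y \<le> - 2 * l \<and> quartic l y = 0"
    using r3 quartic_r3 * q1
    by (intro IVT' continuous_on_quartic) auto
  then obtain y where y: "y \<ge> r3" "y \<le> - 2 * l" "quartic l y = 0" by auto
  have "x \<noteq> 0" using x by (auto simp: quartic_def)
  moreover have "x \<noteq> r3" "y \<noteq> r3" "y \<noteq> - 2 * l" using x y quartic_r3 q1 by auto
  ultimately have "0 < x" "x < r3" "r3 < y" "y < - 2 * l" using x y by linarith+
  with x y show ?thesis by blast
qed

text \<open>\<open>Min\<close> and \<open>Max\<close> range over all real roots, so the root set
  must be shown to consist of two points: a third root would lie on the same side of
  \<open>r3\<close> as one of them, where the ratio is strictly monotone.\<close>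

lemma
  shows hm_gt_0: "0 < hm" and hm_less_r3: "hm < r3" and r3_less_hp: "r3 < hp" and hp_less: "hp < - 2 * l"
    and quartic_hm: "quartic l hm = 0" and quartic_hp: "quartic l hp = 0"
proof -
  obtain x y where xy: "0 < x" "x < r3" "r3 < y" "y < - 2 * l" "quartic l x = 0" "quartic l y = 0"
    using quartic_roots_exist by auto
  have "{z. quartic l z = 0} = {x, y}"
  proof (intro equalityI subsetI)
    fix z assume "z \<in> {z. quartic l z = 0}"
    then have z: "quartic l z = 0" by simp
    have z0: "z > 0" using z quartic_neg_imp_pos[of l z] l_neg by simp
    have le: "a^4 \<le> 3" if "0 < a" "a < r3" for a
      using that r3 by (metis less_eq_real_def power_mono)
    have ge: "a^4 \<ge> 3" if "r3 < a" for a
      using that r3 by (metis less_eq_real_def power_mono)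
    consider "z < r3" "z < x" | "z < r3" "x < z" | "r3 < z" "z < y" | "r3 < z" "z > y" | "z = r3" | "z \<in> {x, y}"
      by force
    then show "z \<in> {x, y}"
    proof cases
      case 1 then show ?thesis using quartic_decreasing_ratio[of z x l] le xy z z0 by force
    next
      case 2 then show ?thesis using quartic_decreasing_ratio[of x z l] le xy z z0 by force
    next
      case 3 then show ?thesis using quartic_increasing_ratio[of z y l] ge xy z z0 by force
    next
      case 4 then show ?thesis using quartic_increasing_ratio[of y z l] ge xy z r3 by force
    next
      case 5 then show ?thesis using z quartic_r3 by simp
    qed
  qed (use xy in auto)
  then have set: "{x. x^4 + 2 * l * x^3 + 1 = 0} = {x, y}" by (simp add: quartic_def)
  have "hm = x" "hp = y"
    using xy by (auto simp: eta_minus_def eta_plus_def set)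
  with xy show "0 < hm" "hm < r3" "r3 < hp" "hp < - 2 * l" "quartic l hm = 0" "quartic l hp = 0"
    by auto
qed

lemma pow4_le_3: "0 < x \<Longrightarrow> x \<le> r3 \<Longrightarrow> x^4 \<le> 3"
  using r3 by (metis less_eq_real_def power_mono)

lemma pow4_ge_3: "r3 \<le> x \<Longrightarrow> x^4 \<ge> 3"
  using r3 by (metis less_eq_real_def power_mono)

lemma hp_pow4: "hp^4 > 3"
  using r3 r3_less_hp by (metis less_eq_real_def power_strict_mono zero_less_numeral)

lemma hm_less_hp: "hm < hp" using hm_less_r3 r3_less_hp by simp
lemma hp_gt_0: "hp > 0" using hm_gt_0 hm_less_hp by simp

lemma quartic_pos_left: "quartic l x > 0" if "0 < x" "x < hm"
proof -
  have "quartic l hm * x^3 < quartic l x * hm^3"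
    using that pow4_le_3[of hm] hm_gt_0 hm_less_r3 by (intro quartic_decreasing_ratio) auto
  then show ?thesis using that by (simp add: quartic_hm zero_less_mult_iff)
qed

lemma quartic_pos_right: "quartic l x > 0" if "hp < x"
proof -
  have "quartic l hp * x^3 < quartic l x * hp^3"
    using that pow4_ge_3[of hp] r3 r3_less_hp by (intro quartic_increasing_ratio) auto
  then show ?thesis using that hp_gt_0 by (simp add: quartic_hp zero_less_mult_iff)
qed

lemma quartic_neg: "quartic l x < 0" if "hm < x" "x < hp"
proof (cases "x \<le> r3")
  case True
  have "quartic l x * hm^3 < quartic l hm * x^3"
    using that True pow4_le_3[of x] hm_gt_0 by (intro quartic_decreasing_ratio) auto
  then show ?thesis using that hm_gt_0 by (simp add: quartic_hm mult_less_0_iff)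
next
  case False
  have "quartic l x * hp^3 < quartic l hp * x^3"
    using that False pow4_ge_3[of x] hm_gt_0 by (intro quartic_increasing_ratio) auto
  then show ?thesis using that hp_gt_0 by (simp add: quartic_hp mult_less_0_iff)
qed

lemma moduli_P_iff: "(l, x) \<in> moduli_P \<longleftrightarrow> hm < x \<and> x < hp"
proof -
  have "quartic l x < 0 \<longleftrightarrow> hm < x \<and> x < hp" if "x > 0"
    using that quartic_neg[of x] quartic_pos_left[of x] quartic_pos_right[of x] quartic_hm quartic_hp
    by (cases x hm rule: linorder_cases; cases x hp rule: linorder_cases) force+
  then show ?thesis using hm_gt_0 by (auto simp: moduli_P_def quartic_def)
qed

lemma continuous_on_c_of: "S \<subseteq> {0<..} \<Longrightarrow> continuous_on S (c_of l)"
  using c_of_has_derivative DERIV_isCont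
  by (intro continuous_at_imp_continuous_on ballI) blast

lemma c_of_decreasing: "c_of l y < c_of l x" if "hm \<le> x" "x < y" "y \<le> hp"
proof (rule DERIV_neg_imp_decreasing_open[OF that(2)])
  fix z assume z: "x < z" "z < y"
  then have "quartic l z < 0" "z > 0" using quartic_neg[of z] that hm_gt_0 by auto
  then show "\<exists>d. (c_of l has_real_derivative d) (at z) \<and> d < 0"
    using c_of_has_derivative[of z l] by (intro exI[of _ "quartic l z / (2 * z^3)"]) (auto simp: divide_neg_pos)
qed (use that hm_gt_0 in \<open>auto intro!: continuous_on_c_of\<close>)

lemma c_of_increasing: "c_of l x < c_of l y" if "hp \<le> x" "x < y"
proof (rule DERIV_pos_imp_increasing_open[OF that(2)])
  fix z assume z: "x < z" "z < y"
  then have "quartic l z > 0" "z > 0" using quartic_pos_right[of z] that hp_gt_0 by auto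
  then show "\<exists>d. (c_of l has_real_derivative d) (at z) \<and> d > 0"
    using c_of_has_derivative[of z l] by (intro exI[of _ "quartic l z / (2 * z^3)"]) auto
qed (use that hp_gt_0 in \<open>auto intro!: continuous_on_c_of\<close>)

text \<open>At a zero of the quartic \<open>x + 2 * l = - 1 / x^3\<close>, which eliminates
  \<open>l\<close>; the sign of \<open>c\<close> is then that of \<open>1 - x^4\<close>.\<close>

lemma c_of_root: "quartic l x = 0 \<Longrightarrow> x > 0 \<Longrightarrow> c_of l x = (1 - x^4) / (4 * x^6)"
proof -
  assume *: "quartic l x = 0" "x > 0"
  then have "x^3 * (x + 2 * l) = -1" by (simp add: quartic_def power4_eq_xxxx power3_eq_cube algebra_simps)
  then have "(x + 2 * l) = -1 / x^3" using * by (simp add: field_simps)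
  then have "c_of l x = ((-1/x^3)^2 - 1 / x^2) / 4" using * by (simp add: c_of_alt)
  also have "\<dots> = (1 - x^4) / (4 * x^6)"
    using * by (simp add: field_simps power_mult[symmetric])
  finally show ?thesis .
qed

text \<open>The exceptional value of \<open>c\<close>: it will turn out that a slice meets
  \<open>moduli_E\<close> where \<open>e1 = - 2 * l\<close>.\<close>

lemma c_of_minus_2l: "c_of l (- 2 * l) = - 1 / (16 * l^2)"
  using l_neg by (subst c_of_alt) (auto simp: power2_eq_square)

lemma c_of_surj_right: "\<exists>x>hp. c_of l x = c" if "c > c_of l hp"
proof -
  \<comment> \<open>Large enough that \<open>M + 2 * l >= 4\<close>, hence
    \<open>(M + 2 * l)^2 >= 4 * (M + 2 * l)\<close>, which exceeds
    \<open>4 * c + 1 / M^2\<close>.\<close>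
  define M where "M = hp + 4 + \<bar>c\<bar> - 4 * l + 1 / hp^2"
  have M: "M > hp" "M + 2 * l \<ge> 4 + \<bar>c\<bar> + 1 / hp^2"
  proof -
    have "1 / hp^2 \<ge> 0" by simp
    then show "M > hp" "M + 2 * l \<ge> 4 + \<bar>c\<bar> + 1 / hp^2"
      unfolding M_def using hp_gt_0 l_neg by linarith+
  qed
  have h: "0 \<le> 1 / hp^2" by simp
  then have "4 \<le> M + 2 * l" using M(2) by linarith
  then have "(M + 2 * l) * 4 \<le> (M + 2 * l)^2"
    unfolding power2_eq_square by (intro mult_left_mono) auto
  moreover have "1 / M^2 \<le> 1 / hp^2" using M hp_gt_0 by (intro divide_left_mono power_mono) auto
  moreover have "c \<le> \<bar>c\<bar>" by simp
  ultimately have "4 * c \<le> (M + 2 * l)^2 - 1 / M^2"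
    using M(2) h by argo
  then have "c \<le> c_of l M" using M hp_gt_0 by (subst c_of_alt) auto
  then have "\<exists>x\<ge>hp. x \<le> M \<and> c_of l x = c"
    using M(1) that hp_gt_0 by (intro IVT' continuous_on_c_of) auto
  then obtain x where x: "x \<ge> hp" "c_of l x = c" by auto
  then have "x \<noteq> hp" using that by auto
  with x show ?thesis by (intro exI[of _ x]) auto
qed




text \<open>\<open>c_of l\<close> increases on \<open>[\<eta>\<^sub>+, \<infinity>)\<close>, and \<open>x\<close> is a positive root of \<open>Q\<close> for the
  parameter \<open>c\<close> iff \<open>c_of l x = c\<close>; so the root \<open>e\<^sub>1\<close> paired with \<open>e\<^sub>2\<close> depends continuously on \<open>e\<^sub>2\<close>.\<close>

definition outer_root :: "real \<Rightarrow> real" where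
  "outer_root x = (THE z. z \<ge> hp \<and> c_of l z = c_of l x)"

lemma c_of_inj_right: "hp \<le> x \<Longrightarrow> hp \<le> y \<Longrightarrow> c_of l x = c_of l y \<Longrightarrow> x = y"
  using c_of_increasing[of x y] c_of_increasing[of y x] by (cases x y rule: linorder_cases) auto

lemma c_of_less_iff: "hp \<le> x \<Longrightarrow> hp \<le> y \<Longrightarrow> c_of l x < c_of l y \<longleftrightarrow> x < y"
  using c_of_increasing[of x y] c_of_increasing[of y x] by (metis less_asym less_irrefl linorder_neqE)

lemma outer_root_eqI: "z \<ge> hp \<Longrightarrow> c_of l z = c_of l x \<Longrightarrow> outer_root x = z"
  unfolding outer_root_def by (rule the_equality) (auto intro: c_of_inj_right)

lemma outer_root_hp: "outer_root hp = hp" by (rule outer_root_eqI) auto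

lemma
  assumes "hm \<le> x" "x < hp"
  shows outer_root_gt: "outer_root x > hp" and c_of_outer_root_aux: "c_of l (outer_root x) = c_of l x"
proof -
  obtain z where "z > hp" "c_of l z = c_of l x"
    using c_of_surj_right c_of_decreasing[of x hp] assms by auto
  then show "outer_root x > hp" "c_of l (outer_root x) = c_of l x" using outer_root_eqI[of z x] by auto
qed

lemma c_of_outer_root: "hm \<le> x \<Longrightarrow> x \<le> hp \<Longrightarrow> c_of l (outer_root x) = c_of l x"
  using c_of_outer_root_aux[of x] outer_root_hp by (cases "x = hp") auto

lemma outer_root_ge: "hm \<le> x \<Longrightarrow> x \<le> hp \<Longrightarrow> outer_root x \<ge> hp"
  using outer_root_gt[of x] outer_root_hp by (cases "x = hp") auto

text \<open>\<open>c_of l\<close> falls on the inner branch and rises on the outer one, so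
  \<open>e1\<close> moves down as \<open>e2\<close> moves up.\<close>

lemma outer_root_le: "outer_root x \<le> outer_root y" if "hm \<le> y" "y \<le> x" "x \<le> hp"
proof (rule ccontr)
  assume "\<not> ?thesis"
  then have "c_of l (outer_root y) < c_of l (outer_root x)" using that by (intro c_of_increasing outer_root_ge) auto
  then have "c_of l y < c_of l x" using that by (simp add: c_of_outer_root)
  then show False using c_of_decreasing[of y x] that by (cases "x = y") auto
qed

lemma continuous_on_outer_root: "continuous_on {hm..hp} outer_root"
proof -
  \<comment> \<open>By antitonicity all values lie in \<open>{hp..M}\<close>; on this compact
    interval the inverse of the injective \<open>c_of l\<close> is continuous.\<close>
  define M where "M = outer_root hm"
  define g where "g = the_inv_into {hp..M} (c_of l)"
  have inj: "inj_on (c_of l) {hp..M}" by (rule inj_onI) (auto intro: c_of_inj_right)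
  have "continuous_on (c_of l ` {hp..M}) g"
    using hp_gt_0 by (intro continuous_on_inv continuous_on_c_of)
      (auto simp: g_def the_inv_into_f_f[OF inj])
  then have "continuous_on (c_of l ` {hm..hp}) g"
  proof (rule continuous_on_subset, intro subsetI)
    fix c assume "c \<in> c_of l ` {hm..hp}"
    then obtain x where x: "hm \<le> x" "x \<le> hp" "c = c_of l x" by auto
    then have "c = c_of l (outer_root x)" "outer_root x \<in> {hp..M}"
      using outer_root_le[of hm x] outer_root_ge[of x] by (auto simp: c_of_outer_root M_def)
    then show "c \<in> c_of l ` {hp..M}" by blast
  qed
  then have "continuous_on {hm..hp} (\<lambda>x. g (c_of l x))"
    using hm_gt_0 by (intro continuous_on_compose2[OF _ continuous_on_c_of[of "{hm..hp}"]]) auto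
  moreover have "g (c_of l x) = outer_root x" if "x \<in> {hm..hp}" for x
  proof -
    have "outer_root x \<in> {hp..M}" using that outer_root_le[of hm x] outer_root_ge[of x] by (auto simp: M_def)
    then show ?thesis using that the_inv_into_f_f[OF inj] by (simp add: g_def flip: c_of_outer_root)
  qed
  ultimately show ?thesis by (subst continuous_on_cong[OF refl, of _ outer_root "\<lambda>x. g (c_of l x)"]) auto
qed

text \<open>Since \<open>- 2 * l\<close> itself lies on the outer branch, the position of
  \<open>e1\<close> relative to it, which selects the case of the period map, can be read off from
  \<open>c\<close> alone.\<close>

lemma outer_root_less_iff: "outer_root x < - 2 * l \<longleftrightarrow> c_of l x < - 1 / (16 * l^2)"
  and outer_root_eq_iff: "outer_root x = - 2 * l \<longleftrightarrow> c_of l x = - 1 / (16 * l^2)"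
  if "hm \<le> x" "x \<le> hp"
proof -
  have "c_of l (outer_root x) = c_of l x" "outer_root x \<ge> hp" using that c_of_outer_root outer_root_ge by auto
  then show "outer_root x < - 2 * l \<longleftrightarrow> c_of l x < - 1 / (16 * l^2)" "outer_root x = - 2 * l \<longleftrightarrow> c_of l x = - 1 / (16 * l^2)"
    using c_of_less_iff[of "outer_root x" "- 2 * l"] c_of_inj_right[of "outer_root x" "- 2 * l"] hp_less c_of_minus_2l
    by auto
qed

text \<open>For positive \<open>x\<close>, \<open>c\<close> is negative iff
  \<open>x * (x + 2 * l)\<close> has modulus below 1; here that product is negative and at least
  \<open>- l^2\<close>.\<close>

lemma c_of_neg: "c_of l x < 0" if "l > -1" "0 < x" "x < - 2 * l"
proof -
  have "x * (x + 2 * l) < 0" using that by (simp add: mult_less_0_iff)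
  moreover have "x * (x + 2 * l) = (x + l)^2 - l^2" by (simp add: power2_eq_square algebra_simps)
  moreover have "l^2 < 1" using that l_neg by (simp add: abs_square_less_1)
  moreover have "(x + l)^2 \<ge> 0" by simp
  ultimately have "\<bar>x * (x + 2 * l)\<bar> < 1" by linarith
  then have "(x * (x + 2 * l))^2 < 1" by (simp add: abs_square_less_1)
  then have "(x + 2 * l)^2 < 1 / x^2"
    unfolding power_mult_distrib using that by (simp add: pos_less_divide_eq mult.commute)
  then show ?thesis using that by (subst c_of_alt) auto
qed

text \<open>\<open>c\<close> vanishes where \<open>x * (x + 2 * l)\<close> is 1 or -1;
  \<open>a_of l\<close> is the larger solution for -1.\<close>

lemma
  assumes "l \<le> -1"
  shows a_of_root: "a_of l * (a_of l + 2 * l) = -1" and a_of_ge_1: "a_of l \<ge> 1"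
proof -
  have "l^2 \<ge> 1" using assms abs_le_square_iff[of 1 l] by simp
  then have "sqrt (l^2 - 1)^2 = l^2 - 1" "sqrt (l^2 - 1) \<ge> 0" by auto
  moreover have "sqrt (l^2 - 1) - l \<ge> 1" using calculation(2) assms by linarith
  ultimately show "a_of l * (a_of l + 2 * l) = -1" "a_of l \<ge> 1"
    using assms unfolding a_of_def by (auto simp: power2_eq_square algebra_simps)
qed

lemma c_of_a_of: "c_of l (a_of l) = 0" if "l \<le> -1"
proof -
  have "(a_of l + 2 * l) = - 1 / a_of l" using a_of_root[OF that] a_of_ge_1[OF that] by (simp add: field_simps)
  then show ?thesis using a_of_ge_1[OF that] by (subst c_of_alt) (auto simp: power2_eq_square)
qed

lemma quartic_a_of: "quartic l (a_of l) = 1 - (a_of l)^2" if "l \<le> -1"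
proof -
  have "quartic l (a_of l) = (a_of l)^2 * (a_of l * (a_of l + 2 * l)) + 1"
    by (simp add: quartic_def power2_eq_square power4_eq_xxxx power3_eq_cube algebra_simps)
  then show ?thesis by (simp add: a_of_root[OF that])
qed

text \<open>For \<open>l <= -1\<close> the quartic is nonpositive at \<open>a_of l\<close>, so this
  point lies between the two roots. It is \<open>hm\<close> itself when \<open>l = -1\<close>, and
  \<open>hp\<close> is excluded because \<open>c\<close> is negative there.\<close>

lemma a_of_bounds: "hm \<le> a_of l \<and> a_of l < hp" 
proof (cases "l \<le> -1")
  case True
  have "quartic l (a_of l) \<le> 0" using quartic_a_of[OF True] a_of_ge_1[OF True] by simp
  then have *: "hm \<le> a_of l" "a_of l \<le> hp"
    using quartic_pos_left[of "a_of l"] quartic_pos_right[of "a_of l"] a_of_ge_1[OF True] by force+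
  have "c_of l hp < 0" using hp_pow4 hp_gt_0 by (simp add: c_of_root[OF quartic_hp] divide_neg_pos)
  then show ?thesis using * c_of_a_of[OF True] by (cases "a_of l = hp") auto
qed (use hm_less_hp in \<open>auto simp: a_of_def\<close>)

lemma moduli_T_iff: "(l, x) \<in> moduli_T \<longleftrightarrow> a_of l < x \<and> x < hp"
proof (cases "l \<le> -1")
  case True
  then show ?thesis
    using a_of_bounds c_of_a_of[OF True] c_of_decreasing[of "a_of l" x] c_of_decreasing[of x "a_of l"]
    by (cases x "a_of l" rule: linorder_cases) (auto simp: moduli_T_def moduli_P_iff)
next
  case False
  then show ?thesis
    using c_of_neg[of x] hm_gt_0 hp_less by (auto simp: moduli_T_def moduli_P_iff a_of_def)
qed

text \<open>\<open>c_of l hm\<close> is the supremum of \<open>c\<close> on the slice, so the right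
  side says that the exceptional value can be reached. In \<open>y = hm^4\<close> it reads
  \<open>y^2 - y - 1 < 0\<close>, whence the golden ratio.\<close>

lemma exceptional_threshold:
  "l < - root 4 (golden^5) / 2 \<longleftrightarrow> - 1 / (16 * l^2) < c_of l hm"
proof -
  define z where "z = root 4 golden"
  have g: "golden > 0" "golden^2 = golden + 1" "golden < 3"
  proof -
    have "sqrt 5 < sqrt 9" by (rule real_sqrt_less_mono) simp
    then have "sqrt 5 < 3" by simp
    then show "golden > 0" "golden < 3" unfolding golden_def by (simp_all add: add_pos_pos)
    show "golden^2 = golden + 1" by (simp add: golden_def power2_eq_square field_simps)
  qed
  have z: "z > 0" "z^4 = golden" using g by (auto simp: z_def)
  have "z < r3"
  proof -
    have "z^4 < r3^4" using z r3 g by simp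
    then show ?thesis using r3 by (metis less_eq_real_def power_less_imp_less_base)
  qed
  have r: "root 4 (golden^5) = z^5" using g by (simp add: z_def real_root_power)
  have z8: "z^8 = golden + 1"
    using g z power_mult[of z 4 2] by simp
  \<comment> \<open>\<open>z^4 + 1 = golden + 1 = z^8\<close>, so the quartic at \<open>z\<close>
    has a factor \<open>z^3\<close> and its sign is that of \<open>2 * l + z^5\<close>.\<close>
  have qz: "quartic l z = (2 * l + z^5) * z^3"
    using z8 z by (simp add: quartic_def algebra_simps flip: power_add)
  have 1: "l < - root 4 (golden^5) / 2 \<longleftrightarrow> quartic l z < 0"
    using z unfolding r qz by (auto simp: mult_less_0_iff)
  have 2: "quartic l z < 0 \<longleftrightarrow> hm < z"
    using quartic_neg[of z] quartic_pos_left[of z] quartic_hm z \<open>z < r3\<close> r3_less_hp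
    by (cases z hm rule: linorder_cases) auto
  define y where "y = hm^4"
  have 3: "hm < z \<longleftrightarrow> y < golden"
    unfolding y_def z(2)[symmetric] using z(1) hm_gt_0 by (auto intro: power_strict_mono dest: power_less_imp_less_base)
  have y: "y > 0" using hm_gt_0 by (simp add: y_def)
  have g1: "golden > 1" by (simp add: golden_def)
  have 4: "y < golden \<longleftrightarrow> y^2 - y - 1 < 0"
  proof -
    have "y^2 - y - 1 = (y - golden) * (y + golden - 1)" using g(2) by (simp add: power2_eq_square algebra_simps)
    moreover have "y + golden - 1 > 0" using y g1 by simp
    ultimately show ?thesis by (simp add: mult_less_0_iff)
  qed
  have l: "2 * l * hm^3 = - (1 + y)" using quartic_hm unfolding quartic_def y_def by linarith
  have l2: "4 * l^2 * hm^6 = (1 + y)^2"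
  proof -
    have "(2 * l * hm^3)^2 = (1 + y)^2" unfolding l by (simp only: power2_minus)
    then show ?thesis by (simp add: power_mult_distrib flip: power_mult)
  qed
  have h12: "hm^6 * hm^6 = y^3" unfolding y_def by (simp flip: power_mult power_add)
  have "- 1 / (16 * l^2) < c_of l hm \<longleftrightarrow> - 1 / (4 * (1 + y)^2 / hm^6) < (1 - y) / (4 * hm^6)"
    unfolding c_of_root[OF quartic_hm hm_gt_0] l2[symmetric] using hm_gt_0 by (simp add: y_def)
  also have "\<dots> \<longleftrightarrow> - (hm^6 * hm^6) < (1 - y) * (1 + y)^2"
    using hm_gt_0 y by (simp add: field_simps)
  also have "\<dots> \<longleftrightarrow> y^2 - y - 1 < 0"
    unfolding h12 by (simp add: power2_eq_square power3_eq_cube algebra_simps)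
  finally show ?thesis using 1 2 3 4 by simp
qed

text \<open>The quotient of \<open>Q_poly\<close> by \<open>(x - e1) * (x - e2)\<close>, its
  coefficients given by Vieta: the four roots have sum \<open>- 4 * l\<close> and product
  -1.\<close>

definition cofactor :: "real \<Rightarrow> real \<Rightarrow> real \<Rightarrow> real" where
  "cofactor e1 e2 x = x^2 + (4 * l + e1 + e2) * x - 1 / (e1 * e2)"

text \<open>This is \<open>c_of l e1 = c_of l e2\<close> divided by \<open>e1 - e2\<close>. At
  \<open>x = hp\<close> the roots coincide and the vanishing derivative of \<open>c_of l\<close>
  takes the place of the difference quotient.\<close>

lemma root_relation:
  assumes "hm \<le> x" "x \<le> hp"
  shows "(outer_root x)^2 * x^2 * (4 * l + outer_root x + x) + outer_root x + x = 0"
proof (cases "x = hp")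
  case True
  have "hp^2 * hp^2 * (4 * l + hp + hp) + hp + hp = 2 * hp * quartic l hp"
    by (simp add: quartic_def power2_eq_square power4_eq_xxxx power3_eq_cube algebra_simps)
  then show ?thesis using True by (simp add: outer_root_hp quartic_hp)
next
  case False
  let ?e = "outer_root x"
  have *: "?e > hp" "c_of l ?e = c_of l x" "x > 0" "?e \<noteq> x" using False assms outer_root_gt[of x] c_of_outer_root[of x] hm_gt_0 hp_gt_0 by auto
  have e0: "?e > 0" using * hp_gt_0 by simp
  have "4 * ?e^2 * x^2 * (c_of l ?e - c_of l x) = (?e - x) * (?e^2 * x^2 * (4 * l + ?e + x) + ?e + x)"
    using *(3) e0 by (simp add: c_of_def field_simps power2_eq_square)
  then show ?thesis using * by simp
qed

text \<open>Naming the reciprocal \<open>u\<close> turns the relation into polynomial identities,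
  which can be used for rewriting in the factorizations below.\<close>

lemma root_relation_inverse:
  fixes x :: real
  defines "e \<equiv> outer_root x" and "u \<equiv> 1 / (outer_root x * x)"
  assumes "hm \<le> x" "x \<le> hp"
  shows "e * x * u = 1"
    and "e * x * (4 * l + e + x) = - (e + x) * u"
    and "e * (4 * l + e + x) = - ((e * u)^2) - u"
proof -
  have *: "e > 0" "x > 0" using assms outer_root_ge[of x] hm_gt_0 hp_gt_0 by auto
  show u: "e * x * u = 1" using * by (simp add: u_def e_def)
  have r: "e^2 * x^2 * (4 * l + e + x) = - (e + x)" using root_relation[of x] assms(3,4) unfolding e_def by linarith
  have b: "4 * l + e + x = - (e + x) * u^2"
    using r * by (simp add: u_def e_def power_divide power_mult_distrib nonzero_eq_divide_eq mult_ac)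
  have "e * x * (4 * l + e + x) = - (e + x) * (e * x * u) * u"
    unfolding b by (simp add: power2_eq_square)
  then show "e * x * (4 * l + e + x) = - (e + x) * u" unfolding u by simp
  have "e * (4 * l + e + x) = - ((e * u)^2) - (e * x * u) * u"
    unfolding b by (simp add: power2_eq_square algebra_simps)
  then show "e * (4 * l + e + x) = - ((e * u)^2) - u" unfolding u by simp
qed

text \<open>From \<open>Q_poly l c x = 4 * x^2 * (c_of l x - c)\<close> the derivative of
  \<open>Q_poly\<close> at \<open>e2\<close> is \<open>2 * quartic l e2 / e2\<close>, and the
  cofactor there is this derivative over \<open>e2 - e1\<close>. In particular it vanishes at
  \<open>hm\<close>.\<close>

lemma cofactor_e2:
  assumes "hm \<le> x" "x < hp"
  shows "cofactor (outer_root x) x x = - 2 * quartic l x / (x * (outer_root x - x))"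
proof -
  let ?e = "outer_root x"
  have *: "?e > x" "x > 0" using assms outer_root_gt[of x] hm_gt_0 by auto
  define u where "u = 1 / (?e * x)"
  note f = root_relation_inverse[of x, folded u_def]
  have "cofactor ?e x x * (x * (?e - x)) + 2 * quartic l x
      = (?e * x * (4 * l + ?e + x)) * x - ?e * x * u + u * x^2 + 2"
    unfolding cofactor_def quartic_def u_def[symmetric]
    by (simp add: power4_eq_xxxx power3_eq_cube power2_eq_square algebra_simps)
  also have "\<dots> = 2 - 2 * (?e * x * u)"
    using assms by (subst f(2)) (auto simp: power2_eq_square algebra_simps)
  finally have "cofactor ?e x x * (x * (?e - x)) = - 2 * quartic l x"
    using f(1) assms by simp
  moreover have "x * (?e - x) \<noteq> 0" using * by simp
  ultimately show ?thesis by (metis nonzero_mult_div_cancel_right)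
qed

lemma cofactor_hp: "cofactor hp hp hp = (hp^4 - 3) / hp^2"
proof -
  have "4 * l + hp + hp = - 2 / hp^3"
    using quartic_hp hp_gt_0 by (simp add: quartic_def field_simps power4_eq_xxxx power3_eq_cube)
  then show ?thesis using hp_gt_0 by (simp add: cofactor_def field_simps power4_eq_xxxx power3_eq_cube power2_eq_square)
qed

lemma cofactor_e2_pos: "cofactor (outer_root x) x x > 0" if "hm < x" "x \<le> hp"
proof (cases "x = hp")
  case True then show ?thesis using hp_pow4 hp_gt_0 by (simp add: outer_root_hp cofactor_hp)
next
  case False
  then have "- 2 * quartic l x > 0" "x * (outer_root x - x) > 0"
    using that outer_root_gt[of x] hm_gt_0 quartic_neg[of x] by (auto intro!: mult_pos_pos)
  then show ?thesis using that False by (subst cofactor_e2) (auto intro: divide_neg_pos)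
qed

text \<open>The quotient of the cofactor by \<open>x\<close> is \<open>x - 1 / (e1 * e2 * x)\<close>
  plus a constant and increases for positive \<open>x\<close>; multiplying by \<open>x\<close>
  preserves this as long as the value at \<open>e2\<close> is nonnegative.\<close>

lemma cofactor_mono:
  assumes "0 < e1" "0 < e2" "e2 \<le> x" "cofactor e1 e2 e2 \<ge> 0"
  shows "cofactor e1 e2 e2 \<le> cofactor e1 e2 x"
proof -
  have "e2 * cofactor e1 e2 x - x * cofactor e1 e2 e2 = (x - e2) * (x * e2 + 1 / (e1 * e2))"
    using assms by (simp add: cofactor_def field_simps power2_eq_square)
  also have "\<dots> \<ge> 0" using assms by auto
  finally have "x * cofactor e1 e2 e2 \<le> e2 * cofactor e1 e2 x" by simp
  moreover have "e2 * cofactor e1 e2 e2 \<le> x * cofactor e1 e2 e2" using assms by (intro mult_right_mono) auto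
  ultimately have "e2 * cofactor e1 e2 e2 \<le> e2 * cofactor e1 e2 x" by linarith
  then show ?thesis using assms by simp
qed

lemma Q_poly_factor:
  assumes "hm \<le> e2" "e2 \<le> hp"
  shows "Q_poly l (c_of l e2) x = (x - outer_root e2) * (x - e2) * cofactor (outer_root e2) e2 x"
proof -
  let ?e = "outer_root e2"
  have *: "?e > 0" "e2 > 0" using assms outer_root_ge[of e2] hm_gt_0 hp_gt_0 by auto
  define u where "u = 1 / (?e * e2)"
  note f = root_relation_inverse[OF assms, folded u_def]
  have c: "4 * c_of l e2 = 4 * l^2 + 4 * l * e2 + e2^2 - (?e * u)^2"
    using * by (simp add: c_of_def u_def power_divide)
  have "(x - ?e) * (x - e2) * (x^2 + (4 * l + ?e + e2) * x - u)
      = x^4 + 4 * l * x^3 + (?e * e2 - u - e2 * (4 * l + ?e + e2) - ?e * (4 * l + ?e + e2)) * x^2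
        + ((?e + e2) * u + ?e * e2 * (4 * l + ?e + e2)) * x - ?e * e2 * u"
    by (simp add: power4_eq_xxxx power3_eq_cube power2_eq_square algebra_simps)
  also have "\<dots> = x^4 + 4 * l * x^3 + (4 * l^2 - 4 * c_of l e2) * x^2 - 1"
    unfolding f c by (simp add: power2_eq_square algebra_simps)
  finally show ?thesis
    unfolding cofactor_def Q_poly_def u_def[symmetric] by (simp add: algebra_simps)
qed

end

section \<open>The differential equation\<close>

lemma has_primitive:
  fixes f :: "real \<Rightarrow> real"
  assumes "continuous_on UNIV f"
  shows "((\<lambda>s. LBINT t=ereal 0..ereal s. f t) has_real_derivative f s) (at s)"
proof -
  let ?b = "\<bar>s\<bar> + 1"
  have "((\<lambda>s. LBINT t=ereal 0..ereal s. f t) has_vector_derivative f s) (at s within {-?b..?b})"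
    using assms by (intro interval_integral_FTC2) (auto intro: continuous_on_subset)
  then have "((\<lambda>s. LBINT t=ereal 0..ereal s. f t) has_vector_derivative f s) (at s within {-?b<..<?b})"
    by (rule has_vector_derivative_within_subset) auto
  moreover have "at s within {-?b<..<?b} = at s"
    by (intro at_within_open) auto
  ultimately show ?thesis by (simp add: has_real_derivative_iff_has_vector_derivative)
qed

lemma odd_if_derivative_even:
  fixes F f :: "real \<Rightarrow> real"
  assumes "\<And>x. (F has_real_derivative f x) (at x)" "F 0 = 0" "\<And>x. f (- x) = f x"
  shows "F (- x) = - F x"
proof -
  have "((\<lambda>x. F (- x) + F x) has_real_derivative 0) (at x)" for x
    using assms(3)[of x]
    by (auto intro!: derivative_eq_intros DERIV_chain2[OF assms(1)] assms(1))
  then have "F (- x) + F x = F (- 0) + F 0" by (intro DERIV_isconst_all[of "\<lambda>x. F (- x) + F x"]) auto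
  then show ?thesis using assms(2) by simp
qed

lemma additive_if_derivative_periodic:
  fixes F f :: "real \<Rightarrow> real"
  assumes "\<And>x. (F has_real_derivative f x) (at x)" "F 0 = 0" "\<And>x. f (x + p) = f x"
  shows "F (x + p) = F x + F p"
proof -
  have "((\<lambda>x. F (x + p) - F x) has_real_derivative 0) (at x)" for x
    using assms(3)[of x]
    by (auto intro!: derivative_eq_intros DERIV_chain2[OF assms(1)] assms(1))
  then have "F (x + p) - F x = F (0 + p) - F 0" by (intro DERIV_isconst_all[of "\<lambda>x. F (x + p) - F x"]) auto
  then show ?thesis using assms(2) by simp
qed

text \<open>The lower bound on the slope makes \<open>S\<close> grow at least linearly in both
  directions, so it is onto and its inverse is defined on the whole line.\<close>

lemma increasing_inverse:
  fixes S g :: "real \<Rightarrow> real"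
  assumes S: "\<And>t. (S has_real_derivative g t) (at t)" and g: "\<And>t. g t \<ge> d" and d: "d > 0"
  obtains T where "\<And>t. T (S t) = t" "\<And>s. S (T s) = s" "\<And>s. (T has_real_derivative 1 / g (T s)) (at s)"
proof -
  have less: "S a < S b" if "a < b" for a b
    using that S g d by (intro DERIV_pos_imp_increasing[OF that]) (metis less_le_trans)
  then have inj: "inj S" by (intro injI) (metis less_irrefl linorder_neqE)
  have cont: "isCont S t" for t using S DERIV_isCont by blast
  have lower: "S 0 + d * t \<le> S t" if "t \<ge> 0" for t
  proof -
    have "S 0 - d * 0 \<le> S t - d * t"
      using that by (intro DERIV_nonneg_imp_nondecreasing[of 0 t "\<lambda>t. S t - d * t"])
        (auto intro!: exI derivative_eq_intros S simp: g)
    then show ?thesis by simp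
  qed
  have upper: "S t \<le> S 0 + d * t" if "t \<le> 0" for t
  proof -
    have "S t - d * t \<le> S 0 - d * 0"
      using that by (intro DERIV_nonneg_imp_nondecreasing[of t 0 "\<lambda>t. S t - d * t"])
        (auto intro!: exI derivative_eq_intros S simp: g)
    then show ?thesis by simp
  qed
  have surj: "\<exists>t. S t = s" for s
  proof -
    define r where "r = \<bar>s - S 0\<bar> / d"
    have r: "r \<ge> 0" "d * r = \<bar>s - S 0\<bar>" using d by (auto simp: r_def)
    have "S (- r) \<le> s" "s \<le> S r" using lower[of r] upper[of "- r"] r by auto
    then show ?thesis
      using r cont IVT[of S "- r" s r] by auto
  qed
  define T where "T = inv S"
  have T1: "T (S t) = t" for t using inj by (simp add: T_def)
  have T2: "S (T s) = s" for s using someI_ex[OF surj[of s]] by (simp add: T_def inv_def)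
  have "isCont T s" for s
  proof -
    have "isCont T (S (T s))"
      by (rule isCont_inverse_function[of 1]) (auto simp: T1 cont)
    then show ?thesis by (simp add: T2)
  qed
  moreover have "g (T s) \<noteq> 0" for s using g[of "T s"] d by auto
  ultimately have "(T has_real_derivative inverse (g (T s))) (at s)" for s
    using S by (intro DERIV_inverse_function[where f = S and a = "s - 1" and b = "s + 1"]) (auto simp: T2)
  then show ?thesis using that[of T] T1 T2 by (simp add: inverse_eq_divide)
qed

text \<open>Gronwall's argument: \<open>exp (- L * t) * D t\<close> does not increase for positive
  times and \<open>exp (L * t) * D t\<close> does not decrease for negative ones.\<close>

lemma zero_if_derivative_bounded_by_self:
  fixes D D' :: "real \<Rightarrow> real"
  assumes D: "\<And>t. \<bar>t\<bar> \<le> r \<Longrightarrow> (D has_real_derivative D' t) (at t)"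
    and bound: "\<And>t. \<bar>t\<bar> \<le> r \<Longrightarrow> \<bar>D' t\<bar> \<le> L * D t"
    and "D 0 = 0" "D s \<ge> 0" "\<bar>s\<bar> \<le> r"
  shows "D s = 0"
proof -
  have "D s \<le> 0"
  proof (cases "s \<ge> 0")
    case True
    have "exp (- L * s) * D s \<le> exp (- L * 0) * D 0"
    proof (rule DERIV_nonpos_imp_nonincreasing[OF True])
      fix t assume t: "0 \<le> t" "t \<le> s"
      then have "\<bar>t\<bar> \<le> r" using assms by auto
      then have "((\<lambda>t. exp (- L * t) * D t) has_real_derivative exp (- L * t) * (D' t - L * D t)) (at t)"
        by (auto intro!: derivative_eq_intros D simp: algebra_simps)
      moreover have "exp (- L * t) * (D' t - L * D t) \<le> 0"
        using bound[OF \<open>\<bar>t\<bar> \<le> r\<close>] by (intro mult_nonneg_nonpos) auto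
      ultimately show "\<exists>y. ((\<lambda>t. exp (- L * t) * D t) has_real_derivative y) (at t) \<and> y \<le> 0" by blast
    qed
    then show ?thesis using \<open>D 0 = 0\<close> by (simp add: mult_le_0_iff)
  next
    case False
    then have "s \<le> 0" by simp
    have "exp (L * s) * D s \<le> exp (L * 0) * D 0"
    proof (rule DERIV_nonneg_imp_nondecreasing[OF \<open>s \<le> 0\<close>])
      fix t assume t: "s \<le> t" "t \<le> 0"
      then have "\<bar>t\<bar> \<le> r" using assms by auto
      then have "((\<lambda>t. exp (L * t) * D t) has_real_derivative exp (L * t) * (D' t + L * D t)) (at t)"
        by (auto intro!: derivative_eq_intros D simp: algebra_simps)
      moreover have "exp (L * t) * (D' t + L * D t) \<ge> 0"
        using bound[OF \<open>\<bar>t\<bar> \<le> r\<close>] by (intro mult_nonneg_nonneg) auto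
      ultimately show "\<exists>y. ((\<lambda>t. exp (L * t) * D t) has_real_derivative y) (at t) \<and> y \<ge> 0" by blast
    qed
    then show ?thesis using \<open>D 0 = 0\<close> by (simp add: mult_le_0_iff)
  qed
  then show ?thesis using assms by simp
qed

lemma bounded_if_has_derivative:
  fixes f :: "real \<Rightarrow> real"
  assumes "\<And>t. (f has_real_derivative f' t) (at t)"
  obtains M where "\<And>t. \<bar>t\<bar> \<le> r \<Longrightarrow> f t \<le> M"
proof -
  have "continuous_on {-r..r} f"
    using assms DERIV_isCont by (intro continuous_at_imp_continuous_on) blast
  then have "bounded (f ` {-r..r})"
    by (intro compact_imp_bounded compact_continuous_image) auto
  then obtain M where "\<And>t. t \<in> {-r..r} \<Longrightarrow> \<bar>f t\<bar> \<le> M" by (force simp: bounded_iff)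
  then show ?thesis using that[of M] by (meson abs_le_D1 abs_le_D2 abs_le_iff atLeastAtMost_iff minus_le_iff order_trans)
qed

text \<open>In the variable \<open>1 / m\<close> the equation reads \<open>y'' = y + 2 l / y\<^sup>2 + 1 / y\<^sup>3\<close>, whose right-hand
  side is Lipschitz as long as \<open>m\<close> is bounded.\<close>

lemma is_mu_unique:
  assumes "is_mu l e m" "is_mu l e n"
  shows "m = n"
proof
  fix s :: real
  obtain m' where m: "\<And>s. m s > 0" "m 0 = e" "m' 0 = 0" 
    "\<And>s. (m has_real_derivative m' s) (at s)"
    "\<And>s. (m' has_real_derivative (2 * (m' s)^2 / m s - m s - 2 * l * (m s)^4 - (m s)^5)) (at s)"
    using assms(1) unfolding is_mu_def by blast
  obtain n' where n: "\<And>s. n s > 0" "n 0 = e" "n' 0 = 0" 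
    "\<And>s. (n has_real_derivative n' s) (at s)"
    "\<And>s. (n' has_real_derivative (2 * (n' s)^2 / n s - n s - 2 * l * (n s)^4 - (n s)^5)) (at s)"
    using assms(2) unfolding is_mu_def by blast
  have inv: "((\<lambda>s. 1 / f s) has_real_derivative - f' s / (f s)^2) (at s) \<and>
    ((\<lambda>s. - f' s / (f s)^2) has_real_derivative 1 / f s + 2 * l * (f s)^2 + (f s)^3) (at s)"
    if f: "\<And>s. f s > 0" "\<And>s. (f has_real_derivative f' s) (at s)"
      "\<And>s. (f' has_real_derivative (2 * (f' s)^2 / f s - f s - 2 * l * (f s)^4 - (f s)^5)) (at s)"
    for f f' :: "real \<Rightarrow> real" and s
  proof
    have fs: "f s \<noteq> 0" using f(1)[of s] by simp
    show "((\<lambda>s. 1 / f s) has_real_derivative - f' s / (f s)^2) (at s)"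
      by (rule derivative_eq_intros f refl fs)+ (use fs in \<open>simp add: field_simps power2_eq_square\<close>)
    show "((\<lambda>s. - f' s / (f s)^2) has_real_derivative 1 / f s + 2 * l * (f s)^2 + (f s)^3) (at s)"
    proof -
      have "((\<lambda>s. - f' s / (f s)^2) has_real_derivative
          (- (2 * (f' s)^2 / f s - f s - 2 * l * (f s)^4 - (f s)^5) * (f s)^2 - (- f' s) * (2 * f s * f' s))
            / ((f s)^2 * (f s)^2)) (at s)"
        using fs by (intro DERIV_divide) (auto intro!: derivative_eq_intros f(2,3))
      also have "(- (2 * (f' s)^2 / f s - f s - 2 * l * (f s)^4 - (f s)^5) * (f s)^2 - (- f' s) * (2 * f s * f' s))
            / ((f s)^2 * (f s)^2) = 1 / f s + 2 * l * (f s)^2 + (f s)^3"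
        using fs by (simp add: field_simps eval_nat_numeral)
      finally show ?thesis .
    qed
  qed
  define y z p q where "y s = 1 / m s" and "z s = 1 / n s" and "p s = - m' s / (m s)^2" and "q s = - n' s / (n s)^2"
    for s
  define P where "P s = y s + 2 * l * (m s)^2 + (m s)^3" for s
  define Q where "Q s = z s + 2 * l * (n s)^2 + (n s)^3" for s
  have d: "(y has_real_derivative p s) (at s)" "(z has_real_derivative q s) (at s)"
    "(p has_real_derivative P s) (at s)" "(q has_real_derivative Q s) (at s)" for s
    using inv[of m m' s] inv[of n n' s] m n
    by (auto simp: y_def[abs_def] z_def[abs_def] p_def[abs_def] q_def[abs_def] P_def Q_def)
  obtain M1 where M1: "\<And>t. \<bar>t\<bar> \<le> \<bar>s\<bar> \<Longrightarrow> m t \<le> M1" using bounded_if_has_derivative[OF m(4)] by metis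
  obtain M2 where M2: "\<And>t. \<bar>t\<bar> \<le> \<bar>s\<bar> \<Longrightarrow> n t \<le> M2" using bounded_if_has_derivative[OF n(4)] by metis
  define M where "M = max M1 M2"
  \<comment> \<open>A Lipschitz constant: \<open>m - n = (z - y) * m * n\<close> with
    \<open>m, n <= M\<close> bounds the differences of \<open>2 * l * m^2\<close> and
    \<open>m^3\<close> by \<open>4 * |l| * M^3\<close> and \<open>3 * M^4\<close> times
    \<open>|y - z|\<close>.\<close>
  define K where "K = 1 + 4 * \<bar>l\<bar> * M^3 + 3 * M^4"
  define D where "D t = (y t - z t)^2 + (p t - q t)^2" for t
  define D' where "D' t = 2 * (y t - z t) * (p t - q t) + 2 * (p t - q t) * (P t - Q t)" for t
  have D: "(D has_real_derivative D' t) (at t)" for t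
    unfolding D_def[abs_def] D'_def by (rule derivative_eq_intros d refl)+ (simp add: algebra_simps)
  have bound: "\<bar>D' t\<bar> \<le> (1 + K) * D t" if t: "\<bar>t\<bar> \<le> \<bar>s\<bar>" for t
  proof -
    have mM: "0 < m t" "m t \<le> M" and nM: "0 < n t" "n t \<le> M"
      using M1[OF t] M2[OF t] m n by (auto simp: M_def)
    then have M0: "0 < M" by simp
    define mn where "mn = m t * n t"
    have mn: "0 < mn" "mn \<le> M * M" using mM nM by (auto simp: mn_def intro!: mult_mono)
    have diff: "m t - n t = (z t - y t) * mn" using mM nM by (simp add: y_def z_def mn_def field_simps)
    have pw: "(m t)^2 - (n t)^2 = (m t - n t) * (m t + n t)" "(m t)^3 - (n t)^3 = (m t - n t) * ((m t)^2 + mn + (n t)^2)"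
      by (simp_all add: mn_def power2_eq_square power3_eq_cube algebra_simps)
    have "P t - Q t = (y t - z t) + 2 * l * ((m t)^2 - (n t)^2) + ((m t)^3 - (n t)^3)"
      by (simp add: P_def Q_def algebra_simps)
    then have PQ: "P t - Q t = (y t - z t) * (1 - 2 * l * (mn * (m t + n t)) - mn * ((m t)^2 + mn + (n t)^2))"
      unfolding pw diff by (simp add: algebra_simps)
    have e1: "mn * (m t + n t) \<le> M * M * (M + M)" using mM nM mn by (intro mult_mono) auto
    have e1': "0 \<le> mn * (m t + n t)" using mM nM mn by auto
    have e2: "mn * ((m t)^2 + mn + (n t)^2) \<le> M * M * (M^2 + M * M + M^2)"
      using mM nM mn M0 by (intro mult_mono add_mono power_mono) auto
    have e2': "0 \<le> mn * ((m t)^2 + mn + (n t)^2)" using mM nM mn by auto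
    have "\<bar>2 * l * (mn * (m t + n t))\<bar> = 2 * \<bar>l\<bar> * (mn * (m t + n t))" 
      unfolding abs_mult[of "2 * l"] abs_of_nonneg[OF e1'] by (simp add: abs_mult)
    also have "\<dots> \<le> 2 * \<bar>l\<bar> * (M * M * (M + M))" using e1 by (intro mult_left_mono) auto
    also have "\<dots> = 4 * \<bar>l\<bar> * M^3" by (simp add: power3_eq_cube)
    finally have "\<bar>2 * l * (mn * (m t + n t))\<bar> \<le> 4 * \<bar>l\<bar> * M^3" .
    moreover have "M * M * (M^2 + M * M + M^2) = 3 * M^4" by (simp add: power4_eq_xxxx power2_eq_square)
    ultimately have "\<bar>1 - 2 * l * (mn * (m t + n t)) - mn * ((m t)^2 + mn + (n t)^2)\<bar> \<le> K"
      unfolding K_def using e2 e2' by linarith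
    then have PQ': "\<bar>P t - Q t\<bar> \<le> \<bar>y t - z t\<bar> * K"
      unfolding PQ abs_mult by (intro mult_left_mono) auto
    have K0: "K \<ge> 0" unfolding K_def using M0 by (intro add_nonneg_nonneg mult_nonneg_nonneg) auto
    have "\<bar>D' t\<bar> \<le> 2 * \<bar>y t - z t\<bar> * \<bar>p t - q t\<bar> + 2 * \<bar>p t - q t\<bar> * \<bar>P t - Q t\<bar>"
      unfolding D'_def by (intro order_trans[OF abs_triangle_ineq]) (simp only: abs_mult abs_numeral order_refl)
    also have "\<dots> \<le> 2 * \<bar>y t - z t\<bar> * \<bar>p t - q t\<bar> + 2 * \<bar>p t - q t\<bar> * (\<bar>y t - z t\<bar> * K)"
      using PQ' by (intro add_left_mono mult_left_mono) auto
    also have "\<dots> = (1 + K) * (2 * \<bar>y t - z t\<bar> * \<bar>p t - q t\<bar>)" by (simp add: algebra_simps)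
    also have "\<dots> \<le> (1 + K) * D t"
    proof (intro mult_left_mono)
      have "0 \<le> (\<bar>y t - z t\<bar> - \<bar>p t - q t\<bar>)^2" by simp
      also have "\<dots> = D t - 2 * \<bar>y t - z t\<bar> * \<bar>p t - q t\<bar>" by (simp add: D_def power2_diff)
      finally show "2 * \<bar>y t - z t\<bar> * \<bar>p t - q t\<bar> \<le> D t" by simp
    qed (use K0 in simp)
    finally show ?thesis .
  qed
  have "D 0 = 0" by (simp add: D_def y_def z_def p_def q_def m(2,3) n(2,3))
  moreover have "D s \<ge> 0" by (simp add: D_def)
  ultimately have "D s = 0" 
    using zero_if_derivative_bounded_by_self[of "\<bar>s\<bar>" D D' "1 + K" s] D bound by blast
  then have "y s = z s" by (simp add: D_def sum_power2_eq_zero_iff)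
  then show "m s = n s" by (simp add: y_def z_def)
qed

lemma mu_of_eqI: "is_mu l e m \<Longrightarrow> mu_of l e = m"
  unfolding mu_of_def by (rule the_equality) (auto intro: is_mu_unique)

text \<open>In the solution, \<open>\<mu>'\<^sup>2 = \<mu>\<^sup>2 (e\<^sub>1 - \<mu>) (\<mu> - e\<^sub>2) R(\<mu>)\<close> with \<open>R\<close> the cofactor. The
  substitution \<open>\<mu> = X(t)\<close> absorbs both turning points, so \<open>t\<close> satisfies \<open>t' = h(t)\<close> with \<open>h > 0\<close>, solved
  by inverting the primitive \<open>S\<close> of \<open>1 / h\<close>.\<close>

locale orbit = slice +
  fixes e2 :: real
  assumes e2_gt: "hm < e2" and e2_less: "e2 < hp"
begin

definition "e1 = outer_root e2"
definition "c = c_of l e2"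

abbreviation "R \<equiv> cofactor e1 e2"

lemma e2_pos: "e2 > 0" using e2_gt hm_gt_0 by simp
lemma e2_less_e1: "e2 < e1" using outer_root_gt[of e2] e2_gt e2_less by (simp add: e1_def)
lemma e1_pos: "e1 > 0" using e2_pos e2_less_e1 by simp

lemma Q_factor: "Q_poly l c x = (x - e1) * (x - e2) * R x"
  unfolding c_def e1_def using e2_gt e2_less by (intro Q_poly_factor) auto

lemma R_ge: "x \<ge> e2 \<Longrightarrow> R e2 \<le> R x"
  and R_e2_pos: "R e2 > 0"
proof -
  show "R e2 > 0" unfolding e1_def using e2_gt e2_less by (intro cofactor_e2_pos) auto
  then show "x \<ge> e2 \<Longrightarrow> R e2 \<le> R x" using e1_pos e2_pos by (intro cofactor_mono) auto
qed

lemma R_pos: "x \<ge> e2 \<Longrightarrow> R x > 0" using R_ge[of x] R_e2_pos by simp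

lemma R_mono: "R x \<le> R y" if "e2 \<le> x" "x \<le> y"
proof -
  have "x * R y - y * R x = (y - x) * (x * y + 1 / (e1 * e2))"
    using e1_pos e2_pos by (simp add: cofactor_def field_simps power2_eq_square)
  also have "\<dots> \<ge> 0" using that e1_pos e2_pos by auto
  finally have "y * R x \<le> x * R y" by simp
  moreover have "x * R x \<le> y * R x" using that R_pos[of x] by (intro mult_right_mono) auto
  ultimately have "x * R x \<le> x * R y" by linarith
  then show ?thesis using that e2_pos by simp
qed

section \<open>The periodic solution and its least period\<close>

definition X :: "real \<Rightarrow> real" where
  "X t = (e1 + e2) / 2 - (e1 - e2) / 2 * cos t"

lemma X_bounds: "e2 \<le> X t" "X t \<le> e1"
proof -
  have "(e1 - e2) / 2 * cos t \<le> (e1 - e2) / 2 * 1" "(e1 - e2) / 2 * (-1) \<le> (e1 - e2) / 2 * cos t"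
    using e2_less_e1 by (intro mult_left_mono; simp)+
  then show "e2 \<le> X t" "X t \<le> e1" unfolding X_def by (simp_all add: field_simps)
qed

lemma X_pos: "X t > 0" using X_bounds[of t] e2_pos by simp
lemma X_0: "X 0 = e2" by (simp add: X_def field_simps)
lemma X_pi: "X pi = e1" by (simp add: X_def field_simps)
lemma X_even: "X (- t) = X t" by (simp add: X_def)
lemma X_periodic: "X (t + 2 * pi) = X t" by (simp add: X_def)

lemma X_eq_e2_iff: "X t = e2 \<longleftrightarrow> cos t = 1"
proof -
  have "X t - e2 = (e1 - e2) / 2 * (1 - cos t)" by (simp add: X_def field_simps)
  then show ?thesis using e2_less_e1 by auto
qed

lemma X_has_derivative: "(X has_real_derivative (e1 - e2) / 2 * sin t) (at t)"
  unfolding X_def[abs_def] by (auto intro!: derivative_eq_intros)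

definition h :: "real \<Rightarrow> real" where
  "h t = X t * sqrt (R (X t))"

lemma R_X_pos: "R (X t) > 0" using R_pos X_bounds by simp

lemma h_pos: "h t > 0" unfolding h_def using R_X_pos X_pos by simp

lemma h_le: "h t \<le> e1 * sqrt (R e1)"
  unfolding h_def using X_bounds[of t] X_pos[of t] R_mono[of "X t" e1] R_X_pos[of t]
  by (intro mult_mono real_sqrt_le_mono) auto

lemma h_ge: "h t \<ge> e2 * sqrt (R e2)"
  unfolding h_def using X_bounds[of t] e2_pos R_ge[of "X t"] R_e2_pos
  by (intro mult_mono real_sqrt_le_mono) auto

lemma h_even: "h (- t) = h t" and h_periodic: "h (t + 2 * pi) = h t"
  by (simp_all add: h_def X_even X_periodic)

lemma R_has_derivative: "(R has_real_derivative 2 * x + (4 * l + e1 + e2)) (at x)"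
  unfolding cofactor_def[abs_def] by (auto intro!: derivative_eq_intros)

lemma h_has_derivative:
  "(h has_real_derivative (e1 - e2) / 2 * sin t * (sqrt (R (X t)) + X t * (2 * X t + (4 * l + e1 + e2)) / (2 * sqrt (R (X t))))) (at t)"
proof -
  have "((\<lambda>t. R (X t)) has_real_derivative (2 * X t + (4 * l + e1 + e2)) * ((e1 - e2) / 2 * sin t)) (at t)"
    by (rule DERIV_chain2[OF R_has_derivative X_has_derivative])
  moreover have "(sqrt has_real_derivative inverse (sqrt (R (X t))) / 2) (at (R (X t)))"
    by (rule DERIV_real_sqrt[OF R_X_pos])
  ultimately have "((\<lambda>t. sqrt (R (X t))) has_real_derivative
      inverse (sqrt (R (X t))) / 2 * ((2 * X t + (4 * l + e1 + e2)) * ((e1 - e2) / 2 * sin t))) (at t)"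
    by (rule DERIV_chain2[rotated])
  from DERIV_mult[OF X_has_derivative this] show ?thesis
    unfolding h_def[abs_def]
    by (rule DERIV_cong) (use R_X_pos[of t] in \<open>simp add: field_simps\<close>)
qed

lemma continuous_h: "continuous_on S h"
  using h_has_derivative DERIV_isCont by (intro continuous_at_imp_continuous_on ballI) blast

definition S :: "real \<Rightarrow> real" where
  "S s = (LBINT t=ereal 0..ereal s. 1 / h t)"

lemma S_has_derivative: "(S has_real_derivative 1 / h t) (at t)"
  unfolding S_def[abs_def]
  by (intro has_primitive continuous_intros continuous_h) (use h_pos in \<open>auto simp: less_imp_neq[symmetric]\<close>)

lemma S_0: "S 0 = 0" by (simp add: S_def zero_ereal_def[symmetric])

lemma S_odd: "S (- t) = - S t"
  by (rule odd_if_derivative_even[OF S_has_derivative S_0]) (simp add: h_even)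

lemma S_add_period: "S (t + 2 * pi) = S t + S (2 * pi)"
  by (rule additive_if_derivative_periodic[OF S_has_derivative S_0]) (simp add: h_periodic)

lemma S_strict_mono: "S a < S b" if "a < b"
proof (rule DERIV_pos_imp_increasing[OF that])
  show "\<exists>y. (S has_real_derivative y) (at t) \<and> y > 0" for t
    using S_has_derivative h_pos[of t] by (intro exI[of _ "1 / h t"]) simp
qed

definition T :: "real \<Rightarrow> real" where
  "T = (SOME T. (\<forall>t. T (S t) = t) \<and> (\<forall>s. S (T s) = s) \<and> (\<forall>s. (T has_real_derivative h (T s)) (at s)))"

lemma T_S: "T (S t) = t" and S_T: "S (T s) = s" and T_has_derivative: "(T has_real_derivative h (T s)) (at s)"
proof -
  \<comment> \<open>The upper bound for \<open>h\<close> bounds the slope \<open>1 / h\<close> of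
    \<open>S\<close> from below; this is what makes the solution exist for all times.\<close>
  have "1 / (e1 * sqrt (R e1)) \<le> 1 / h t" for t
    using h_le[of t] h_pos[of t] by (intro divide_left_mono) (auto intro: mult_pos_pos less_le_trans)
  moreover have "1 / (e1 * sqrt (R e1)) > 0" using e1_pos R_pos[of e1] e2_less_e1 by simp
  ultimately obtain U where "\<And>t. U (S t) = t" "\<And>s. S (U s) = s"
    "\<And>s. (U has_real_derivative 1 / (1 / h (U s))) (at s)"
    using increasing_inverse[OF S_has_derivative] by metis
  then have "\<exists>T. (\<forall>t. T (S t) = t) \<and> (\<forall>s. S (T s) = s) \<and> (\<forall>s. (T has_real_derivative h (T s)) (at s))"
    by (intro exI[of _ U]) simp
  from someI_ex[OF this] show "T (S t) = t" "S (T s) = s" "(T has_real_derivative h (T s)) (at s)"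
    unfolding T_def[symmetric] by auto
qed

definition omega :: real where "omega = S (2 * pi)"
definition mu :: "real \<Rightarrow> real" where "mu s = X (T s)"
definition mu' :: "real \<Rightarrow> real" where "mu' s = (e1 - e2) / 2 * sin (T s) * h (T s)"

lemma omega_pos: "omega > 0" using S_strict_mono[of 0 "2 * pi"] by (simp add: omega_def S_0)

lemma T_0: "T 0 = 0" using T_S[of 0] by (simp add: S_0)
lemma T_less_iff: "T a < T b \<longleftrightarrow> a < b"
proof
  show "a < b" if "T a < T b" using S_strict_mono[OF that] by (simp add: S_T)
  show "T a < T b" if "a < b"
  proof (rule ccontr)
    assume "\<not> T a < T b"
    then have "S (T b) \<le> S (T a)" using S_strict_mono[of "T b" "T a"] by (cases "T a = T b") auto
    then show False using that by (simp add: S_T)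
  qed
qed

lemma T_odd: "T (- s) = - T s"
  using T_S[of "- T s"] by (simp add: S_odd S_T)
lemma T_add_period: "T (s + omega) = T s + 2 * pi"
  using T_S[of "T s + 2 * pi"] by (simp add: S_add_period S_T omega_def)
lemma S_pi: "S pi = omega / 2"
  using S_add_period[of "- pi"] by (simp add: S_odd omega_def)
lemma T_half: "T (omega / 2) = pi"
  using T_S[of pi] by (simp add: S_pi)

lemma mu_bounds: "e2 \<le> mu s" "mu s \<le> e1" by (simp_all add: mu_def X_bounds)
lemma mu_pos: "mu s > 0" by (simp add: mu_def X_pos)
lemma mu_0: "mu 0 = e2" by (simp add: mu_def T_0 X_0)
lemma mu'_0: "mu' 0 = 0" by (simp add: mu'_def T_0)
lemma mu_half: "mu (omega / 2) = e1" by (simp add: mu_def T_half X_pi)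
lemma mu'_half: "mu' (omega / 2) = 0" by (simp add: mu'_def T_half)
lemma mu_even: "mu (- s) = mu s" by (simp add: mu_def T_odd X_even)
lemma mu_periodic: "mu (s + omega) = mu s" by (simp add: mu_def T_add_period X_periodic)
lemma mu'_periodic: "mu' (s + omega) = mu' s" by (simp add: mu'_def T_add_period h_periodic)

lemma mu'_pos: "mu' s > 0" if "0 < s" "s < omega / 2"
proof -
  have "0 < T s" "T s < pi" using that T_less_iff[of 0 s] T_less_iff[of s "omega / 2"] by (auto simp: T_0 T_half)
  then show ?thesis unfolding mu'_def using e2_less_e1 h_pos sin_gt_zero by simp
qed

lemma mu_less_e1: "mu s < e1" if "- (omega / 2) < s" "s < omega / 2"
proof -
  have "- pi < T s" "T s < pi"
    using that[THEN T_less_iff[THEN iffD2]] by (simp_all only: T_odd T_half)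
  then have "\<bar>T s\<bar> < pi" by auto
  then have "cos pi < cos \<bar>T s\<bar>" by (intro cos_monotone_0_pi) auto
  then have "- 1 < cos (T s)" by simp
  then have "(e1 - e2) / 2 * (- 1) < (e1 - e2) / 2 * cos (T s)" using e2_less_e1 by (intro mult_strict_left_mono) auto
  then show ?thesis by (simp add: mu_def X_def field_simps)
qed

lemma mu_has_derivative: "(mu has_real_derivative mu' s) (at s)"
  unfolding mu_def[abs_def] mu'_def by (rule DERIV_chain2[OF X_has_derivative T_has_derivative])

lemma sin_square_X: "((e1 - e2) / 2 * sin t)^2 = (e1 - X t) * (X t - e2)"
proof -
  have "((e1 - e2) / 2 * sin t)^2 = ((e1 - e2) / 2)^2 * (1 - (cos t)^2)"
    by (simp only: power_mult_distrib sin_squared_eq)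
  then show ?thesis by (simp add: X_def power2_eq_square field_simps)
qed

lemma mu'_square: "(mu' s)^2 = - ((mu s)^2) * Q_poly l c (mu s)"
proof -
  have "(mu' s)^2 = ((e1 - X (T s)) * (X (T s) - e2)) * (h (T s))^2"
    unfolding mu'_def power_mult_distrib[of _ "h (T s)"] sin_square_X ..
  also have "(h (T s))^2 = (X (T s))^2 * R (X (T s))"
    using R_X_pos[of "T s"] by (simp add: h_def power_mult_distrib)
  finally show ?thesis unfolding Q_factor mu_def by (simp add: algebra_simps)
qed

text \<open>Both sides are the derivative of \<open>Q_poly l c\<close>, computed from the factored
  and from the expanded form; uniqueness of the derivative replaces a computation with the root
  relations.\<close>

lemma Q_derivative:
  "(2 * x - e1 - e2) * R x + (x - e1) * (x - e2) * (2 * x + (4 * l + e1 + e2))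
    = 4 * x^3 + 12 * l * x^2 + 8 * (l^2 - c) * x"
proof (rule DERIV_unique)
  show "((\<lambda>x. Q_poly l c x) has_real_derivative 4 * x^3 + 12 * l * x^2 + 8 * (l^2 - c) * x) (at x)"
    unfolding Q_poly_def by (auto intro!: derivative_eq_intros)
  show "((\<lambda>x. Q_poly l c x) has_real_derivative
    (2 * x - e1 - e2) * R x + (x - e1) * (x - e2) * (2 * x + (4 * l + e1 + e2))) (at x)"
    unfolding Q_factor by (auto intro!: derivative_eq_intros R_has_derivative simp: algebra_simps)
qed

text \<open>Differentiating \<open>mu'_square\<close> would give the equation only after division by
  \<open>mu'\<close>, which vanishes at the turning points. The explicit product is differentiated
  instead; the square roots pair up and leave \<open>- (x^2 / 2) * Q' - x * Q\<close>, valid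
  everywhere.\<close>

lemma mu'_has_derivative:
  "(mu' has_real_derivative 2 * (mu' s)^2 / mu s - mu s - 2 * l * (mu s)^4 - (mu s)^5) (at s)"
proof -
  define t where "t = T s"
  define x where "x = X t"
  define r where "r = (e1 - e2) / 2"
  define B where "B = 2 * x + (4 * l + e1 + e2)"
  have x: "x > 0" "sqrt (R x) > 0" "sqrt (R x) ^ 2 = R x" using X_pos R_X_pos[of t] by (auto simp: x_def)
  have "((\<lambda>s. r * sin (T s) * h (T s)) has_real_derivative
     (r * cos t * h t + r * sin t * (r * sin t * (sqrt (R x) + x * B / (2 * sqrt (R x))))) * h t) (at s)"
    unfolding r_def t_def x_def B_def
    by (rule derivative_eq_intros T_has_derivative DERIV_chain2[OF h_has_derivative T_has_derivative] refl)+
       (simp add: algebra_simps)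
  moreover have "(r * cos t * h t + r * sin t * (r * sin t * (sqrt (R x) + x * B / (2 * sqrt (R x))))) * h t
     = r * cos t * (h t)^2 + (r * sin t)^2 * ((sqrt (R x) + x * B / (2 * sqrt (R x))) * h t)"
  proof -
    have "(a + b * (b * W)) * H = a * H + b\<^sup>2 * (W * H)" for a b W H :: real
      by (simp add: power2_eq_square algebra_simps)
    from this[of "r * cos t * h t" "r * sin t" "sqrt (R x) + x * B / (2 * sqrt (R x))" "h t"]
    show ?thesis by (simp only: power2_eq_square mult.assoc)
  qed
  moreover have "(sqrt (R x) + x * B / (2 * sqrt (R x))) * h t = x * R x + x^2 * B / 2"
    using x unfolding h_def x_def[symmetric] by (simp add: field_simps power2_eq_square)
  moreover have "r * cos t * (h t)^2 + (r * sin t)^2 * (x * R x + x^2 * B / 2)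
     = ((e1 + e2) / 2 - x) * (x^2 * R x) + (e1 - x) * (x - e2) * (x * R x + x^2 * B / 2)"
    using x unfolding r_def sin_square_X by (simp add: h_def x_def[symmetric] power_mult_distrib) (simp add: X_def x_def)
  moreover have "\<dots> = - (x^2 / 2) * ((2 * x - e1 - e2) * R x + (x - e1) * (x - e2) * B) - x * ((x - e1) * (x - e2) * R x)"
    by (simp add: field_simps power2_eq_square)
  moreover have "\<dots> = - (x^2 / 2) * (4 * x^3 + 12 * l * x^2 + 8 * (l^2 - c) * x) - x * Q_poly l c x"
    unfolding B_def Q_derivative Q_factor ..
  moreover have "\<dots> = 2 * (mu' s)^2 / mu s - mu s - 2 * l * (mu s)^4 - (mu s)^5"
    unfolding mu'_square mu_def t_def[symmetric] x_def[symmetric] using x(1)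
    by (simp add: Q_poly_def field_simps eval_nat_numeral)
  ultimately show ?thesis
    unfolding mu'_def[abs_def] r_def by simp
qed

lemma is_mu: "is_mu l e2 mu"
  unfolding is_mu_def using mu_pos mu_0 mu'_0 mu_has_derivative mu'_has_derivative by blast

lemma mu_of_eq: "mu_of l e2 = mu" by (rule mu_of_eqI[OF is_mu])

text \<open>A period \<open>p\<close> brings \<open>mu\<close> back to its minimum
  \<open>e2\<close>, which forces \<open>T p\<close> to be a positive multiple of
  \<open>2 * pi\<close>.\<close>

lemma omega_of_eq: "omega_of l e2 = omega"
  unfolding omega_of_def least_period_def mu_of_eq
proof (rule Least_equality)
  show "periodic_with mu omega" using omega_pos mu_periodic by (simp add: periodic_with_def)
  fix p assume p: "periodic_with mu p"
  then have "p > 0" "mu p = e2" using mu_0 unfolding periodic_with_def by (auto dest: spec[of _ 0])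
  then have "cos (T p) = 1" "T p > 0" using T_less_iff[of 0 p] by (auto simp: mu_def X_eq_e2_iff T_0)
  then obtain n :: int where n: "T p = of_int n * 2 * pi" using cos_one_2pi_int by auto
  then have "n > 0" using \<open>T p > 0\<close> by (simp add: zero_less_mult_iff)
  then have "1 * (2 * pi) \<le> of_int n * (2 * pi)" by (intro mult_right_mono) auto
  then have "T omega \<le> T p" using n T_add_period[of 0] by (simp add: T_0)
  then show "omega \<le> p" using T_less_iff[of p omega] by simp
qed

end

section \<open>The curve and its frame\<close>

lemma has_vector_derivative_vector_3:
  assumes "(a has_real_derivative a') (at s)" "(b has_real_derivative b') (at s)" "(c has_real_derivative c') (at s)"
  shows "((\<lambda>s. vector [a s, b s, c s] :: real^3) has_vector_derivative vector [a', b', c']) (at s)"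
proof -
  have eq: "(vector [x, y, z] :: real^3) = x *\<^sub>R axis 1 1 + (y *\<^sub>R axis 2 1 + z *\<^sub>R axis 3 1)" for x y z
    by (simp add: vec_eq_iff forall_3 axis_def)
  have "((\<lambda>s. f s *\<^sub>R v) has_vector_derivative f' *\<^sub>R v) (at s)"
    if "(f has_real_derivative f') (at s)" for f f' and v :: "real^3"
    using has_vector_derivative_scaleR[OF that has_vector_derivative_const[of v]] by simp
  from has_vector_derivative_add[OF this[OF assms(1)] has_vector_derivative_add[OF this[OF assms(2)] this[OF assms(3)]]]
  show ?thesis unfolding eq .
qed

text \<open>Inside a class closed under differentiation the derivatives of all orders can be chosen
  by iteration, with no formula for them.\<close>

lemma smooth_curve_if_closed_under_derivative:
  assumes closed: "\<And>f. f \<in> A \<Longrightarrow> \<exists>g\<in>A. \<forall>s. (f has_real_derivative g s) (at s)"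
    and "a \<in> A" "b \<in> A" "c \<in> A"
  shows "smooth_curve (\<lambda>s. vector [a s, b s, c s])"
proof -
  obtain d where d: "\<And>f. f \<in> A \<Longrightarrow> d f \<in> A" "\<And>f s. f \<in> A \<Longrightarrow> (f has_real_derivative d f s) (at s)"
    using closed by metis
  have iter: "(d ^^ n) f \<in> A" if "f \<in> A" for n f
    using that by (induction n) (auto intro: d)
  define D where "D n s = (vector [(d ^^ n) a s, (d ^^ n) b s, (d ^^ n) c s] :: real^3)" for n s
  have "(D n has_vector_derivative D (Suc n) s) (at s)" for n s
    unfolding D_def[abs_def] using d(2)[OF iter] assms
    by (intro has_vector_derivative_vector_3) auto
  moreover have "D 0 = (\<lambda>s. vector [a s, b s, c s])" by (simp add: D_def[abs_def])
  ultimately show ?thesis unfolding smooth_curve_def by blast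
qed

inductive_set function_algebra :: "(real \<Rightarrow> real) set \<Rightarrow> (real \<Rightarrow> real) set" for B where
  generator: "f \<in> B \<Longrightarrow> f \<in> function_algebra B"
| const: "(\<lambda>s. c) \<in> function_algebra B"
| add: "f \<in> function_algebra B \<Longrightarrow> g \<in> function_algebra B \<Longrightarrow> (\<lambda>s. f s + g s) \<in> function_algebra B"
| mult: "f \<in> function_algebra B \<Longrightarrow> g \<in> function_algebra B \<Longrightarrow> (\<lambda>s. f s * g s) \<in> function_algebra B"

text \<open>By the sum and product rules, closure under differentiation has to be checked on the
  generators only.\<close>

lemma function_algebra_closed_under_derivative:
  assumes "\<And>f. f \<in> B \<Longrightarrow> \<exists>g\<in>function_algebra B. \<forall>s. (f has_real_derivative g s) (at s)"
    and "f \<in> function_algebra B"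
  shows "\<exists>g\<in>function_algebra B. \<forall>s. (f has_real_derivative g s) (at s)"
  using assms(2)
proof induction
  case (generator f)
  then show ?case by (rule assms(1))
next
  case (const c)
  show ?case by (intro bexI[of _ "\<lambda>s. 0"]) (auto intro: function_algebra.const)
next
  case (add f g)
  then obtain f' g' where "f' \<in> function_algebra B" "g' \<in> function_algebra B"
    "\<And>s. (f has_real_derivative f' s) (at s)" "\<And>s. (g has_real_derivative g' s) (at s)" by blast
  then show ?case
    by (intro bexI[of _ "\<lambda>s. f' s + g' s"]) (auto intro!: function_algebra.add DERIV_add)
next
  case (mult f g)
  then obtain f' g' where "f' \<in> function_algebra B" "g' \<in> function_algebra B"
    "\<And>s. (f has_real_derivative f' s) (at s)" "\<And>s. (g has_real_derivative g' s) (at s)" by blast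
  with mult show ?case
    by (intro bexI[of _ "\<lambda>s. f' s * g s + g' s * f s"])
       (auto intro!: function_algebra.add function_algebra.mult DERIV_mult)
qed

lemma periodic_multiple:
  fixes f :: "real \<Rightarrow> 'a"
  assumes "\<And>s. f (s + p) = f s"
  shows "f (s + of_int m * p) = f s"
proof -
  have nat: "f (s + real n * p) = f s" for n s
  proof (induction n)
    case (Suc n)
    have "f (s + real (Suc n) * p) = f (s + real n * p + p)" by (simp add: algebra_simps)
    then show ?case using Suc assms by simp
  qed simp
  show ?thesis
  proof (cases "m \<ge> 0")
    case True
    then show ?thesis using nat[of s "nat m"] by simp
  next
    case False
    then show ?thesis using nat[of "s + of_int m * p" "nat (- m)"] by simp
  qed
qed

locale timelike_orbit = orbit +
  assumes c_neg: "c < 0"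
begin

definition k :: real where "k = sqrt (- c)"
text \<open>Half of \<open>y\<close>, \<open>beta\<close> and \<open>- alpha\<close> are the
  components of the momentum along the curve, its tangent and its normal;
  \<open>alpha_beta_square\<close> thus says that the momentum has Lorentz square
  \<open>c\<close>.\<close>

definition y :: "real \<Rightarrow> real" where "y s = 1 / mu s"
definition alpha :: "real \<Rightarrow> real" where "alpha s = mu s + 2 * l"
definition beta :: "real \<Rightarrow> real" where "beta s = mu' s / (mu s)^2"
definition tau :: "real \<Rightarrow> real" where "tau s = alpha s / (y s + 2 * k)"
definition Psi :: "real \<Rightarrow> real" where "Psi s = (LBINT t=ereal 0..ereal s. (mu t)^2 + tau t)"

lemma k_pos: "k > 0" and k_square: "k^2 = - c" using c_neg by (auto simp: k_def)
lemma y_pos: "y s > 0" using mu_pos by (simp add: y_def)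
lemma mu_y: "mu s * y s = 1" using mu_pos[of s] by (simp add: y_def)
lemma tau_y: "tau s * (y s + 2 * k) = alpha s" using y_pos[of s] k_pos by (simp add: tau_def)

lemma alpha_beta_square: "(alpha s)^2 + (beta s)^2 = (y s)^2 - 4 * k^2"
proof -
  have "(beta s)^2 = - Q_poly l c (mu s) / (mu s)^2"
    using mu_pos[of s] unfolding beta_def power_divide mu'_square by (simp add: field_simps power2_eq_square)
  then show ?thesis
    using mu_pos[of s] unfolding k_square by (simp add: alpha_def y_def Q_poly_def field_simps eval_nat_numeral)
qed

lemma y_has_derivative: "(y has_real_derivative - beta s) (at s)"
proof -
  have "mu s \<noteq> 0" using mu_pos[of s] by simp
  then show ?thesis unfolding y_def[abs_def] beta_def
    by (auto intro!: derivative_eq_intros mu_has_derivative simp: power2_eq_square)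
qed

lemma alpha_has_derivative: "(alpha has_real_derivative (mu s)^2 * beta s) (at s)"
proof -
  have "mu s \<noteq> 0" using mu_pos[of s] by simp
  then show ?thesis unfolding alpha_def[abs_def] beta_def
    by (auto intro!: derivative_eq_intros mu_has_derivative)
qed

lemma beta_has_derivative: "(beta has_real_derivative - y s - (mu s)^2 * alpha s) (at s)"
proof -
  have m: "mu s \<noteq> 0" using mu_pos[of s] by simp
  have "(beta has_real_derivative ((2 * (mu' s)^2 / mu s - mu s - 2 * l * (mu s)^4 - (mu s)^5) * (mu s)^2
      - mu' s * (2 * mu s * mu' s)) / ((mu s)^2 * (mu s)^2)) (at s)"
    unfolding beta_def[abs_def] using m
    by (intro DERIV_divide) (auto intro!: derivative_eq_intros mu_has_derivative mu'_has_derivative)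
  also have "((2 * (mu' s)^2 / mu s - mu s - 2 * l * (mu s)^4 - (mu s)^5) * (mu s)^2
      - mu' s * (2 * mu s * mu' s)) / ((mu s)^2 * (mu s)^2) = - y s - (mu s)^2 * alpha s"
    using m by (simp add: y_def alpha_def field_simps eval_nat_numeral)
  finally show ?thesis .
qed

lemma tau_has_derivative: "(tau has_real_derivative ((mu s)^2 + tau s) * beta s / (y s + 2 * k)) (at s)"
proof -
  have yk: "y s + 2 * k \<noteq> 0" using y_pos[of s] k_pos by simp
  have "(tau has_real_derivative ((mu s)^2 * beta s * (y s + 2 * k) - alpha s * (- beta s)) / ((y s + 2 * k) * (y s + 2 * k))) (at s)"
    unfolding tau_def[abs_def] using yk
    by (intro DERIV_divide) (auto intro!: derivative_eq_intros alpha_has_derivative y_has_derivative)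
  also have "(mu s)^2 * beta s * (y s + 2 * k) - alpha s * (- beta s) = ((mu s)^2 + tau s) * beta s * (y s + 2 * k)"
    unfolding tau_y[of s, symmetric] by (simp add: algebra_simps)
  also have "\<dots> / ((y s + 2 * k) * (y s + 2 * k)) = ((mu s)^2 + tau s) * beta s / (y s + 2 * k)"
    using yk by simp
  finally show ?thesis .
qed

lemma continuous_mu: "continuous_on A mu"
  using mu_has_derivative DERIV_isCont by (intro continuous_at_imp_continuous_on ballI) blast

lemma continuous_tau: "continuous_on A tau"
  using tau_has_derivative DERIV_isCont by (intro continuous_at_imp_continuous_on ballI) blast

lemma Psi_has_derivative: "(Psi has_real_derivative (mu s)^2 + tau s) (at s)"
  unfolding Psi_def[abs_def]
  by (intro has_primitive continuous_intros continuous_mu continuous_tau)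

lemma Psi_0: "Psi 0 = 0" by (simp add: Psi_def zero_ereal_def[symmetric])

lemma y_periodic: "y (s + omega) = y s" and alpha_periodic: "alpha (s + omega) = alpha s" and beta_periodic: "beta (s + omega) = beta s"
  and tau_periodic: "tau (s + omega) = tau s"
  by (simp_all add: y_def alpha_def beta_def tau_def mu_periodic mu'_periodic)

lemma tau_even: "tau (- s) = tau s" by (simp add: tau_def alpha_def y_def mu_even)

lemma Psi_add_period: "Psi (s + omega) = Psi s + Psi omega"
  by (rule additive_if_derivative_periodic[OF Psi_has_derivative Psi_0]) (simp add: mu_periodic tau_periodic)

text \<open>At angle 0 the triple \<open>curve\<close>, \<open>normal\<close>,
  \<open>- tangent\<close> consists of the images of the coordinate axes under the Lorentz boost
  that sends the first axis to \<open>(y, alpha, beta) / (2 * k)\<close>; the frame is this boost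
  followed by the rotation by \<open>Psi\<close>. Unlike polar coordinates, it stays regular where
  \<open>alpha\<close> and \<open>beta\<close> both vanish.\<close>

definition curve :: "real \<Rightarrow> real^3" where
  "curve s = vector [y s / (2 * k), (alpha s * cos (Psi s) - beta s * sin (Psi s)) / (2 * k),
     (alpha s * sin (Psi s) + beta s * cos (Psi s)) / (2 * k)]"

definition tangent :: "real \<Rightarrow> real^3" where
  "tangent s = vector [- beta s / (2 * k),
     (- (tau s * beta s) * cos (Psi s) - (tau s * alpha s - y s) * sin (Psi s)) / (2 * k),
     (- (tau s * beta s) * sin (Psi s) + (tau s * alpha s - y s) * cos (Psi s)) / (2 * k)]"

definition normal :: "real \<Rightarrow> real^3" where
  "normal s = vector [alpha s / (2 * k),
     ((2 * k + tau s * alpha s) * cos (Psi s) - tau s * beta s * sin (Psi s)) / (2 * k),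
     ((2 * k + tau s * alpha s) * sin (Psi s) + tau s * beta s * cos (Psi s)) / (2 * k)]"

lemma curve_has_derivative: "(curve has_vector_derivative tangent s) (at s)"
  unfolding curve_def[abs_def] tangent_def
proof (rule has_vector_derivative_vector_3)
  have k: "2 * k \<noteq> 0" using k_pos by simp
  note d = y_has_derivative alpha_has_derivative beta_has_derivative Psi_has_derivative
    DERIV_chain2[OF DERIV_sin Psi_has_derivative] DERIV_chain2[OF DERIV_cos Psi_has_derivative]
  show "((\<lambda>s. y s / (2 * k)) has_real_derivative - beta s / (2 * k)) (at s)"
    by (intro DERIV_cdivide d)
  show "((\<lambda>s. (alpha s * cos (Psi s) - beta s * sin (Psi s)) / (2 * k)) has_real_derivative
     (- (tau s * beta s) * cos (Psi s) - (tau s * alpha s - y s) * sin (Psi s)) / (2 * k)) (at s)"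
    by (intro DERIV_cdivide, rule DERIV_cong, (rule DERIV_diff DERIV_mult d)+) (simp add: algebra_simps)
  show "((\<lambda>s. (alpha s * sin (Psi s) + beta s * cos (Psi s)) / (2 * k)) has_real_derivative
     (- (tau s * beta s) * sin (Psi s) + (tau s * alpha s - y s) * cos (Psi s)) / (2 * k)) (at s)"
    by (intro DERIV_cdivide, rule DERIV_cong, (rule DERIV_add DERIV_mult d)+) (simp add: algebra_simps)
qed

text \<open>The Frenet equation; comparison with the definition of geodesic curvature gives the
  curvature \<open>mu^2\<close>.\<close>

lemma tangent_has_derivative: "(tangent has_vector_derivative curve s + (mu s)^2 *\<^sub>R normal s) (at s)"
proof -
  define C D where "C = cos (Psi s)" and "D = sin (Psi s)"
  have k: "k \<noteq> 0" using k_pos by simp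
  have yk: "y s + 2 * k \<noteq> 0" using y_pos[of s] k_pos by simp
  have be2: "(beta s)^2 / (y s + 2 * k) = y s - 2 * k - tau s * alpha s"
  proof -
    have "(beta s)^2 = (y s - 2 * k) * (y s + 2 * k) - alpha s * (tau s * (y s + 2 * k))"
      using alpha_beta_square[of s] unfolding tau_y by (simp add: power2_eq_square algebra_simps)
    then show ?thesis using yk by (simp add: field_simps)
  qed
  define P where "P = (mu s)^2 + tau s"
  \<comment> \<open>A vector with coordinates \<open>(p, q)\<close> in a plane rotating at the rate
    \<open>P\<close> has the derivative \<open>(p' - P * q, q' + P * p)\<close> in that plane; facts
    \<open>1\<close> and \<open>2\<close> match it with the right-hand side at angle 0.\<close>
  define p q p' q' where "p = - (tau s * beta s)" and "q = tau s * alpha s - y s"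
    and "p' = - (P * beta s / (y s + 2 * k) * beta s + tau s * (- y s - (mu s)^2 * alpha s))"
    and "q' = P * beta s / (y s + 2 * k) * alpha s + tau s * ((mu s)^2 * beta s) + beta s"
  have dp: "((\<lambda>s. - (tau s * beta s)) has_real_derivative p') (at s)"
    unfolding p'_def P_def
    by (rule DERIV_cong, (rule derivative_intros tau_has_derivative beta_has_derivative)+) (simp add: algebra_simps)
  have dq: "((\<lambda>s. tau s * alpha s - y s) has_real_derivative q') (at s)"
    unfolding q'_def P_def
    by (rule DERIV_cong, (rule derivative_intros tau_has_derivative alpha_has_derivative y_has_derivative)+) (simp add: algebra_simps)
  have 1: "p' - P * q = alpha s + (mu s)^2 * (2 * k + tau s * alpha s)"
  proof -
    have "p' = - (P * ((beta s)^2 / (y s + 2 * k))) + tau s * (y s + (mu s)^2 * alpha s)"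
      by (simp add: p'_def power2_eq_square algebra_simps)
    also have "\<dots> = - (P * (y s - 2 * k - tau s * alpha s)) + tau s * (y s + (mu s)^2 * alpha s)" unfolding be2 ..
    finally have "p' - P * q = (mu s)^2 * (2 * k + tau s * alpha s) + tau s * (y s + 2 * k)"
      by (simp add: P_def q_def algebra_simps)
    then show ?thesis unfolding tau_y by simp
  qed
  have 2: "q' + P * p = beta s + (mu s)^2 * (tau s * beta s)"
  proof -
    have "alpha s / (y s + 2 * k) = tau s" by (simp add: tau_def)
    then have "P * beta s / (y s + 2 * k) * alpha s = P * beta s * tau s" by (metis times_divide_eq_left times_divide_eq_right)
    then show ?thesis by (simp add: q'_def p_def P_def algebra_simps)
  qed
  have c1: "((\<lambda>s. - beta s / (2 * k)) has_real_derivative (y s + (mu s)^2 * alpha s) / (2 * k)) (at s)"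
    by (intro DERIV_cdivide, rule DERIV_cong, (rule DERIV_minus beta_has_derivative)+) simp
  have c2: "((\<lambda>s. (- (tau s * beta s) * cos (Psi s) - (tau s * alpha s - y s) * sin (Psi s)) / (2 * k)) has_real_derivative
      ((p' - P * q) * C - (q' + P * p) * D) / (2 * k)) (at s)"
    by (intro DERIV_cdivide, rule DERIV_cong, (rule DERIV_diff DERIV_mult dp dq DERIV_chain2[OF DERIV_sin Psi_has_derivative]
          DERIV_chain2[OF DERIV_cos Psi_has_derivative])+)
       (simp add: P_def p_def q_def C_def D_def algebra_simps)
  have c3: "((\<lambda>s. (- (tau s * beta s) * sin (Psi s) + (tau s * alpha s - y s) * cos (Psi s)) / (2 * k)) has_real_derivative
      ((p' - P * q) * D + (q' + P * p) * C) / (2 * k)) (at s)"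
    by (intro DERIV_cdivide, rule DERIV_cong, (rule DERIV_add DERIV_mult dp dq DERIV_chain2[OF DERIV_sin Psi_has_derivative]
          DERIV_chain2[OF DERIV_cos Psi_has_derivative])+)
       (simp add: P_def p_def q_def C_def D_def algebra_simps)
  have "curve s + (mu s)^2 *\<^sub>R normal s = vector [(y s + (mu s)^2 * alpha s) / (2 * k),
     ((p' - P * q) * C - (q' + P * p) * D) / (2 * k), ((p' - P * q) * D + (q' + P * p) * C) / (2 * k)]"
    unfolding 1 2 using k by (simp add: curve_def normal_def vec_eq_iff forall_3 C_def D_def field_simps)
  then show ?thesis
    using has_vector_derivative_vector_3[OF c1 c2 c3] by (simp add: tangent_def[abs_def])
qed

lemma trig_sum_squares:
  fixes a b :: real
  shows "(a * cos t - b * sin t)^2 + (a * sin t + b * cos t)^2 = a^2 + b^2"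
proof -
  have "(a * C - b * D)^2 + (a * D + b * C)^2 = (a^2 + b^2) * (D^2 + C^2)" for C D :: real
    by (simp add: power2_eq_square algebra_simps)
  from this[of "cos t" "sin t"] show ?thesis by simp
qed

lemma lorentz_rotated:
  "lorentz (vector [x / d, (a * cos t - b * sin t) / d, (a * sin t + b * cos t) / d])
     (vector [x / d, (a * cos t - b * sin t) / d, (a * sin t + b * cos t) / d]) = (a^2 + b^2 - x^2) / d^2"
proof -
  have "lorentz (vector [x / d, p / d, q / d]) (vector [x / d, p / d, q / d]) = (p^2 + q^2 - x^2) / d^2" for p q
    by (simp add: lorentz_def power2_eq_square add_divide_distrib diff_divide_distrib)
  from this[of "a * cos t - b * sin t" "a * sin t + b * cos t"] show ?thesis unfolding trig_sum_squares .
qed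

lemma tau_square: "(tau s)^2 * ((alpha s)^2 + (beta s)^2) = tau s * alpha s * (y s - 2 * k)"
proof -
  have "(tau s)^2 * ((alpha s)^2 + (beta s)^2) = tau s * (tau s * (y s + 2 * k)) * (y s - 2 * k)"
    unfolding alpha_beta_square by (simp add: power2_eq_square algebra_simps)
  then show ?thesis by (simp add: tau_y)
qed

lemma tau_alpha_y: "tau s * alpha s * y s + 2 * k * (tau s * alpha s) = (alpha s)^2"
  using tau_y[of s] by (metis distrib_left mult.assoc mult.commute power2_eq_square)

lemma lorentz_curve: "lorentz (curve s) (curve s) = -1"
  unfolding curve_def lorentz_rotated alpha_beta_square using k_pos by (simp add: power_mult_distrib)

lemma lorentz_tangent: "lorentz (tangent s) (tangent s) = 1"
proof -
  have "(- (tau s * beta s))^2 + (tau s * alpha s - y s)^2 - (- beta s)^2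
     = (tau s)^2 * ((alpha s)^2 + (beta s)^2) - 2 * (tau s * alpha s * y s) + (y s)^2 - (beta s)^2"
    by (simp add: power2_eq_square algebra_simps)
  also have "\<dots> = (y s)^2 - (alpha s)^2 - (beta s)^2"
    unfolding tau_square using tau_alpha_y[of s] by (simp add: algebra_simps)
  finally have "(- (tau s * beta s))^2 + (tau s * alpha s - y s)^2 - (- beta s)^2 = 4 * k^2" using alpha_beta_square[of s] by simp
  then show ?thesis unfolding tangent_def lorentz_rotated using k_pos by (simp add: power_mult_distrib)
qed

lemma lorentz_normal: "lorentz (normal s) (normal s) = 1"
proof -
  have "(2 * k + tau s * alpha s)^2 + (tau s * beta s)^2 - (alpha s)^2
     = (tau s)^2 * ((alpha s)^2 + (beta s)^2) + 4 * k * (tau s * alpha s) + 4 * k^2 - (alpha s)^2"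
    by (simp add: power2_eq_square algebra_simps)
  also have "\<dots> = 4 * k^2"
    unfolding tau_square using tau_alpha_y[of s] by (simp add: algebra_simps)
  finally show ?thesis unfolding normal_def lorentz_rotated using k_pos by (simp add: power_mult_distrib)
qed

lemma lcross_curve_tangent: "lcross (curve s) (tangent s) = normal s"
proof -
  define C D where "C = cos (Psi s)" and "D = sin (Psi s)"
  have k: "k \<noteq> 0" using k_pos by simp
  have CD: "C * C + D * D = 1" by (simp add: C_def D_def flip: power2_eq_square)
  define p q where "p = - (tau s * beta s)" and "q = tau s * alpha s - y s"
  have f1: "alpha s * q - beta s * p = - (2 * k * alpha s)"
  proof -
    have "alpha s * q - beta s * p = tau s * ((alpha s)^2 + (beta s)^2) - alpha s * y s"
      by (simp add: p_def q_def power2_eq_square algebra_simps)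
    also have "\<dots> = tau s * (y s + 2 * k) * (y s - 2 * k) - alpha s * y s"
      unfolding alpha_beta_square by (simp add: power2_eq_square algebra_simps)
    finally show ?thesis unfolding tau_y by (simp add: algebra_simps)
  qed
  have f2: "- (beta s * beta s) - y s * q = 2 * k * (2 * k + tau s * alpha s)"
    using alpha_beta_square[of s] tau_alpha_y[of s] by (simp add: q_def power2_eq_square algebra_simps)
  have f3: "alpha s * beta s + y s * p = 2 * k * (tau s * beta s)"
  proof -
    have "alpha s * beta s = tau s * (y s + 2 * k) * beta s" by (simp add: tau_y)
    then show ?thesis by (simp add: p_def algebra_simps)
  qed
  have "- ((alpha s * C - beta s * D) * (p * D + q * C) - (alpha s * D + beta s * C) * (p * C - q * D))
      = - ((alpha s * q - beta s * p) * (C * C + D * D))" by (simp add: algebra_simps)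
  then have g1: "- ((alpha s * C - beta s * D) * (p * D + q * C) - (alpha s * D + beta s * C) * (p * C - q * D)) = 2 * k * alpha s"
    unfolding CD f1 by simp
  have g2: "(alpha s * D + beta s * C) * (- beta s) - y s * (p * D + q * C)
      = 2 * k * ((2 * k + tau s * alpha s) * C - tau s * beta s * D)"
  proof -
    have "(alpha s * D + beta s * C) * (- beta s) - y s * (p * D + q * C)
      = (- (beta s * beta s) - y s * q) * C - (alpha s * beta s + y s * p) * D" by (simp add: algebra_simps)
    then show ?thesis unfolding f2 f3 by (simp add: algebra_simps)
  qed
  have g3: "y s * (p * C - q * D) - (alpha s * C - beta s * D) * (- beta s)
      = 2 * k * ((2 * k + tau s * alpha s) * D + tau s * beta s * C)"
  proof -
    have "y s * (p * C - q * D) - (alpha s * C - beta s * D) * (- beta s)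
      = (- (beta s * beta s) - y s * q) * D + (alpha s * beta s + y s * p) * C" by (simp add: algebra_simps)
    then show ?thesis unfolding f2 f3 by (simp add: algebra_simps)
  qed
  have "lcross (curve s) (tangent s) = vector
    [- ((alpha s * C - beta s * D) * (p * D + q * C) - (alpha s * D + beta s * C) * (p * C - q * D)) / (4 * k^2),
     ((alpha s * D + beta s * C) * (- beta s) - y s * (p * D + q * C)) / (4 * k^2),
     (y s * (p * C - q * D) - (alpha s * C - beta s * D) * (- beta s)) / (4 * k^2)]"
    unfolding lcross_def cross3_def curve_def tangent_def C_def[symmetric] D_def[symmetric] p_def[symmetric] q_def[symmetric]
    using k by (simp add: vec_eq_iff forall_3 field_simps power2_eq_square)
  also have "\<dots> = normal s"
    unfolding g1 g2 g3 normal_def C_def[symmetric] D_def[symmetric] using k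
    by (simp add: vec_eq_iff forall_3 power2_eq_square field_simps)
  finally show ?thesis .
qed

lemma velocity_curve: "velocity curve s = tangent s"
  by (rule vector_derivative_at[OF curve_has_derivative])

lemma geodesic_curvature_curve: "geodesic_curvature curve s = (mu s)^2"
  unfolding geodesic_curvature_def velocity_curve lcross_curve_tangent
    vector_derivative_at[OF tangent_has_derivative]
proof (rule the_equality)
  fix a assume "curve s + (mu s)\<^sup>2 *\<^sub>R normal s = curve s + a *\<^sub>R normal s"
  then have "(a - (mu s)^2) *\<^sub>R normal s = 0" by (simp only: scaleR_left_diff_distrib add_left_cancel) simp
  then have "a - (mu s)^2 = 0 \<or> normal s = 0" by (simp only: scaleR_eq_0_iff)
  moreover have "normal s \<noteq> 0" using lorentz_normal[of s] by (auto simp: lorentz_def)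
  ultimately show "a = (mu s)^2" by auto
qed simp

lemma blaschke_curve: "blaschke curve = mu"
  using mu_pos by (auto simp: blaschke_def geodesic_curvature_curve less_imp_le)

lemma deriv_mu: "deriv mu s = mu' s"
  by (rule DERIV_imp_deriv[OF mu_has_derivative])

text \<open>Chosen so that every derivative is again a polynomial in them: \<open>mu'\<close> is
  \<open>mu^2 * beta\<close>, \<open>alpha\<close> is \<open>mu + 2 * l\<close>, and
  \<open>tau\<close> enters through the last generator.\<close>

definition generators :: "(real \<Rightarrow> real) set" where
  "generators = {mu, y, beta, \<lambda>s. cos (Psi s), \<lambda>s. sin (Psi s), \<lambda>s. 1 / (y s + 2 * k)}"

lemma smooth_curve: "smooth_curve curve"
proof -
  let ?A = "function_algebra generators"
  have gen: "mu \<in> ?A" "y \<in> ?A" "beta \<in> ?A" "(\<lambda>s. cos (Psi s)) \<in> ?A" "(\<lambda>s. sin (Psi s)) \<in> ?A"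
    "(\<lambda>s. 1 / (y s + 2 * k)) \<in> ?A"
    by (auto intro: function_algebra.generator simp: generators_def)
  note intros = function_algebra.add function_algebra.mult function_algebra.const gen
  have Psi': "mu s * mu s + (mu s + 2 * l) * (1 / (y s + 2 * k)) = (mu s)^2 + tau s" for s
    by (simp add: tau_def alpha_def power2_eq_square)
  have "\<exists>g\<in>?A. \<forall>s. (f has_real_derivative g s) (at s)" if f: "f \<in> generators" for f
  proof -
    consider "f = mu" | "f = y" | "f = beta" | "f = (\<lambda>s. cos (Psi s))" | "f = (\<lambda>s. sin (Psi s))"
      | "f = (\<lambda>s. 1 / (y s + 2 * k))" using f by (auto simp: generators_def)
    then show ?thesis
    proof cases
      case 1
      have "(mu has_real_derivative mu s * mu s * beta s) (at s)" for s
        by (rule DERIV_cong[OF mu_has_derivative]) (use mu_pos[of s] in \<open>simp add: beta_def power2_eq_square\<close>)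
      then show ?thesis unfolding 1 by (intro bexI[of _ "\<lambda>s. mu s * mu s * beta s"] allI intros)
    next
      case 2
      have "(y has_real_derivative (-1) * beta s) (at s)" for s
        by (rule DERIV_cong[OF y_has_derivative]) simp
      then show ?thesis unfolding 2 by (intro bexI[of _ "\<lambda>s. (-1) * beta s"] allI intros)
    next
      case 3
      have "(beta has_real_derivative (-1) * y s + (-1) * (mu s * mu s) * (mu s + 2 * l)) (at s)" for s
        by (rule DERIV_cong[OF beta_has_derivative]) (simp add: alpha_def power2_eq_square)
      then show ?thesis unfolding 3
        by (intro bexI[of _ "\<lambda>s. (-1) * y s + (-1) * (mu s * mu s) * (mu s + 2 * l)"] allI intros)
    next
      case 4
      have "((\<lambda>s. cos (Psi s)) has_real_derivative
          (-1) * sin (Psi s) * (mu s * mu s + (mu s + 2 * l) * (1 / (y s + 2 * k)))) (at s)" for s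
        unfolding Psi' by (rule DERIV_cong[OF DERIV_chain2[OF DERIV_cos Psi_has_derivative]]) simp
      then show ?thesis unfolding 4
        by (intro bexI[of _ "\<lambda>s. (-1) * sin (Psi s) * (mu s * mu s + (mu s + 2 * l) * (1 / (y s + 2 * k)))"] allI intros)
    next
      case 5
      have "((\<lambda>s. sin (Psi s)) has_real_derivative
          cos (Psi s) * (mu s * mu s + (mu s + 2 * l) * (1 / (y s + 2 * k)))) (at s)" for s
        unfolding Psi' by (rule DERIV_cong[OF DERIV_chain2[OF DERIV_sin Psi_has_derivative]]) simp
      then show ?thesis unfolding 5
        by (intro bexI[of _ "\<lambda>s. cos (Psi s) * (mu s * mu s + (mu s + 2 * l) * (1 / (y s + 2 * k)))"] allI intros)
    next
      case 6
      have "((\<lambda>s. 1 / (y s + 2 * k)) has_real_derivative beta s * (1 / (y s + 2 * k)) * (1 / (y s + 2 * k))) (at s)" for s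
      proof -
        have "y s + 2 * k \<noteq> 0" using y_pos[of s] k_pos by simp
        then show ?thesis by (auto intro!: derivative_eq_intros y_has_derivative)
      qed
      then show ?thesis unfolding 6
        by (intro bexI[of _ "\<lambda>s. beta s * (1 / (y s + 2 * k)) * (1 / (y s + 2 * k))"] allI intros)
    qed
  qed
  note closed = function_algebra_closed_under_derivative[OF this]
  have "curve = (\<lambda>s. vector [y s * (1 / (2 * k)),
      ((mu s + 2 * l) * cos (Psi s) + (-1) * beta s * sin (Psi s)) * (1 / (2 * k)),
      ((mu s + 2 * l) * sin (Psi s) + beta s * cos (Psi s)) * (1 / (2 * k))])"
    by (simp add: curve_def[abs_def] alpha_def)
  then show ?thesis
    by (simp only:) (rule smooth_curve_if_closed_under_derivative[OF closed]; (intro intros)?)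
qed

text \<open>The frame was built with the first coordinate axis as the direction of the momentum;
  \<open>f1\<close> gives the length and \<open>f2\<close> cancels the spatial part.\<close>

lemma momentum_curve: "momentum l curve s = vector [k, 0, 0]"
proof -
  define C D where "C = cos (Psi s)" and "D = sin (Psi s)"
  have k: "k \<noteq> 0" using k_pos by simp
  have f1: "y s * y s - beta s * beta s - alpha s * alpha s = 4 * k^2"
    using alpha_beta_square[of s] by (simp add: power2_eq_square)
  have f2: "y s * alpha s - beta s * (tau s * beta s) - alpha s * (2 * k + tau s * alpha s) = 0"
  proof -
    have "y s * alpha s - beta s * (tau s * beta s) - alpha s * (2 * k + tau s * alpha s)
      = (y s - 2 * k) * alpha s - tau s * ((alpha s)^2 + (beta s)^2)" by (simp add: power2_eq_square algebra_simps)
    also have "\<dots> = (y s - 2 * k) * alpha s - (tau s * (y s + 2 * k)) * (y s - 2 * k)"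
      unfolding alpha_beta_square by (simp add: power2_eq_square algebra_simps)
    finally show ?thesis unfolding tau_y by simp
  qed
  have "momentum l curve s = (1 / 2) *\<^sub>R (y s *\<^sub>R curve s + beta s *\<^sub>R tangent s - alpha s *\<^sub>R normal s)"
    unfolding momentum_def blaschke_curve deriv_mu velocity_curve lcross_curve_tangent
    by (simp add: y_def beta_def alpha_def algebra_simps)
  also have "\<dots> = (1 / (4 * k)) *\<^sub>R vector [y s * y s - beta s * beta s - alpha s * alpha s,
    (y s * alpha s - beta s * (tau s * beta s) - alpha s * (2 * k + tau s * alpha s)) * C,
    (y s * alpha s - beta s * (tau s * beta s) - alpha s * (2 * k + tau s * alpha s)) * D]"
    unfolding curve_def tangent_def normal_def C_def[symmetric] D_def[symmetric] using k
    by (simp add: vec_eq_iff forall_3 field_simps)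
  also have "\<dots> = vector [k, 0, 0]"
    unfolding f1 f2 using k by (simp add: vec_eq_iff forall_3 power2_eq_square)
  finally show ?thesis .
qed

lemma BT_curve: "BT_curve curve"
  unfolding BT_curve_def B_curve_with_def convex_curve_def hyperbolic_curve_def blaschke_curve
proof (intro exI conjI allI)
  show "smooth_curve curve" by (rule smooth_curve)
  show "range curve \<subseteq> hyperbolic_plane"
    using lorentz_curve y_pos k_pos by (auto simp: hyperbolic_plane_def) (simp add: curve_def)
  show "lorentz (velocity curve s) (velocity curve s) = 1" for s
    unfolding velocity_curve by (rule lorentz_tangent)
  show "geodesic_curvature curve s > 0" for s
    using mu_pos[of s] by (simp add: geodesic_curvature_curve)
  show "nonconstant mu" unfolding nonconstant_def using mu_0 mu_half e2_less_e1 by (metis less_irrefl)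
  show "periodic mu" unfolding periodic_def periodic_with_def using omega_pos mu_periodic by blast
  show "mu differentiable at s" for s
    using mu_has_derivative real_differentiable_def by blast
  show "(deriv mu s)^2 = - ((mu s)^2) * Q_poly l c (mu s)" for s
    unfolding deriv_mu by (rule mu'_square)
  show "timelike (momentum l curve s)" for s
    unfolding timelike_def momentum_curve using k_pos by (simp add: lorentz_def)
qed

lemma closed_curve:
  assumes "Psi omega = 2 * pi * q" "q \<in> \<rat>"
  shows "closed_curve curve"
proof -
  obtain m n :: int where mn: "n > 0" "q = of_int m / of_int n"
    using assms(2) by (metis Rats_cases')
  \<comment> \<open>Subtracting the linear drift makes \<open>Psi\<close> periodic, so
    \<open>n\<close> periods of \<open>mu\<close> advance \<open>Psi\<close> by exactly
    \<open>m\<close> full turns.\<close>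
  have "Psi (s + of_int n * omega) - (s + of_int n * omega) * Psi omega / omega = Psi s - s * Psi omega / omega" for s
    using omega_pos by (intro periodic_multiple[of "\<lambda>s. Psi s - s * Psi omega / omega"]) (simp add: Psi_add_period field_simps)
  moreover have "(s + of_int n * omega) * Psi omega / omega = s * Psi omega / omega + 2 * pi * of_int m" for s
    using omega_pos mn by (simp add: assms field_simps)
  ultimately have Psi: "Psi (s + of_int n * omega) = Psi s + 2 * pi * of_int m" for s by (smt (verit))
  have "cos (Psi (s + of_int n * omega)) = cos (Psi s)" "sin (Psi (s + of_int n * omega)) = sin (Psi s)" for s
    by (simp_all add: Psi cos_add sin_add cos_int_2pin sin_int_2pin)
  then have "curve (s + of_int n * omega) = curve s" for s
    by (simp add: curve_def periodic_multiple[of y] periodic_multiple[of alpha] periodic_multiple[of beta]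
        y_periodic alpha_periodic beta_periodic)
  moreover have "of_int n * omega > 0" using mn omega_pos by simp
  ultimately show ?thesis unfolding closed_curve_def periodic_def periodic_with_def by blast
qed

end

section \<open>The standard BT-curve and the period map\<close>

context orbit
begin

lemma moduli_P_e2: "(l, e2) \<in> moduli_P" using e2_gt e2_less by (simp add: moduli_P_iff)

lemma e1_of_eq: "e1_of l e2 = e1"
  unfolding e1_of_def c_def[symmetric]
proof (rule Max_eqI)
  have eq: "{x. Q_poly l c x = 0} = {x. poly [:-1, 0, 4 * (l^2 - c), 4 * l, 1:] x = 0}"
    by (simp add: Q_poly_def power2_eq_square power3_eq_cube power4_eq_xxxx algebra_simps)
  show "finite {x. Q_poly l c x = 0}" unfolding eq by (rule poly_roots_finite) simp
  show "e1 \<in> {x. Q_poly l c x = 0}" by (simp add: Q_factor)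
  fix x assume "x \<in> {x. Q_poly l c x = 0}"
  then have "(x - e1) * (x - e2) * R x = 0" by (simp add: Q_factor)
  then show "x \<le> e1" using R_pos[of x] e2_less_e1 by (cases "x \<le> e1") auto
qed

lemma Q_poly_square: "Q_poly l c x = (x * (x + 2 * l))^2 - (1 + 4 * c * x^2)"
  by (simp add: Q_poly_def power2_eq_square power3_eq_cube power4_eq_xxxx algebra_simps)

text \<open>\<open>Q_poly_square\<close> at the root \<open>e1\<close> turns
  \<open>1 + 4 * c * e1^2\<close> into the perfect square
  \<open>(e1 * (e1 + 2 * l))^2\<close>.\<close>

lemma moduli_E_iff: "(l, e2) \<in> moduli_E \<longleftrightarrow> e1 = - 2 * l"
proof -
  have "1 + 4 * c * e1^2 = (e1 * (e1 + 2 * l))^2"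
    using Q_poly_square[of e1] Q_factor[of e1] by simp
  then show ?thesis
    using moduli_P_e2 e1_pos by (auto simp: moduli_E_def e1_of_eq c_def[symmetric])
qed

end

context slice
begin

lemma moduli_E_iff_c_of: "(l, x) \<in> moduli_E \<longleftrightarrow> hm < x \<and> x < hp \<and> c_of l x = - 1 / (16 * l^2)"
proof (cases "hm < x \<and> x < hp")
  case True
  then interpret orbit l x by unfold_locales auto
  show ?thesis using moduli_E_iff outer_root_eq_iff[of x] True by (simp add: e1_def)
next
  case False
  then show ?thesis using moduli_P_iff by (auto simp: moduli_E_def)
qed

text \<open>Below the threshold the exceptional value lies strictly between the values of
  \<open>c\<close> at \<open>hp\<close> and \<open>hm\<close>; strict monotonicity makes the
  solution unique, so the definite description denotes.\<close>

lemma exc_of: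
  assumes "l < - root 4 (golden^5) / 2"
  shows "hm < exc_of l \<and> exc_of l < hp \<and> c_of l (exc_of l) = - 1 / (16 * l^2)"
proof -
  have 1: "- 1 / (16 * l^2) < c_of l hm" using assms unfolding exceptional_threshold .
  have 2: "c_of l hp < - 1 / (16 * l^2)"
    unfolding c_of_minus_2l[symmetric] using hp_less by (intro c_of_increasing) auto
  have "\<exists>x\<ge>hm. x \<le> hp \<and> c_of l x = - 1 / (16 * l^2)"
    using 1 2 hm_less_hp hm_gt_0 by (intro IVT2' continuous_on_c_of) auto
  then obtain x where x: "hm \<le> x" "x \<le> hp" "c_of l x = - 1 / (16 * l^2)" by auto
  then have "x \<noteq> hm" "x \<noteq> hp" using 1 2 by auto
  with x have x': "hm < x" "x < hp" by auto
  have "exc_of l = x"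
    unfolding exc_of_def moduli_E_iff_c_of
  proof (rule the_equality)
    fix z assume z: "hm < z \<and> z < hp \<and> c_of l z = - 1 / (16 * l\<^sup>2)"
    then show "z = x" using c_of_decreasing[of z x] c_of_decreasing[of x z] x x'
      by (cases z x rule: linorder_cases) auto
  qed (use x x' in auto)
  then show ?thesis using x x' by simp
qed

end

section \<open>The angle of \<open>(alpha, beta)\<close> and its increment over a period\<close>

context timelike_orbit
begin

abbreviation "Theta \<equiv> Theta_of l e2"
definition Phi :: "real \<Rightarrow> real" where "Phi s = Psi s + Theta s"
definition A :: "real \<Rightarrow> real" where "A s = sqrt ((y s)^2 - 4 * k^2)"
text \<open>When \<open>e1 = - 2 * l\<close>, the relation \<open>2 * k * e1 = 1\<close> gives
  \<open>2 * k * alpha = - mu * (y - 2 * k)\<close>; the first branch is the quotient with the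
  common factor \<open>y - 2 * k\<close> cancelled, regular even at \<open>mu = e1\<close>.\<close>

definition Theta' :: "real \<Rightarrow> real" where
  "Theta' s = (if e1 = - 2 * l then - mu s / (y s + 2 * k) else 2 * k * alpha s / ((y s)^2 - 4 * k^2))"

lemma sqrt_abs_c: "sqrt \<bar>c\<bar> = k" using c_neg by (simp add: k_def)

lemma e2_less_2l: "e2 < - 2 * l" using e2_less hp_less by simp

lemma y_square_ge: "(y s)^2 \<ge> 4 * k^2" using alpha_beta_square[of s] sum_power2_ge_zero[of "alpha s" "beta s"] by simp

lemma A_square: "(A s)^2 = (y s)^2 - 4 * k^2" using y_square_ge by (simp add: A_def)

lemma A_nonneg: "A s \<ge> 0" using y_square_ge by (simp add: A_def)

text \<open>A zero makes \<open>alpha\<close> and \<open>beta\<close> vanish together, so it is a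
  turning point with \<open>mu = - 2 * l\<close>; this cannot be \<open>e2\<close>, which lies below
  \<open>- 2 * l\<close>.\<close>

lemma A_eq_0D: "A s = 0 \<Longrightarrow> mu s = e1 \<and> e1 = - 2 * l"
proof -
  assume "A s = 0"
  then have "(alpha s)^2 + (beta s)^2 = 0" unfolding alpha_beta_square using A_square[of s] by simp
  then have "alpha s = 0" "beta s = 0" by (auto simp: sum_power2_eq_zero_iff)
  then have *: "mu s = - 2 * l" "mu' s = 0" using mu_pos[of s] by (auto simp: alpha_def beta_def)
  then have "(mu s - e1) * (mu s - e2) * R (mu s) = 0"
    using mu'_square[of s] mu_pos[of s] by (simp add: Q_factor)
  then show ?thesis using * e2_less_2l R_pos[of "mu s"] mu_bounds[of s] by auto
qed

lemma A_pos: "e1 \<noteq> - 2 * l \<or> mu s < e1 \<Longrightarrow> A s > 0"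
  using A_eq_0D[of s] A_nonneg[of s] by (cases "A s = 0") auto

lemma k_exceptional: "2 * k * e1 = 1" if "e1 = - 2 * l"
proof -
  have "1 + 4 * c * e1^2 = (e1 * (e1 + 2 * l))^2"
    using Q_poly_square[of e1] Q_factor[of e1] by simp
  then have "(2 * k * e1)^2 = 1" using that k_square by (simp add: power_mult_distrib)
  then show ?thesis using k_pos e1_pos by (simp add: power2_eq_1_iff) (smt (verit) mult_pos_pos)
qed

lemma Theta'_eq: "Theta' s * (A s)^2 = 2 * k * alpha s" if "A s > 0"
proof (cases "e1 = - 2 * l")
  case True
  have "alpha s = mu s - e1" using True by (simp add: alpha_def)
  also have "\<dots> = mu s * (1 - e1 * y s)" using mu_y[of s] by (simp add: algebra_simps)
  finally have alpha: "alpha s = mu s * (1 - e1 * y s)" .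
  have "2 * k * alpha s = mu s * (2 * k - (2 * k * e1) * y s)" unfolding alpha by (simp add: algebra_simps)
  then have *: "2 * k * alpha s = - mu s * (y s - 2 * k)" unfolding k_exceptional[OF True] by (simp add: algebra_simps)
  have yk: "y s + 2 * k \<noteq> 0" using y_pos[of s] k_pos by simp
  have "Theta' s * (A s)^2 = - mu s / (y s + 2 * k) * ((y s + 2 * k) * (y s - 2 * k))"
    unfolding A_square using True by (simp add: Theta'_def power2_eq_square algebra_simps)
  also have "\<dots> = - mu s * (y s - 2 * k)" using yk by simp
  finally show ?thesis using * by simp
next
  case False
  then show ?thesis using that unfolding Theta'_def A_square[symmetric] by simp
qed

lemma Theta_has_derivative: "(Theta has_real_derivative Theta' s) (at s)"
proof (cases "e1 = - 2 * l")
  case True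
  have E: "(l, e2) \<in> moduli_E" using True by (simp add: moduli_E_iff)
  have m: "mu s - 2 * l > 0" for s using mu_pos[of s] l_neg by simp
  have "((\<lambda>s. - 8 * k * l^2 * (LBINT t=ereal 0..ereal s. (mu t)^2 / (mu t - 2 * l)))
      has_real_derivative - 8 * k * l^2 * ((mu s)^2 / (mu s - 2 * l))) (at s)"
    using m by (intro DERIV_cmult has_primitive continuous_intros continuous_mu) (auto simp: less_imp_neq[symmetric])
  moreover have "- 8 * k * l^2 * ((mu s)^2 / (mu s - 2 * l)) = Theta' s"
  proof -
    \<comment> \<open>This reduces the constant in the exceptional formula for the angle to
      \<open>- e1\<close>.\<close>
    have "4 * k * l = - 1" using k_exceptional[OF True] True by simp
    moreover have "- 8 * k * l^2 = - 2 * (4 * k * l) * l" by (simp add: power2_eq_square)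
    ultimately have n8: "- 8 * k * l^2 = - e1" using True by simp
    have yk: "y s + 2 * k = (mu s - 2 * l) / (mu s * e1)"
    proof -
      have "2 * k = 1 / e1" using k_exceptional[OF True] e1_pos by (simp add: field_simps)
      then have yk: "y s + 2 * k = 1 / mu s + 1 / e1" by (simp add: y_def)
      have "mu s - 2 * l = mu s + e1" using True by simp
      then show ?thesis unfolding yk using mu_pos[of s] e1_pos by (simp add: field_simps)
    qed
    show ?thesis unfolding n8 Theta'_def yk using True by (simp add: power2_eq_square)
  qed
  ultimately show ?thesis
    using E by (simp add: Theta_of_def[abs_def] c_def[symmetric] mu_of_eq sqrt_abs_c)
next
  case False
  have E: "(l, e2) \<notin> moduli_E" using False by (simp add: moduli_E_iff)
  have eq: "1 + 4 * c * (mu s)^2 = (mu s)^2 * (A s)^2" for s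
    using mu_pos[of s] k_square unfolding A_square by (simp add: y_def field_simps power2_eq_square)
  have nz: "(mu s)^2 * (A s)^2 \<noteq> 0" for s using A_pos[of s] False mu_pos[of s] by simp
  have "continuous_on UNIV (\<lambda>s. (mu s)^2 * (mu s + 2 * l) / (1 + 4 * c * (mu s)^2))"
    using nz by (intro continuous_intros continuous_mu) (simp add: eq)
  then have "((\<lambda>s. 2 * k * (LBINT t=ereal 0..ereal s. (mu t)^2 * (mu t + 2 * l) / (1 + 4 * c * (mu t)^2)))
      has_real_derivative 2 * k * ((mu s)^2 * (mu s + 2 * l) / (1 + 4 * c * (mu s)^2))) (at s)"
    by (intro DERIV_cmult has_primitive)
  moreover have "2 * k * ((mu s)^2 * (mu s + 2 * l) / (1 + 4 * c * (mu s)^2)) = Theta' s"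
    unfolding eq using False nz[of s] by (simp add: Theta'_def alpha_def A_square[symmetric])
  ultimately show ?thesis
    using E by (simp add: Theta_of_def[abs_def] c_def[symmetric] mu_of_eq sqrt_abs_c)
qed

lemma Theta_0: "Theta 0 = 0" by (simp add: Theta_of_def zero_ereal_def[symmetric])

lemma Phi_has_derivative: "(Phi has_real_derivative (mu s)^2 + tau s + Theta' s) (at s)"
  unfolding Phi_def[abs_def] by (intro DERIV_add Psi_has_derivative Theta_has_derivative)

lemma Phi_0: "Phi 0 = 0" by (simp add: Phi_def Psi_0 Theta_0)

lemma Phi_add_period: "Phi (s + omega) = Phi s + Phi omega"
  by (rule additive_if_derivative_periodic[OF Phi_has_derivative Phi_0])
     (simp add: mu_periodic tau_periodic Theta'_def y_periodic alpha_periodic)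

lemma Phi_odd: "Phi (- s) = - Phi s"
  by (rule odd_if_derivative_even[OF Phi_has_derivative Phi_0])
     (simp add: mu_even tau_even Theta'_def y_def alpha_def)

text \<open>Oddness and quasi-periodicity, both taken at minus half a period, reduce the increment
  to the moment when \<open>mu\<close> reaches its maximum \<open>e1\<close>.\<close>

lemma Phi_omega: "Phi omega = 2 * Phi (omega / 2)"
  using Phi_add_period[of "- (omega / 2)"] by (simp add: Phi_odd)

lemma A_periodic: "A (s + omega) = A s" by (simp add: A_def y_periodic)

text \<open>Away from its zeros the plane curve \<open>(alpha, beta)\<close> rotates with angular velocity \<open>- \<Phi>'\<close>.\<close>

lemma polar_form:
  assumes ab: "a < 0" "0 < b" and s: "a < s" "s < b" and A: "\<And>s. a < s \<Longrightarrow> s < b \<Longrightarrow> A s > 0"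
  shows "alpha s = - A s * cos (Phi s)" "beta s = A s * sin (Phi s)"
proof -
  define p where "p s = alpha s / A s" for s
  define q where "q s = beta s / A s" for s
  \<comment> \<open>\<open>f\<close> is the inner product of the unit vectors \<open>(p, q)\<close>
    and \<open>(- cos Phi, sin Phi)\<close>, which rotate at the same rate; being constantly 1, it
    forces them to agree.\<close>
  define f where "f s = q s * sin (Phi s) - p s * cos (Phi s)" for s
  define nu where "nu s = (mu s)^2 + tau s + Theta' s" for s
  have d: "(p has_real_derivative q s * nu s) (at s)" "(q has_real_derivative - p s * nu s) (at s)"
    if "a < s" "s < b" for s
  proof -
    have A0: "A s > 0" using A that by simp
    have yk: "y s + 2 * k \<noteq> 0" using y_pos[of s] k_pos by simp
    have dA: "(A has_real_derivative - (y s * beta s) / A s) (at s)"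
    proof -
      have "((\<lambda>s. (y s)^2 - 4 * k^2) has_real_derivative - 2 * y s * beta s) (at s)"
        by (auto intro!: derivative_eq_intros y_has_derivative)
      moreover have "(y s)^2 - 4 * k^2 > 0" using A0 A_square[of s] by (metis zero_less_power)
      ultimately show ?thesis
        unfolding A_def[abs_def]
        by (intro DERIV_cong[OF DERIV_chain2[OF DERIV_real_sqrt]]) (auto simp: field_simps)
    qed
    have tA: "tau s * (A s)^2 = alpha s * (y s - 2 * k)"
    proof -
      have "(A s)^2 = (y s + 2 * k) * (y s - 2 * k)" unfolding A_square by (simp add: power2_eq_square algebra_simps)
      then show ?thesis using tau_y[of s] by (metis mult.assoc)
    qed
    have nuA: "nu s * (A s)^2 = (mu s)^2 * (A s)^2 + y s * alpha s"
      using tA Theta'_eq[OF A0] by (simp add: nu_def algebra_simps)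
    have "(p has_real_derivative ((mu s)^2 * beta s * A s - alpha s * (- (y s * beta s) / A s)) / (A s * A s)) (at s)"
      unfolding p_def[abs_def] using A0 by (intro DERIV_divide alpha_has_derivative dA) simp
    moreover have "((mu s)^2 * beta s * A s - alpha s * (- (y s * beta s) / A s)) / (A s * A s) = beta s * (nu s * (A s)^2) / (A s)^3"
      unfolding nuA using A0 by (simp add: field_simps power2_eq_square power3_eq_cube)
    moreover have "\<dots> = q s * nu s" using A0 by (simp add: q_def field_simps power2_eq_square power3_eq_cube)
    ultimately show "(p has_real_derivative q s * nu s) (at s)" by simp
    have "(q has_real_derivative ((- y s - (mu s)^2 * alpha s) * A s - beta s * (- (y s * beta s) / A s)) / (A s * A s)) (at s)"
      unfolding q_def[abs_def] using A0 by (intro DERIV_divide beta_has_derivative dA) simp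
    moreover have "((- y s - (mu s)^2 * alpha s) * A s - beta s * (- (y s * beta s) / A s)) / (A s * A s)
        = (- y s * (A s)^2 - (mu s)^2 * alpha s * (A s)^2 + y s * (beta s)^2) / (A s)^3"
      using A0 by (simp add: field_simps power2_eq_square power3_eq_cube)
    moreover have be2: "(beta s)^2 = (A s)^2 - (alpha s)^2" using alpha_beta_square[of s] A_square[of s] by simp
    have "- y s * (A s)^2 - (mu s)^2 * alpha s * (A s)^2 + y s * (beta s)^2 = - alpha s * (nu s * (A s)^2)"
      unfolding nuA be2 by (simp add: algebra_simps power2_eq_square)
    moreover have "- alpha s * (nu s * (A s)^2) / (A s)^3 = - p s * nu s"
      using A0 by (simp add: p_def field_simps power2_eq_square power3_eq_cube)
    ultimately show "(q has_real_derivative - p s * nu s) (at s)" by simp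
  qed
  have pq: "(p s)^2 + (q s)^2 = 1" if "a < s" "s < b" for s
  proof -
    have "(alpha s)^2 + (beta s)^2 = (A s)^2" by (simp add: alpha_beta_square A_square)
    then show ?thesis using A[OF that] by (simp add: p_def q_def power_divide flip: add_divide_distrib)
  qed
  have "f s = f 0"
  proof (rule DERIV_isconst3[of a b s 0 f])
    fix s assume "s \<in> {a<..<b}"
    then have s: "a < s" "s < b" by auto
    have dPhi: "(Phi has_real_derivative nu s) (at s)" unfolding nu_def by (rule Phi_has_derivative)
    have "(f has_real_derivative (- p s * nu s * sin (Phi s) + cos (Phi s) * nu s * q s)
      - (q s * nu s * cos (Phi s) + - sin (Phi s) * nu s * p s)) (at s)"
      unfolding f_def[abs_def]
      by (intro DERIV_diff DERIV_mult d[OF s] DERIV_chain2[OF DERIV_sin dPhi] DERIV_chain2[OF DERIV_cos dPhi])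
    then show "(f has_real_derivative 0) (at s)" by (rule DERIV_cong) (simp add: algebra_simps)
  qed (use ab s in auto)
  also have "f 0 = 1"
  proof -
    have "alpha 0 < 0" using e2_less_2l by (simp add: alpha_def mu_0)
    moreover have "beta 0 = 0" by (simp add: beta_def mu'_0)
    moreover have "(p 0)^2 + (q 0)^2 = 1" using ab by (intro pq) auto
    ultimately have "q 0 = 0" "(p 0)^2 = 1" "p 0 < 0" using A[of 0] ab by (auto simp: q_def p_def divide_neg_pos)
    then show ?thesis by (simp add: f_def Phi_0 power2_eq_1_iff)
  qed
  finally have "f s = 1" .
  have "(C + P)^2 + (D - Q)^2 = (P^2 + Q^2) + (D^2 + C^2) - 2 * (Q * D - P * C)" for C D P Q :: real
    by (simp add: power2_eq_square algebra_simps)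
  from this[of "cos (Phi s)" "p s" "sin (Phi s)" "q s"]
  have "(cos (Phi s) + p s)^2 + (sin (Phi s) - q s)^2 = 0"
    unfolding pq[OF s] sin_cos_squared_add f_def[symmetric] \<open>f s = 1\<close> by simp
  then have "p s = - cos (Phi s)" "q s = sin (Phi s)" by (auto simp: sum_power2_eq_zero_iff)
  then show "alpha s = - A s * cos (Phi s)" "beta s = A s * sin (Phi s)"
    using A[OF s] by (auto simp: p_def q_def field_simps)
qed

lemma polar_form_half:
  assumes "- (omega / 2) < s" "s < omega / 2"
  shows "alpha s = - A s * cos (Phi s)" "beta s = A s * sin (Phi s)"
  using polar_form[of "- (omega / 2)" "omega / 2" s] A_pos mu_less_e1 omega_pos assms by auto

lemma polar_form_generic:
  assumes "e1 \<noteq> - 2 * l"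
  shows "alpha s = - A s * cos (Phi s)" "beta s = A s * sin (Phi s)"
  using polar_form[of "- \<bar>s\<bar> - 1" "\<bar>s\<bar> + 1" s] A_pos assms by auto

lemma isCont_Phi: "isCont Phi s" using Phi_has_derivative DERIV_isCont by blast

text \<open>On the open half period \<open>mu\<close> rises, so \<open>beta\<close> and with it
  \<open>sin (Phi s)\<close> are positive; starting from 0, \<open>Phi\<close> can leave
  \<open>[0, pi]\<close> at neither end.\<close>

lemma Phi_half_bounds: "0 \<le> Phi (omega / 2) \<and> Phi (omega / 2) \<le> pi"
proof -
  have sin: "sin (Phi s) > 0" if "0 < s" "s < omega / 2" for s
  proof -
    have "A s > 0" using that by (intro A_pos disjI2 mu_less_e1) auto
    moreover have "beta s > 0" using mu'_pos[OF that] mu_pos[of s] by (simp add: beta_def)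
    ultimately show ?thesis using polar_form_half(2)[of s] that by (simp add: zero_less_mult_iff)
  qed
  have "Phi (omega / 2) \<le> pi"
  proof (rule ccontr)
    assume *: "\<not> ?thesis"
    then have "\<exists>s\<ge>0. s \<le> omega / 2 \<and> Phi s = pi"
      using omega_pos isCont_Phi by (intro IVT) (auto simp: Phi_0)
    then obtain s where s: "s \<ge> 0" "s \<le> omega / 2" "Phi s = pi" by auto
    have "s \<noteq> 0" using s(3) by (auto simp: Phi_0)
    moreover have "s \<noteq> omega / 2" using s(3) * by (metis order_refl)
    ultimately have "0 < s" "s < omega / 2" using s by linarith+
    then show False using sin[of s] s(3) by simp
  qed
  moreover have "0 \<le> Phi (omega / 2)"
  proof (rule ccontr)
    assume *: "\<not> ?thesis"
    \<comment> \<open>A value between \<open>- pi\<close> and 0 that \<open>Phi\<close> would have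
      to take on its way down and at which the sine is negative.\<close>
    define v where "v = max (Phi (omega / 2) / 2) (- pi / 2)"
    have v: "v < 0" "- pi < v" "Phi (omega / 2) < v" using * pi_gt_zero by (auto simp: v_def less_max_iff_disj)
    then have "\<exists>s\<ge>0. s \<le> omega / 2 \<and> Phi s = v"
      using omega_pos isCont_Phi by (intro IVT2) (auto simp: Phi_0)
    then obtain s where s: "s \<ge> 0" "s \<le> omega / 2" "Phi s = v" by auto
    have "s \<noteq> 0" using s(3) v by (auto simp: Phi_0)
    moreover have "s \<noteq> omega / 2" using s(3) v(3) by (metis less_irrefl)
    ultimately have "0 < s" "s < omega / 2" using s by linarith+
    then have "sin v > 0" using sin[of s] s(3) by simp
    moreover have "sin (- v) > 0" using v by (intro sin_gt_zero) auto
    ultimately show False by simp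
  qed
  ultimately show ?thesis by simp
qed

text \<open>At the half period \<open>beta = 0\<close> and \<open>alpha = e1 + 2 * l\<close>, whose
  sign decides between the angles 0 and \<open>pi\<close>. If it is zero, the point passes through
  the origin and the angle is found from the direction of passage.\<close>

lemma Phi_period:
  "e1 < - 2 * l \<Longrightarrow> Phi omega = 0"
  "e1 > - 2 * l \<Longrightarrow> Phi omega = 2 * pi"
  "e1 = - 2 * l \<Longrightarrow> Phi omega = pi"
proof -
  have alpha: "alpha (omega / 2) = e1 + 2 * l" by (simp add: alpha_def mu_half)
  have beta: "beta (omega / 2) = 0" by (simp add: beta_def mu'_half)
  have gen: "Phi (omega / 2) = 0 \<or> Phi (omega / 2) = pi" if "e1 \<noteq> - 2 * l"
  proof -
    have "sin (Phi (omega / 2)) = 0"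
      using polar_form_generic(2)[OF that, of "omega / 2"] A_pos[of "omega / 2"] that beta by simp
    then show ?thesis using Phi_half_bounds sin_gt_zero[of "Phi (omega / 2)"] by force
  qed
  show "Phi omega = 0" if "e1 < - 2 * l"
  proof -
    have "cos (Phi (omega / 2)) > 0"
      using polar_form_generic(1)[of "omega / 2"] A_pos[of "omega / 2"] that alpha by (simp add: zero_less_mult_iff) (smt (verit) mult_nonneg_nonpos)
    then show ?thesis using gen that by (auto simp: Phi_omega)
  qed
  show "Phi omega = 2 * pi" if "e1 > - 2 * l"
  proof -
    have "cos (Phi (omega / 2)) < 0"
      using polar_form_generic(1)[of "omega / 2"] A_pos[of "omega / 2"] that alpha by (smt (verit) mult_nonneg_nonneg mult_minus_left)
    then show ?thesis using gen that by (auto simp: Phi_omega)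
  qed
  show "Phi omega = pi" if "e1 = - 2 * l"
  proof -
    \<comment> \<open>The polar form carries no information at the half period itself.
      \<open>Y\<close> is the component of \<open>(alpha, beta)\<close> across the direction
      \<open>(- cos Phi, sin Phi)\<close>; it is 0 just before, so its derivative there, a nonzero
      multiple of \<open>cos (Phi (omega / 2))\<close>, is 0 as well.\<close>
    define Y where "Y s = alpha s * sin (Phi s) + beta s * cos (Phi s)" for s
    have Y0: "Y s = 0" if "- (omega / 2) < s" "s < omega / 2" for s
      unfolding Y_def polar_form_half[OF that] by simp
    have Y1: "Y (omega / 2) = 0" using alpha beta that by (simp add: Y_def)
    have dY: "(Y has_real_derivative - y (omega / 2) * cos (Phi (omega / 2))) (at (omega / 2))"
      unfolding Y_def[abs_def]
      by (rule DERIV_cong, (rule DERIV_add DERIV_mult alpha_has_derivative beta_has_derivative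
            DERIV_chain2[OF DERIV_sin Phi_has_derivative] DERIV_chain2[OF DERIV_cos Phi_has_derivative])+)
         (use alpha beta that in simp)
    have left: "\<exists>h. 0 < h \<and> h < d \<and> Y (omega / 2 - h) = 0" if "d > 0" for d
      using that omega_pos by (intro exI[of _ "min d omega / 2"]) (auto intro!: Y0 simp: min_def)
    have "- y (omega / 2) * cos (Phi (omega / 2)) = 0"
    proof (rule ccontr)
      assume "\<not> ?thesis"
      then consider "- y (omega / 2) * cos (Phi (omega / 2)) > 0" | "- y (omega / 2) * cos (Phi (omega / 2)) < 0" by linarith
      then show False
      proof cases
        case 1
        from DERIV_pos_inc_left[OF dY 1] left Y1 show False by (metis less_irrefl)
      next
        case 2
        from DERIV_neg_dec_left[OF dY 2] left Y1 show False by (metis less_irrefl)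
      qed
    qed
    then have "cos (Phi (omega / 2)) = cos (pi / 2)" using y_pos[of "omega / 2"] by simp
    then have "Phi (omega / 2) = pi / 2" 
      using Phi_half_bounds cos_inj_pi[of "Phi (omega / 2)" "pi / 2"] by auto
    then show ?thesis by (simp add: Phi_omega)
  qed
qed

section \<open>Identification of the standard curve and of the period map\<close>

lemma rho_abs_eq: "rho_abs l e2 s = A s / (2 * k)"
proof -
  have "1 + 4 * c * (mu s)^2 = (mu s)^2 * ((y s)^2 - 4 * k^2)"
    using mu_pos[of s] k_square by (simp add: y_def field_simps power2_eq_square)
  then have "sqrt (1 + 4 * c * (mu s)^2) = mu s * A s"
    using mu_pos[of s] by (simp add: A_def real_sqrt_mult)
  then show ?thesis using mu_pos[of s] by (simp add: rho_abs_def c_def[symmetric] mu_of_eq sqrt_abs_c)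
qed

text \<open>On the exceptional locus \<open>(alpha, beta)\<close> passes through 0 once per period
  while \<open>Phi\<close> advances by \<open>pi\<close>; the sign in \<open>rho_of\<close> makes up
  for the reversal. At the switching points \<open>alpha\<close>, \<open>beta\<close> and
  \<open>A\<close> vanish, so either sign is right.\<close>

lemma polar_form_rho:
  "alpha s = - (2 * k * rho_of l e2 s) * cos (Phi s) \<and> beta s = 2 * k * rho_of l e2 s * sin (Phi s)"
proof (cases "e1 = - 2 * l")
  case False
  then have "rho_of l e2 s = A s / (2 * k)" by (simp add: rho_of_def moduli_E_iff rho_abs_eq)
  then show ?thesis using k_pos polar_form_generic[OF False, of s] by simp
next
  case True
  define n where "n = \<lfloor>(s + omega / 2) / (2 * omega)\<rfloor>"
  define t where "t = s - 2 * omega * of_int n"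
  have "of_int n \<le> (s + omega / 2) / (2 * omega)" "(s + omega / 2) / (2 * omega) < of_int n + 1" unfolding n_def by linarith+
  then have t: "- (omega / 2) \<le> t" "t < 3 * omega / 2" using omega_pos by (simp_all add: t_def field_simps)
  have rho: "2 * k * rho_of l e2 s = (if t \<le> omega / 2 then A t else - A t)"
    using True k_pos unfolding rho_of_def Let_def omega_of_eq n_def[symmetric] t_def[symmetric]
    by (simp add: moduli_E_iff rho_abs_eq)
  have s: "s = t + of_int (2 * n) * omega" by (simp add: t_def)
  have alt: "alpha s = alpha t" and bet: "beta s = beta t"
    unfolding s by (rule periodic_multiple[of _ omega] alpha_periodic beta_periodic)+
  have "Phi (t + of_int (2 * n) * omega) - (t + of_int (2 * n) * omega) * Phi omega / omega = Phi t - t * Phi omega / omega"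
    using omega_pos by (intro periodic_multiple[of "\<lambda>s. Phi s - s * Phi omega / omega"]) (simp add: Phi_add_period field_simps)
  moreover have "(t + of_int (2 * n) * omega) * Phi omega / omega = t * Phi omega / omega + of_int (2 * n) * Phi omega"
    using omega_pos by (simp add: field_simps)
  ultimately have "Phi (t + of_int (2 * n) * omega) = Phi t + of_int (2 * n) * Phi omega" by linarith
  then have "Phi s = Phi t + 2 * pi * of_int n"
    unfolding s[symmetric] Phi_period(3)[OF True] by simp
  then have trig: "cos (Phi s) = cos (Phi t)" "sin (Phi s) = sin (Phi t)"
    by (simp_all add: cos_add sin_add)
  have zero: "alpha t = 0 \<and> beta t = 0 \<and> A t = 0" if "t = omega / 2 \<or> t = - (omega / 2)"
  proof -
    have "mu t = e1" using that mu_half mu_even[of "omega / 2"] by metis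
    then have "y t = 2 * k" using k_exceptional[OF True] e1_pos by (simp add: y_def field_simps)
    then have "A t = 0" by (simp add: A_def power2_eq_square)
    then show ?thesis using alpha_beta_square[of t] A_square[of t] by (simp add: sum_power2_eq_zero_iff)
  qed
  consider "t = omega / 2 \<or> t = - (omega / 2)" | "- (omega / 2) < t" "t < omega / 2" | "omega / 2 < t" "t < 3 * omega / 2"
    using t by linarith
  then show ?thesis
  proof cases
    case 1
    then show ?thesis using zero rho by (simp add: alt bet)
  next
    case 2
    then show ?thesis unfolding rho alt bet trig using polar_form_half[of t] by simp
  next
    case 3
    have ph: "Phi t = Phi (t - omega) + pi" using Phi_add_period[of "t - omega"] Phi_period(3)[OF True] by simp
    have "alpha t = alpha (t - omega)" "beta t = beta (t - omega)" "A t = A (t - omega)"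
      using alpha_periodic[of "t - omega"] beta_periodic[of "t - omega"] A_periodic[of "t - omega"] by auto
    moreover have "- (omega / 2) < t - omega" "t - omega < omega / 2" using 3 by auto
    ultimately show ?thesis unfolding rho alt bet trig ph using polar_form_half[of "t - omega"] 3 omega_pos by simp
  qed
qed

lemma standard_BT_curve_eq: "standard_BT_curve (l, e2) = curve"
proof
  fix s
  define r where "r = rho_of l e2 s"
  have Th: "Theta s = Phi s - Psi s" by (simp add: Phi_def)
  have *: "alpha s = - (2 * k * r) * cos (Phi s)" "beta s = 2 * k * r * sin (Phi s)"
    using polar_form_rho[of s] by (auto simp: r_def)
  have "(alpha s * cos (Psi s) - beta s * sin (Psi s)) / (2 * k) = - (r * cos (Theta s))"
    unfolding * Th cos_diff using k_pos by (simp add: field_simps)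
  moreover have "(alpha s * sin (Psi s) + beta s * cos (Psi s)) / (2 * k) = r * sin (Theta s)"
    unfolding * Th sin_diff using k_pos by (simp add: field_simps)
  moreover have "1 / (2 * k * mu s) = y s / (2 * k)" by (simp add: y_def)
  ultimately show "standard_BT_curve (l, e2) s = curve s"
    by (simp only: standard_BT_curve_def curve_def mu_of_eq c_def[symmetric] sqrt_abs_c r_def[symmetric] prod.case)
qed

lemma moduli_T_e2: "(l, e2) \<in> moduli_T" using moduli_P_e2 c_neg by (simp add: moduli_T_def c_def)

lemma period_map_eq: "period_map (l, e2) = Psi omega / (2 * pi)"
proof -
  have Th: "Theta omega = Phi omega - Psi omega" by (simp add: Phi_def)
  have a: "a_of l < e2" using moduli_T_e2 by (simp add: moduli_T_iff)
  have lt: "e1 < - 2 * l \<longleftrightarrow> c < - 1 / (16 * l^2)" and eq: "e1 = - 2 * l \<longleftrightarrow> c = - 1 / (16 * l^2)"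
    using outer_root_less_iff[of e2] outer_root_eq_iff[of e2] e2_gt e2_less by (simp_all add: e1_def c_def)
  \<comment> \<open>On the slice \<open>c\<close> stays below its value at \<open>hm\<close>, so
    reaching the exceptional value already puts \<open>l\<close> below the threshold; the cases of
    the period map can thus be decided by \<open>c\<close>.\<close>
  have thr: "l < - root 4 (golden^5) / 2" if "c \<ge> - 1 / (16 * l^2)"
    unfolding exceptional_threshold using that c_of_decreasing[of hm e2] e2_gt e2_less by (simp add: c_def)
  have minus: "(l, e2) \<in> moduli_T_minus \<longleftrightarrow> c > - 1 / (16 * l^2)"
  proof (cases "l < - root 4 (golden^5) / 2")
    case True
    show ?thesis unfolding c_def using exc_of[OF True] a True e2_gt e2_less
        c_of_decreasing[of e2 "exc_of l"] c_of_decreasing[of "exc_of l" e2]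
      by (cases e2 "exc_of l" rule: linorder_cases) (auto simp: moduli_T_minus_def)
  next
    case False
    then show ?thesis using thr by (auto simp: moduli_T_minus_def)
  qed
  have plus: "(l, e2) \<in> moduli_T_plus" if "c < - 1 / (16 * l^2)"
  proof (cases "l < - root 4 (golden^5) / 2")
    case True
    show ?thesis using exc_of[OF True] True e2_gt e2_less that[unfolded c_def]
        c_of_decreasing[of e2 "exc_of l"]
      by (cases e2 "exc_of l" rule: linorder_cases) (auto simp: moduli_T_plus_def)
  next
    case False
    then show ?thesis using a e2_less l_less by (auto simp: moduli_T_plus_def)
  qed
  consider "e1 < - 2 * l" | "e1 = - 2 * l" | "e1 > - 2 * l" by linarith
  then show ?thesis
  proof cases
    case 1
    then have "c < - 1 / (16 * l^2)" using lt by simp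
    then show ?thesis using plus minus 1 Phi_period(1)[OF 1]
      by (simp add: period_map_def Let_def omega_of_eq moduli_E_iff Th)
  next
    case 2
    then have "c = - 1 / (16 * l^2)" using eq by simp
    then show ?thesis using minus 2 Phi_period(3)[OF 2]
      by (simp add: period_map_def Let_def omega_of_eq moduli_E_iff Th diff_divide_distrib)
  next
    case 3
    then have "c > - 1 / (16 * l^2)" using lt eq by linarith
    then show ?thesis using minus Phi_period(2)[OF 3]
      by (simp add: period_map_def Let_def omega_of_eq Th diff_divide_distrib)
  qed
qed

lemma BT_string: "q \<in> \<rat> \<Longrightarrow> Psi omega = 2 * pi * q \<Longrightarrow> BT_string (standard_BT_curve (l, e2))"
  unfolding BT_string_def standard_BT_curve_eq using BT_curve closed_curve by simp

end

section \<open>The period map on a slice\<close>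

context slice
begin

definition abscissa :: "real \<Rightarrow> real \<Rightarrow> real" where
  "abscissa e t = (outer_root e + e) / 2 - (outer_root e - e) / 2 * cos t"

definition numerator :: "real \<Rightarrow> real \<Rightarrow> real" where
  "numerator e x = x + (x + 2 * l) / (1 + 2 * sqrt (- c_of l e) * x)"

text \<open>\<open>Psi omega\<close> in the variable \<open>t\<close>, written without the solution
  so that it makes sense at \<open>e = hp\<close> as well, where there is no orbit and the abscissa
  is constant.\<close>

definition rotation :: "real \<Rightarrow> real" where
  "rotation e = integral {0..2 * pi} (\<lambda>t. numerator e (abscissa e t) / sqrt (cofactor (outer_root e) e (abscissa e t)))"

lemma outer_root_ge_self: "outer_root e \<ge> e" if "hm \<le> e" "e \<le> hp" using outer_root_ge[OF that] that by simp

lemma abscissa_bounds: "e \<le> abscissa e t" "abscissa e t \<le> outer_root e" if "hm \<le> e" "e \<le> hp"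
proof -
  have "(outer_root e - e) / 2 * cos t \<le> (outer_root e - e) / 2 * 1" "(outer_root e - e) / 2 * (-1) \<le> (outer_root e - e) / 2 * cos t"
    using outer_root_ge_self[OF that] by (intro mult_left_mono; simp)+
  then show "e \<le> abscissa e t" "abscissa e t \<le> outer_root e" unfolding abscissa_def by (simp_all add: field_simps)
qed

lemma cofactor_abscissa_pos: "cofactor (outer_root e) e (abscissa e t) > 0" if "hm < e" "e \<le> hp"
proof -
  have "cofactor (outer_root e) e e \<le> cofactor (outer_root e) e (abscissa e t)"
    using that abscissa_bounds[of e t] cofactor_e2_pos[of e] outer_root_ge_self[of e] hm_gt_0 by (intro cofactor_mono) auto
  then show ?thesis using cofactor_e2_pos[OF that] by simp
qed

lemma c_of_neg_above_a_of: "a_of l < e \<Longrightarrow> e \<le> hp \<Longrightarrow> c_of l e < 0"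
proof (cases "l \<le> -1")
  case True
  assume "a_of l < e" "e \<le> hp"
  then show ?thesis using c_of_decreasing[of "a_of l" e] a_of_bounds c_of_a_of[OF True] by simp
next
  case False
  assume "a_of l < e" "e \<le> hp"
  then show ?thesis using c_of_neg[of e] False a_of_bounds hm_gt_0 hp_less by simp
qed

lemma timelike_orbitI: "a_of l < e \<Longrightarrow> e < hp \<Longrightarrow> timelike_orbit l e"
  using a_of_bounds c_of_neg_above_a_of[of e]
  by unfold_locales (auto simp: orbit.c_def orbit_def orbit_axioms_def slice_axioms)

end

lemma (in timelike_orbit) rotation_eq: "rotation e2 = Psi omega"
proof -
  have X: "abscissa e2 t = X t" for t by (simp add: abscissa_def X_def e1_def)
  have mu_S: "mu (S t) = X t" for t by (simp add: mu_def T_S)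
  have "((\<lambda>t. ((mu (S t))^2 + tau (S t)) * (1 / h t)) has_integral Psi (S (2 * pi)) - Psi (S 0)) {0..2 * pi}"
  proof (rule fundamental_theorem_of_calculus)
    fix t assume "t \<in> {0..2 * pi}"
    have "((\<lambda>t. Psi (S t)) has_real_derivative ((mu (S t))^2 + tau (S t)) * (1 / h t)) (at t)"
      by (rule DERIV_chain2[OF Psi_has_derivative S_has_derivative])
    then show "((\<lambda>t. Psi (S t)) has_vector_derivative ((mu (S t))^2 + tau (S t)) * (1 / h t)) (at t within {0..2 * pi})"
      by (simp add: has_real_derivative_iff_has_vector_derivative has_vector_derivative_at_within)
  qed simp
  moreover have "((mu (S t))^2 + tau (S t)) * (1 / h t) = numerator e2 (abscissa e2 t) / sqrt (cofactor (outer_root e2) e2 (abscissa e2 t))" for t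
  proof -
    define x where "x = X t"
    have x: "x > 0" using X_pos by (simp add: x_def)
    have "1 / x + 2 * k = (1 + 2 * k * x) / x" using x by (simp add: field_simps)
    then have "x^2 + (x + 2 * l) / (1 / x + 2 * k) = x * (x + (x + 2 * l) / (1 + 2 * k * x))"
      by (simp add: power2_eq_square algebra_simps)
    then show ?thesis
      unfolding numerator_def X e1_def[symmetric] c_def[symmetric] k_def[symmetric] mu_S tau_def alpha_def y_def h_def x_def[symmetric]
      using x by simp
  qed
  ultimately show ?thesis
    unfolding rotation_def by (simp add: S_0 Psi_0 omega_def integral_unique)
qed

context slice
begin

lemma continuous_on_outer_root_fst: "continuous_on ({hm..hp} \<times> B) (\<lambda>p. outer_root (fst p))"
  by (rule continuous_on_compose2[OF continuous_on_outer_root continuous_on_fst[OF continuous_on_id]]) auto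

text \<open>Above \<open>a_of l\<close> one has \<open>hm < e\<close> and \<open>c < 0\<close>, so
  the cofactor and the denominator in \<open>numerator\<close> stay positive on the compact
  rectangle, up to and including \<open>e = hp\<close>.\<close>

lemma continuous_on_rotation:
  assumes "a_of l < b"
  shows "continuous_on {b..hp} rotation"
proof -
  let ?U = "{b..hp} \<times> cbox 0 (2 * pi)"
  have U: "a_of l < fst p" "hm < fst p" "fst p > 0" "fst p \<le> hp" if "p \<in> ?U" for p
    using that assms a_of_bounds hm_gt_0 by auto
  have E: "continuous_on ?U (\<lambda>p. outer_root (fst p))"
    using U by (intro continuous_on_subset[OF continuous_on_outer_root_fst[of UNIV]]) fastforce
  have c: "continuous_on ?U (\<lambda>p. c_of l (fst p))"
  proof (rule continuous_on_compose2[OF continuous_on_c_of[of "{0<..}"] continuous_on_fst[OF continuous_on_id]])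
    show "fst ` ?U \<subseteq> {0<..}" using U(3) by (intro subsetI, elim imageE) (simp only: greaterThan_iff)
  qed simp
  have x: "continuous_on ?U (\<lambda>p. abscissa (fst p) (snd p))"
    unfolding abscissa_def by (intro continuous_intros E) auto
  have xpos: "abscissa (fst p) (snd p) > 0" if "p \<in> ?U" for p
    using U[OF that] abscissa_bounds[of "fst p" "snd p"] by simp
  have N: "continuous_on ?U (\<lambda>p. numerator (fst p) (abscissa (fst p) (snd p)))"
    unfolding numerator_def
  proof (intro continuous_intros x c ballI)
    fix p assume "p \<in> ?U"
    then have "0 \<le> 2 * sqrt (- c_of l (fst p)) * abscissa (fst p) (snd p)"
      using xpos[of p] c_of_neg_above_a_of[of "fst p"] U[of p] by (intro mult_nonneg_nonneg) auto
    then show "1 + 2 * sqrt (- c_of l (fst p)) * abscissa (fst p) (snd p) \<noteq> 0" by linarith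
  qed
  have R: "continuous_on ?U (\<lambda>p. cofactor (outer_root (fst p)) (fst p) (abscissa (fst p) (snd p)))"
    unfolding cofactor_def
  proof (intro continuous_intros x E ballI)
    fix p assume "p \<in> ?U"
    then show "outer_root (fst p) * fst p \<noteq> 0" using U[of p] outer_root_ge_self[of "fst p"] by auto
  qed
  have "continuous_on ?U (\<lambda>(e, t). numerator e (abscissa e t) / sqrt (cofactor (outer_root e) e (abscissa e t)))"
    unfolding case_prod_unfold
  proof (intro continuous_intros N R ballI)
    fix p assume "p \<in> ?U"
    then show "sqrt (cofactor (outer_root (fst p)) (fst p) (abscissa (fst p) (snd p))) \<noteq> 0"
      using cofactor_abscissa_pos[of "fst p" "snd p"] U[of p] by simp
  qed
  from integral_continuous_on_param[OF this] show ?thesis by (simp add: rotation_def[abs_def])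
qed

text \<open>Both \<open>x + 2 * l\<close> and \<open>k\<close> become expressions in
  \<open>x\<close> alone, and \<open>u^2 = x^4 - 1\<close> cancels the denominator. The formula
  serves at \<open>hp\<close> for the limit and at \<open>hm\<close> for the sign of the
  numerator.\<close>

lemma numerator_root:
  assumes "quartic l x = 0" "x > 0" "x^4 > 1"
  shows "numerator x x = sqrt (x^4 - 1) / x"
proof -
  define u where "u = sqrt (x^4 - 1)"
  define D where "D = x^2 + u"
  have u: "u > 0" "u * u = x^4 - 1" using assms by (auto simp: u_def)
  have D: "D > 0" using u by (simp add: D_def add_nonneg_pos)
  have k: "sqrt (- c_of l x) = u / (2 * x^3)"
  proof -
    have "- c_of l x = (u / (2 * x^3))^2"
      using assms by (simp add: c_of_root power_divide power_mult_distrib u_def flip: power_mult) (simp add: field_simps)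
    then show ?thesis using u assms by simp
  qed
  have l: "x + 2 * l = - 1 / x^3"
    using assms by (simp add: quartic_def field_simps power4_eq_xxxx power3_eq_cube)
  have "1 + 2 * (u / (2 * x^3)) * x = D / x^2"
    using assms by (simp add: D_def field_simps power2_eq_square power3_eq_cube)
  then have "numerator x x = x - 1 / (x * D)"
    unfolding numerator_def k l using assms D by (simp add: field_simps power2_eq_square power3_eq_cube)
  also have "\<dots> = (x^2 * D - 1) / (x * D)"
    using assms D by (simp add: field_simps power2_eq_square)
  also have "x^2 * D - 1 = u * D"
    using u(2) by (simp add: D_def power4_eq_xxxx power2_eq_square algebra_simps)
  also have "u * D / (x * D) = u / x" using D by simp
  finally show ?thesis by (simp add: u_def)
qed

text \<open>The integrand is constant; the radicand in \<open>chi\<close> factors as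
  \<open>(hp^4 - 1) * (hp^4 - 3)\<close>, the second factor being the cofactor up to
  \<open>hp^2\<close>.\<close>

lemma rotation_hp: "rotation hp = 2 * pi * chi l"
proof -
  define Y where "Y = hp^4"
  define u where "u = sqrt (Y - 1)"
  have Y: "Y > 3" using hp_pow4 by (simp add: Y_def)
  have u: "u > 0" "u * u = Y - 1" using Y by (auto simp: u_def)
  have h: "hp > 0" by (rule hp_gt_0)
  have N: "numerator hp hp = u / hp"
    using numerator_root[OF quartic_hp h] Y by (simp add: u_def Y_def)
  have R: "sqrt (cofactor hp hp hp) = sqrt (Y - 3) / hp"
    using h by (simp add: cofactor_hp Y_def real_sqrt_divide)
  have "abscissa hp t = hp" for t by (simp add: abscissa_def outer_root_hp)
  then have "rotation hp = integral {0..2 * pi} (\<lambda>t. u / sqrt (Y - 3))"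
    using h by (simp add: rotation_def outer_root_hp N R)
  also have "\<dots> = 2 * pi * (u / sqrt (Y - 3))" by simp
  also have "u / sqrt (Y - 3) = chi l"
  proof -
    have "hp^8 - 4 * hp^4 + 3 = (Y - 1) * (Y - 3)"
      by (simp add: Y_def algebra_simps flip: power_add)
    then have "chi l = (Y - 1) / (u * sqrt (Y - 3))"
      by (simp add: chi_def Y_def[symmetric] u_def real_sqrt_mult)
    also have "\<dots> = u / sqrt (Y - 3)" unfolding u(2)[symmetric] using u(1) by simp
    finally show ?thesis ..
  qed
  finally show ?thesis .
qed

section \<open>Behaviour at the lower end of the slice\<close>

lemma eventually_at_right_less:
  fixes f :: "real \<Rightarrow> real"
  assumes "continuous_on {a..b} f" "a < b" "f a < B"
  shows "eventually (\<lambda>x. f x < B) (at_right a)"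
  using continuous_on_Icc_at_rightD[OF assms(1,2)] assms(3) by (rule order_tendstoD(2))

lemma continuous_on_cofactor_diag: "continuous_on {hm..hp} (\<lambda>e. cofactor (outer_root e) e e)"
  unfolding cofactor_def
proof (intro continuous_intros continuous_on_outer_root ballI)
  fix e assume "e \<in> {hm..hp}"
  then show "outer_root e * e \<noteq> 0" using outer_root_ge_self[of e] hm_gt_0 by auto
qed

text \<open>The fraction is a Moebius map of \<open>x\<close> with determinant
  \<open>1 - 4 * k * l\<close>, which is positive because \<open>l\<close> is negative.\<close>

lemma numerator_mono:
  assumes "c_of l e \<le> 0" "0 < x" "x \<le> z"
  shows "numerator e x \<le> numerator e z"
proof -
  define k where "k = sqrt (- c_of l e)"
  have k: "k \<ge> 0" using assms by (simp add: k_def)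
  have d: "1 + 2 * k * x > 0" "1 + 2 * k * z > 0" using k assms by (auto intro: add_pos_nonneg)
  have "(z + 2 * l) * (1 + 2 * k * x) - (x + 2 * l) * (1 + 2 * k * z) = (z - x) * (1 - 4 * k * l)"
    by (simp add: algebra_simps)
  also have "\<dots> \<ge> 0" using assms k l_neg by (intro mult_nonneg_nonneg) (use mult_nonneg_nonpos[of k l] in auto)
  finally have "(x + 2 * l) / (1 + 2 * k * x) \<le> (z + 2 * l) / (1 + 2 * k * z)"
    using d by (simp add: frac_le_eq divide_le_0_iff)
  then show ?thesis using assms by (simp add: numerator_def k_def)
qed

lemma numerator_hm_pos: "numerator hm hm > 0" if "l > -1"
proof -
  have "c_of l hm < 0" using that hm_gt_0 hm_less_hp hp_less by (intro c_of_neg) auto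
  then have "hm^4 > 1" using hm_gt_0 by (simp add: c_of_root[OF quartic_hm] divide_less_0_iff)
  then show ?thesis using numerator_root[OF quartic_hm] hm_gt_0 by simp
qed

lemma one_minus_cos_le: "1 - cos t \<le> t^2 / 2" for t :: real
proof -
  have "1 - cos t = 2 * (sin (t / 2))^2" using cos_double_sin[of "t / 2"] by simp
  also have "(sin (t / 2))^2 \<le> (t / 2)^2"
    using abs_sin_x_le_abs_x[of "t / 2"] abs_le_square_iff by blast
  finally show ?thesis by (simp add: power_divide)
qed

text \<open>As \<open>e\<close> decreases to \<open>hm\<close>, the roots \<open>e\<^sub>2\<close> and \<open>e\<^sub>3\<close> collide and the integrand behaves like \<open>1 / t\<close> near \<open>0\<close>.\<close>

lemma rotation_lower_bound:
  assumes e: "hm < e" "e < hp" and c: "c_of l e \<le> 0" and n: "0 \<le> n" "n \<le> numerator e e" and M: "outer_root hm \<le> M"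
  defines "d \<equiv> sqrt (cofactor (outer_root e) e e)"
  shows "n / M * (ln (d + 2 * pi * M) - ln d) \<le> rotation e"
proof -
  have d: "d > 0" using e cofactor_e2_pos[of e] by (simp add: d_def)
  have EM: "outer_root e \<le> M" "e \<le> outer_root e" "M > 0" using outer_root_le[of hm e] e M outer_root_ge_self[of e] hm_gt_0 by auto
  \<comment> \<open>The abscissa leaves \<open>e\<close> quadratically in \<open>t\<close> and the
    cofactor grows by at most \<open>4 * M * (x - e)\<close>, so its square root grows at most
    linearly; the comparison integrand \<open>n / (d + M * t)\<close> has a logarithmic
    integral.\<close>
  have R: "sqrt (cofactor (outer_root e) e (abscissa e t)) \<le> d + M * t" if t: "t \<ge> 0" for t
  proof -
    define x where "x = abscissa e t"
    have x: "e \<le> x" "x \<le> outer_root e" using abscissa_bounds[of e t] e by (auto simp: x_def)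
    have "x - e = (outer_root e - e) / 2 * (1 - cos t)" by (simp add: x_def abscissa_def field_simps)
    also have "\<dots> \<le> M / 2 * (t^2 / 2)"
      using EM hm_gt_0 e one_minus_cos_le[of t] by (intro mult_mono) auto
    finally have xe: "x - e \<le> M * t^2 / 4" by simp
    have "cofactor (outer_root e) e x - cofactor (outer_root e) e e = (x - e) * (x + e + (4 * l + outer_root e + e))"
      by (simp add: cofactor_def power2_eq_square algebra_simps)
    also have "\<dots> \<le> (x - e) * (4 * M)" using x EM l_neg by (intro mult_left_mono) auto
    also have "\<dots> \<le> M * t^2 / 4 * (4 * M)" using xe EM by (intro mult_right_mono) auto
    finally have "cofactor (outer_root e) e x \<le> d^2 + (M * t)^2"
      using e cofactor_e2_pos[of e] by (simp add: d_def power2_eq_square algebra_simps)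
    also have "\<dots> \<le> (d + M * t)^2" using d EM t by (simp add: power2_sum)
    finally show ?thesis using d EM t by (simp add: x_def real_le_lsqrt)
  qed
  have "((\<lambda>t. n / (d + M * t)) has_integral n / M * ln (d + M * (2 * pi)) - n / M * ln (d + M * 0)) {0..2 * pi}"
  proof (rule fundamental_theorem_of_calculus)
    fix t :: real assume "t \<in> {0..2 * pi}"
    then have "d + M * t > 0" using d EM by (auto intro: add_pos_nonneg)
    moreover have "((\<lambda>t. d + M * t) has_real_derivative M) (at t)" by (auto intro!: derivative_eq_intros)
    ultimately have "((\<lambda>t. n / M * ln (d + M * t)) has_real_derivative n / M * (1 / (d + M * t) * M)) (at t)"
      by (intro DERIV_cmult DERIV_chain2[OF DERIV_ln_divide])
    then have "((\<lambda>t. n / M * ln (d + M * t)) has_real_derivative n / (d + M * t)) (at t)"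
      using EM by simp
    then show "((\<lambda>t. n / M * ln (d + M * t)) has_vector_derivative n / (d + M * t)) (at t within {0..2 * pi})"
      by (simp add: has_real_derivative_iff_has_vector_derivative has_vector_derivative_at_within)
  qed simp
  moreover have "(\<lambda>t. numerator e (abscissa e t) / sqrt (cofactor (outer_root e) e (abscissa e t))) integrable_on {0..2 * pi}"
  proof (rule integrable_continuous_interval, unfold numerator_def cofactor_def abscissa_def, intro continuous_intros ballI)
    fix t
    have "0 \<le> 2 * sqrt (- c_of l e) * abscissa e t"
      using c abscissa_bounds[of e t] e hm_gt_0 by (intro mult_nonneg_nonneg) auto
    then show "1 + 2 * sqrt (- c_of l e) * ((outer_root e + e) / 2 - (outer_root e - e) / 2 * cos t) \<noteq> 0"
      unfolding abscissa_def by linarith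
    show "sqrt (((outer_root e + e) / 2 - (outer_root e - e) / 2 * cos t)\<^sup>2
         + (4 * l + outer_root e + e) * ((outer_root e + e) / 2 - (outer_root e - e) / 2 * cos t) - 1 / (outer_root e * e)) \<noteq> 0"
      using cofactor_abscissa_pos[of e t] e unfolding cofactor_def abscissa_def by simp
  qed
  moreover have "n / (d + M * t) \<le> numerator e (abscissa e t) / sqrt (cofactor (outer_root e) e (abscissa e t))"
    if "t \<in> {0..2 * pi}" for t
  proof (rule frac_le)
    have "numerator e e \<le> numerator e (abscissa e t)"
      using c abscissa_bounds[of e t] e hm_gt_0 by (intro numerator_mono) auto
    then show "0 \<le> numerator e (abscissa e t)" "n \<le> numerator e (abscissa e t)" using n by auto
    show "0 < sqrt (cofactor (outer_root e) e (abscissa e t))" using cofactor_abscissa_pos[of e t] e by simp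
    show "sqrt (cofactor (outer_root e) e (abscissa e t)) \<le> d + M * t" using R[of t] that by simp
  qed
  ultimately have "n / M * ln (d + M * (2 * pi)) - n / M * ln (d + M * 0) \<le> rotation e"
    unfolding rotation_def by (intro has_integral_le[OF _ integrable_integral]) auto
  then show ?thesis by (simp add: algebra_simps)
qed

text \<open>Near \<open>hm\<close> the numerator stays above half its positive value there while the
  cofactor at \<open>e\<close> tends to 0, so the logarithmic lower bound becomes arbitrarily
  large.\<close>

lemma rotation_unbounded:
  assumes "l > -1"
  shows "\<exists>e. hm < e \<and> e < hp \<and> rotation e > B"
proof -
  define M where "M = outer_root hm"
  define n where "n = numerator hm hm / 2"
  have n: "n > 0" using numerator_hm_pos[OF assms] by (simp add: n_def)
  have M: "M > 0" using outer_root_ge[of hm] hm_less_hp hp_gt_0 by (simp add: M_def)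
  \<comment> \<open>Solves \<open>n / M * (ln (2 * pi * M) - ln b) = |B| + 1\<close>.\<close>
  define b where "b = exp (ln (2 * pi * M) - (\<bar>B\<bar> + 1) * M / n)"
  have c: "c_of l e < 0" if "hm \<le> e" "e \<le> hp" for e
    using that assms hm_gt_0 hp_less by (intro c_of_neg) auto
  have "cofactor (outer_root hm) hm hm = 0"
    using cofactor_e2[of hm] hm_less_hp by (simp add: quartic_hm)
  then have "eventually (\<lambda>e. cofactor (outer_root e) e e < b^2) (at_right hm)"
    using hm_less_hp by (intro eventually_at_right_less[OF continuous_on_cofactor_diag]) (auto simp: b_def)
  moreover have "continuous_on {hm..hp} (\<lambda>e. - numerator e e)"
    unfolding numerator_def
  proof (intro continuous_intros continuous_on_c_of ballI)
    fix e assume e: "e \<in> {hm..hp}"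
    then have "0 \<le> 2 * sqrt (- c_of l e) * e" using c[of e] hm_gt_0 by (intro mult_nonneg_nonneg) auto
    then show "1 + 2 * sqrt (- c_of l e) * e \<noteq> 0" by linarith
  qed (use hm_gt_0 in auto)
  then have "eventually (\<lambda>e. - numerator e e < - n) (at_right hm)"
    using hm_less_hp n by (intro eventually_at_right_less) (auto simp: n_def)
  moreover have "eventually (\<lambda>e. e \<in> {hm<..<hp}) (at_right hm)"
    using hm_less_hp by (rule eventually_at_right_real)
  ultimately have "eventually (\<lambda>e. cofactor (outer_root e) e e < b^2 \<and> n < numerator e e \<and> e \<in> {hm<..<hp}) (at_right hm)"
    by eventually_elim auto
  then obtain e where e: "cofactor (outer_root e) e e < b^2" "n < numerator e e" "hm < e" "e < hp"
    using eventually_happens'[OF trivial_limit_at_right_real] by (metis (no_types, lifting) greaterThanLessThan_iff)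
  define d where "d = sqrt (cofactor (outer_root e) e e)"
  have d: "d > 0" using e cofactor_e2_pos[of e] by (simp add: d_def)
  have "d < b" using e(1) by (simp add: d_def b_def real_less_lsqrt)
  then have "ln d < ln b" using d by simp
  then have "ln (2 * pi * M) - ln d > (\<bar>B\<bar> + 1) * M / n" by (simp add: b_def)
  moreover have "ln (2 * pi * M) \<le> ln (d + 2 * pi * M)"
    using d M by (subst ln_le_cancel_iff) (auto intro: add_pos_pos)
  ultimately have "ln (d + 2 * pi * M) - ln d > (\<bar>B\<bar> + 1) * M / n" by linarith
  then have "n / M * (ln (d + 2 * pi * M) - ln d) > n / M * ((\<bar>B\<bar> + 1) * M / n)"
    using n M by (intro mult_strict_left_mono) auto
  moreover have "n / M * ((\<bar>B\<bar> + 1) * M / n) = \<bar>B\<bar> + 1" using n M by simp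
  moreover have "n / M * (ln (d + 2 * pi * M) - ln d) \<le> rotation e"
    unfolding d_def using e n c[of e] by (intro rotation_lower_bound) (auto simp: M_def)
  ultimately have "rotation e > B" by linarith
  with e show ?thesis by blast
qed

end

context timelike_orbit
begin

lemma omega_le: "omega \<le> 2 * pi / (e2 * sqrt (R e2))"
proof -
  obtain z where "S (2 * pi) - S 0 = (2 * pi - 0) * (1 / h z)"
    using MVT2[of 0 "2 * pi" S "\<lambda>t. 1 / h t"] S_has_derivative by auto
  then have "omega = 2 * pi / h z" by (simp add: omega_def S_0)
  also have "\<dots> \<le> 2 * pi / (e2 * sqrt (R e2))"
    using h_ge[of z] h_pos[of z] e2_pos R_e2_pos by (intro divide_left_mono mult_pos_pos) auto
  finally show ?thesis .
qed

text \<open>\<open>Theta'\<close> is of order \<open>k\<close> and the period at most of order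
  \<open>1 / sqrt (R e2)\<close>; the quotient is kept because \<open>k\<close> and
  \<open>R e2\<close> may tend to 0 together. The condition on \<open>k\<close> keeps
  \<open>y^2 - 4 * k^2\<close> above \<open>1 / (2 * M^2)\<close>.\<close>

lemma Theta_period_bound:
  assumes M: "e1 \<le> M" and k: "8 * k^2 * M^2 \<le> 1" and ne: "e1 \<noteq> - 2 * l"
  shows "\<bar>Theta omega\<bar> \<le> 8 * pi * M^2 * (M - 2 * l) / e2 * (k / sqrt (R e2))"
proof -
  have M0: "M > 0" using M e1_pos by simp
  obtain z where "Theta omega - Theta 0 = (omega - 0) * Theta' z"
    using MVT2[of 0 omega Theta Theta'] Theta_has_derivative omega_pos by auto
  then have "\<bar>Theta omega\<bar> = omega * \<bar>Theta' z\<bar>" using omega_pos by (simp add: Theta_0 abs_mult)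
  also have "\<bar>Theta' z\<bar> \<le> 2 * k * (M - 2 * l) / (1 / (2 * M^2))"
  proof -
    have "1 / M \<le> y z" using mu_bounds[of z] mu_pos[of z] M by (simp add: y_def frac_le)
    then have "(1 / M)^2 \<le> (y z)^2" using M0 by (intro power_mono) auto
    moreover have "4 * k^2 \<le> 1 / (2 * M^2)" using k M0 by (simp add: field_simps)
    moreover have "1 / (2 * M^2) = (1 / M)^2 - 1 / (2 * M^2)" using M0 by (simp add: power_divide field_simps)
    ultimately have A2: "1 / (2 * M^2) \<le> (y z)^2 - 4 * k^2" by linarith
    have "\<bar>alpha z\<bar> \<le> M - 2 * l" using mu_bounds[of z] mu_pos[of z] M l_neg by (auto simp: alpha_def abs_le_iff)
    then have "\<bar>2 * k * alpha z\<bar> \<le> 2 * k * (M - 2 * l)" using k_pos by (simp add: abs_mult)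
    moreover have "0 < 1 / (2 * M^2)" using M0 by simp
    moreover have "\<bar>Theta' z\<bar> = \<bar>2 * k * alpha z\<bar> / ((y z)^2 - 4 * k^2)"
      using ne y_square_ge[of z] by (simp add: Theta'_def abs_divide)
    ultimately show ?thesis using A2 by (simp only:) (rule frac_le, auto)
  qed
  also have "omega * (2 * k * (M - 2 * l) / (1 / (2 * M^2))) \<le> 2 * pi / (e2 * sqrt (R e2)) * (2 * k * (M - 2 * l) / (1 / (2 * M^2)))"
    using omega_le k_pos M0 l_neg by (intro mult_right_mono) auto
  also have "\<dots> = 8 * pi * M^2 * (M - 2 * l) / e2 * (k / sqrt (R e2))"
    by (simp add: field_simps)
  finally show ?thesis using omega_pos by (simp add: mult_left_mono)
qed

end

context slice
begin

text \<open>By \<open>cofactor_e2\<close> this ratio controls \<open>k^2 / R e2\<close>. For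
  \<open>l < -1\<close> the quartic is nonzero at \<open>a_of l\<close>, where \<open>c\<close>
  vanishes; at \<open>l = -1\<close> both vanish.\<close>

lemma c_of_quartic_ratio_small:
  assumes l: "l \<le> -1" and eps: "eps > 0"
  shows "eventually (\<lambda>e. c_of l e / quartic l e < eps) (at_right (a_of l))"
proof (cases "l = -1")
  case False
  have "a_of l > 1"
  proof -
    have "l^2 > 1" using False l abs_square_less_1[of l] abs_square_eq_1[of l] by (smt (verit) abs_le_square_iff power_one)
    then have "sqrt (l^2 - 1) > 0" by simp
    then have "1 < sqrt (l^2 - 1) - l" using l by linarith
    then show ?thesis using l by (simp add: a_of_def)
  qed
  then have "1 < (a_of l)^2" by simp
  then have q: "quartic l (a_of l) \<noteq> 0" using l by (simp add: quartic_a_of)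
  have "isCont (c_of l) (a_of l)"
    using c_of_has_derivative[of "a_of l" l] \<open>a_of l > 1\<close> DERIV_isCont by fastforce
  moreover have "isCont (quartic l) (a_of l)"
    using continuous_on_quartic[of UNIV l] by (simp add: continuous_on_eq_continuous_at)
  ultimately have "isCont (\<lambda>e. c_of l e / quartic l e) (a_of l)" using q by (intro continuous_intros)
  then have "((\<lambda>e. c_of l e / quartic l e) \<longlongrightarrow> c_of l (a_of l) / quartic l (a_of l)) (at_right (a_of l))"
    unfolding isCont_def by (rule filterlim_mono) (auto simp: at_le)
  then show ?thesis using eps l by (intro order_tendstoD(2)) (auto simp: c_of_a_of)
next
  case True
  have a: "a_of l = 1" using True by (simp add: a_of_def)
  \<comment> \<open>At \<open>l = -1\<close> the point 1 is a double zero of \<open>c\<close> and a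
    simple zero of the quartic; \<open>f\<close> is the ratio with one factor \<open>x - 1\<close>
    cancelled.\<close>
  define f :: "real \<Rightarrow> real" where "f x = (x - 1) * (x^2 - 2 * x - 1) / (4 * x^2 * (x^3 - x^2 - x - 1))" for x
  have "isCont f 1" unfolding f_def[abs_def] by (intro continuous_intros) auto
  then have "(f \<longlongrightarrow> f 1) (at_right 1)"
    unfolding isCont_def by (rule filterlim_mono) (auto simp: at_le)
  then have "eventually (\<lambda>x. f x < eps) (at_right 1)"
    using eps order_tendstoD(2)[of f "f 1" _ eps] by (simp add: f_def[of 1])
  moreover have "eventually (\<lambda>x::real. x \<in> {1<..<2}) (at_right 1)" by (rule eventually_at_right_real) simp
  ultimately have "eventually (\<lambda>e. c_of l e / quartic l e < eps) (at_right 1)"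
  proof eventually_elim
    case (elim x)
    then have x: "x > 1" by simp
    have "c_of l x = (x - 1) * ((x - 1) * (x^2 - 2 * x - 1)) / (4 * x^2)"
      using x True by (simp add: c_of_def field_simps eval_nat_numeral)
    moreover have "quartic l x = (x - 1) * (x^3 - x^2 - x - 1)"
      using True by (simp add: quartic_def algebra_simps eval_nat_numeral)
    ultimately have "c_of l x / quartic l x = f x" using x by (simp add: f_def)
    then show ?case using elim by simp
  qed
  then show ?thesis by (simp add: a)
qed

text \<open>\<open>Psi omega = 2 * pi - Theta omega\<close> once \<open>e1 > - 2 * l\<close>, and
  \<open>Theta omega\<close> tends to 0 with \<open>c\<close>.\<close>

lemma rotation_near_full_turn:
  assumes l: "l \<le> -1" and q: "q > 1"
  shows "\<exists>e. a_of l < e \<and> e < hp \<and> rotation e < 2 * pi * q"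
proof -
  define M where "M = outer_root hm"
  define K where "K = 8 * pi * M^2 * (M - 2 * l) / hm * M"
  define eps where "eps = 2 * pi * (q - 1)"
  have M: "M > 0" using outer_root_ge[of hm] hm_less_hp hp_gt_0 by (simp add: M_def)
  have K: "K > 0" using M l_neg hm_gt_0 by (simp add: K_def)
  have eps: "eps > 0" using q by (simp add: eps_def)
  have cont: "continuous_on {a_of l..hp} (\<lambda>e. - c_of l e)"
    using a_of_bounds hm_gt_0 by (intro continuous_intros continuous_on_c_of) auto
  \<comment> \<open>The first bound puts \<open>e1\<close> above \<open>- 2 * l\<close>, so that
    \<open>Phi omega = 2 * pi\<close>; the second is the smallness of \<open>k\<close> required by
    \<open>Theta_period_bound\<close>.\<close>
  have "eventually (\<lambda>e. - c_of l e < min (1 / (16 * l^2)) (1 / (8 * M^2))) (at_right (a_of l))"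
    using l a_of_bounds M by (intro eventually_at_right_less[OF cont]) (auto simp: c_of_a_of)
  \<comment> \<open>Chosen so that \<open>K * sqrt (c / quartic l e / 2) < eps\<close>.\<close>
  moreover have "eventually (\<lambda>e. c_of l e / quartic l e < 2 * (eps / K)^2) (at_right (a_of l))"
    using l eps K by (intro c_of_quartic_ratio_small) auto
  moreover have "eventually (\<lambda>e. e \<in> {a_of l<..<hp}) (at_right (a_of l))"
    using a_of_bounds by (intro eventually_at_right_real) auto
  ultimately have "eventually (\<lambda>e. - c_of l e < min (1 / (16 * l^2)) (1 / (8 * M^2)) \<and>
      c_of l e / quartic l e < 2 * (eps / K)^2 \<and> e \<in> {a_of l<..<hp}) (at_right (a_of l))"
    by eventually_elim auto
  then obtain e where e: "- c_of l e < 1 / (16 * l^2)" "- c_of l e < 1 / (8 * M^2)"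
    "c_of l e / quartic l e < 2 * (eps / K)^2" "a_of l < e" "e < hp"
    using eventually_happens'[OF trivial_limit_at_right_real]
    by (metis (no_types, lifting) greaterThanLessThan_iff min_less_iff_conj)
  interpret timelike_orbit l e using e by (intro timelike_orbitI)
  have e1M: "e1 \<le> M" using outer_root_le[of hm e] e2_gt e2_less by (simp add: e1_def M_def)
  have "\<not> e1 < - 2 * l" "e1 \<noteq> - 2 * l"
    using outer_root_less_iff[of e] outer_root_eq_iff[of e] e2_gt e2_less e(1) by (auto simp: e1_def)
  then have gt: "e1 > - 2 * l" by simp
  have "8 * k^2 * M^2 \<le> 1" using e(2) M by (simp add: k_square c_def field_simps)
  with e1M gt have "\<bar>Theta omega\<bar> \<le> 8 * pi * M^2 * (M - 2 * l) / e * (k / sqrt (R e))"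
    by (intro Theta_period_bound) auto
  also have "\<dots> \<le> 8 * pi * M^2 * (M - 2 * l) / hm * (k / sqrt (R e))"
    using M l_neg hm_gt_0 e2_gt k_pos R_e2_pos by (intro mult_right_mono divide_left_mono) auto
  also have "\<dots> \<le> 8 * pi * M^2 * (M - 2 * l) / hm * (M * sqrt (c / quartic l e / 2))"
  proof (intro mult_left_mono)
    have g: "quartic l e < 0" using quartic_neg e2_gt e2_less by simp
    have R: "R e = - 2 * quartic l e / (e * (e1 - e))"
      unfolding e1_def using e2_gt e2_less by (intro cofactor_e2) auto
    have ee: "e * (e1 - e) > 0" using e2_pos e2_less_e1 by simp
    have "k^2 / R e = (c / quartic l e / 2) * (e * (e1 - e))"
      unfolding k_square R using g ee by (simp add: field_simps)
    also have "\<dots> \<le> (c / quartic l e / 2) * (M * M)"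
      using g c_neg ee e1M e2_less_e1 e2_pos M by (intro mult_left_mono mult_mono) (auto simp: zero_le_divide_iff)
    finally have "sqrt (k^2 / R e) \<le> sqrt ((c / quartic l e / 2) * (M * M))" by (rule real_sqrt_le_mono)
    then show "k / sqrt (R e) \<le> M * sqrt (c / quartic l e / 2)"
      using k_pos M by (simp add: real_sqrt_divide real_sqrt_mult mult.commute)
  qed (use M l_neg hm_gt_0 in auto)
  also have "\<dots> = K * sqrt (c / quartic l e / 2)" by (simp add: K_def)
  also have "\<dots> < K * (eps / K)"
  proof (intro mult_strict_left_mono K real_less_lsqrt)
    show "c / quartic l e / 2 < (eps / K)^2" using e(3) by (simp add: c_def)
  qed (use eps K in auto)
  finally have "\<bar>Theta omega\<bar> < eps" using K by simp
  then have "Psi omega < 2 * pi + eps" using Phi_period(2)[OF gt] by (simp add: Phi_def)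
  then have "rotation e < 2 * pi * q" by (simp add: rotation_eq eps_def algebra_simps)
  then show ?thesis using e by blast
qed

lemma rotation_attains:
  assumes "q \<in> J_interval l"
  shows "\<exists>e. a_of l < e \<and> e < hp \<and> rotation e = 2 * pi * q"
proof (cases "l \<le> -1")
  case True
  then have q: "1 < q" "q < chi l" using assms by (auto simp: J_interval_def)
  obtain b where b: "a_of l < b" "b < hp" "rotation b < 2 * pi * q"
    using rotation_near_full_turn[OF True q(1)] by blast
  have "2 * pi * q < rotation hp" using q by (simp add: rotation_hp)
  then have "\<exists>e\<ge>b. e \<le> hp \<and> rotation e = 2 * pi * q"
    using b by (intro IVT' continuous_on_rotation) auto
  then obtain e where e: "b \<le> e" "e \<le> hp" "rotation e = 2 * pi * q" by blast
  moreover have "e \<noteq> hp" using e(3) \<open>2 * pi * q < rotation hp\<close> by auto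
  ultimately show ?thesis using b by (intro exI[of _ e]) auto
next
  case False
  then have q: "chi l < q" using assms by (auto simp: J_interval_def)
  have a: "a_of l = hm" using False by (simp add: a_of_def)
  obtain b where b: "a_of l < b" "b < hp" "rotation b > 2 * pi * q"
    using rotation_unbounded[of "2 * pi * q"] False unfolding a by auto
  have "2 * pi * q > rotation hp" using q by (simp add: rotation_hp)
  then have "\<exists>e\<ge>b. e \<le> hp \<and> rotation e = 2 * pi * q"
    using b by (intro IVT2' continuous_on_rotation) auto
  then obtain e where e: "b \<le> e" "e \<le> hp" "rotation e = 2 * pi * q" by blast
  moreover have "e \<noteq> hp" using e(3) \<open>2 * pi * q > rotation hp\<close> by auto
  ultimately show ?thesis using b by (intro exI[of _ e]) auto
qed

end

theorem theorem4p5: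
  fixes l q :: real
  assumes "l < -2 / root 4 27"
    and "q \<in> J_interval l" and "q \<in> \<rat>"
  shows "\<exists>e2. (l, e2) \<in> moduli_T \<and>
           BT_string (standard_BT_curve (l, e2)) \<and>
           period_map (l, e2) = q"
proof -
  interpret slice l by unfold_locales (rule assms(1))
  obtain e where e: "a_of l < e" "e < eta_plus l" "rotation e = 2 * pi * q"
    using rotation_attains[OF assms(2)] by blast
  interpret timelike_orbit l e using e by (intro timelike_orbitI)
  have "Psi omega = 2 * pi * q" using e rotation_eq by simp
  then show ?thesis
    using moduli_T_e2 BT_string[OF assms(3)] by (intro exI[of _ e]) (simp add: period_map_eq)
qed

end
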